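(* Let $f\in V\hat{A}$ be an element of infinite order. Then the infinite cyclic subgroup $\langle f\rangle$ is undistorted in $V\hat{A}$. That is, for a fixed finite generating set of $V\hat{A}$ with word length $\ell$, there is a constant $C>0$ such that $|k|\le C\,\ell(f^k)+C$ for all integers $k$.
   Context: Let $\mathfrak C=\{0,1\}^{\mathbb N}$ be the Cantor set, and let $\phi:\mathfrak C\to[0,1]$ be the map $(x_1,x_2,\dots)\mapsto\sum_i x_i2^{-i}$. Points of $\mathfrak C$ are labelled by real numbers in $[0,1]$. A non-dyadic number has a unique preimage under $\phi$. A dyadic $p\in(0,1)$ has two preimages: $p^-$, whose binary sequence is eventually $1$, and $p^+$, whose binary sequence is eventually $0$. We also write $0^+$ for the all-zero sequence and $1^-$ for the all-one sequence. A one-sided neighborhood of $p^+$ means a set of points with labels in $[p,p+\varepsilon)$ (taking $p^+$ at $p$), and similarly a one-sided neighborhood of $p^-$ corresponds to $(p-\varepsilon,p]$. Thompson's group $V$ is the group of bijections $f$ of $\mathfrak C$ satisfying the following: when drawn as maps $[0,1]\to[0,1]$, they are piecewise linear with finitely many pieces; each piece has slope an integer power of $2$; and each piece starts and ends at points with dyadic coordinates. Brin's group $\hat A$ is the group of homeomorphisms $f$ of $[0,1]$ satisfying the following: - $f(0)=0$ and $f(1)=1$; - $f$ is piecewise linear with slopes powers of $2$ and dyadic breakpoints, where breakpoints may accumulate only at $0$ and $1$; - $f(2x)=2f(x)$ in a neighborhood of $0$; - $f(2x-1)=2f(x)-1$ in a neighborhood of $1$. Elements of $\hat A$ act on $\mathfrak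 C$ via $f(p^\pm)=f(p)^\pm$. The Belk–Hyde–Matucci group $V\hat{A}$ is the group of bijections of $\mathfrak C$ generated by $V$ and $\hat A$. It is finitely generated. It equals the set of bijections $f$ of $\mathfrak C$ such that: - $f$ is piecewise linear with slopes powers of $2$ and pieces beginning and ending at points with dyadic coordinates, where breakpoints may accumulate only at finitely many points, called singularities; - each singularity has the form $p^+$ or $p^-$ with $p$ dyadic, and its image has the form $q^+$ or $q^-$ respectively, with the same sign; - if $f(p^\pm)=q^\pm$ is the image of a singularity, then on a sufficiently small one-sided neighborhood of $p^\pm$ (called a regular neighborhood), $f$ is continuous as a map on $[0,1]$ and satisfies $f\circ L_p=L_q\circ f$, where $L_r(x)=2(x-r)+r$. $\mathrm{Sing}(f)$ denotes the finite set of singularities of $f$. The elements with no singularities are exactly the elements of $V$. Products are written as $fg=g\circ f$. A finitely generated subgroup $H$ of a finitely generated group $G$ is undistorted if, for fixed finite generating sets with word lengths $\ell_H$ and $\ell_G$, there is a constant $C$ with $\ell_H(h)\le C\ell_G(h)+C$ for all $h\in H$. *)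

theory Defs
  imports "HOL-Analysis.Analysis"
begin

type_synonym cantor = "nat \<Rightarrow> bool"

definition phi :: "cantor \<Rightarrow> real" where
  "phi x = (\<Sum>i. (if x i then 1 else 0) / 2 ^ Suc i)"

definition dyadic :: "real \<Rightarrow> bool" where
  "dyadic r \<longleftrightarrow> (\<exists>(a::int) (n::nat). r = real_of_int a / 2 ^ n)"

text \<open>Eventually-zero sequences: these are the points 0^+ and p^+ (p dyadic).\<close>
definition ev0 :: "cantor \<Rightarrow> bool" where
  "ev0 x \<longleftrightarrow> (\<exists>N. \<forall>i\<ge>N. \<not> x i)"

definition cat :: "bool list \<Rightarrow> cantor \<Rightarrow> cantor" where
  "cat u w = (\<lambda>i. if i < length u then u ! i else w (i - length u))"

definition is_prefix :: "bool list \<Rightarrow> cantor \<Rightarrow> bool" where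
  "is_prefix u x \<longleftrightarrow> (\<forall>i<length u. x i = u ! i)"

text \<open>Thompson's group V: maps given by a bijection between two complete finite prefix codes
  (i.e. two partitions of the Cantor set into standard dyadic cones), acting by prefix
  replacement u w \<mapsto> v w.  These are exactly the bijections which, drawn on [0,1], are
  piecewise linear with finitely many pieces, slopes powers of 2 and dyadic endpoints.\<close>
definition thompsonV :: "(cantor \<Rightarrow> cantor) \<Rightarrow> bool" where
  "thompsonV f \<longleftrightarrow> (\<exists>ps :: (bool list \<times> bool list) list.
      (\<forall>x. \<exists>!i. i < length ps \<and> is_prefix (fst (ps ! i)) x) \<and>
      (\<forall>y. \<exists>!i. i < length ps \<and> is_prefix (snd (ps ! i)) y) \<and>
      (\<forall>i<length ps. \<forall>w. f (cat (fst (ps ! i)) w) = cat (snd (ps ! i)) w))"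

text \<open>Brin's group \<^emph>\<open>hat A\<close> as maps of the reals (only the values on [0,1] matter).
  Local piecewise linearity at interior points expresses that breakpoints accumulate only at 0 and 1.\<close>
definition brinA :: "(real \<Rightarrow> real) \<Rightarrow> bool" where
  "brinA h \<longleftrightarrow>
     h 0 = 0 \<and> h 1 = 1 \<and>
     (\<exists>g. homeomorphism {0..1} {0..1} h g) \<and>
     (\<forall>x\<in>{0<..<1}. \<exists>\<epsilon>>0. \<exists>m n :: int.
         (\<forall>y\<in>{x..x+\<epsilon>}. h y = h x + 2 powr (real_of_int m) * (y - x)) \<and>
         (\<forall>y\<in>{x-\<epsilon>..x}. h y = h x + 2 powr (real_of_int n) * (y - x)) \<and>
         (m \<noteq> n \<longrightarrow> dyadic x \<and> dyadic (h x))) \<and>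
     (\<exists>\<epsilon>>0. \<forall>x\<in>{0..\<epsilon>}. h (2 * x) = 2 * h x) \<and>
     (\<exists>\<epsilon>>0. \<forall>x\<in>{1-\<epsilon>..1}. h (2 * x - 1) = 2 * h x - 1)"

text \<open>Action of h on the Cantor set: f(p^\<pm>) = f(p)^\<pm>; for non-dyadic points the preimage is unique.\<close>
definition brin_act :: "(real \<Rightarrow> real) \<Rightarrow> cantor \<Rightarrow> cantor" where
  "brin_act h x = (THE y. phi y = h (phi x) \<and> (ev0 y \<longleftrightarrow> ev0 x))"

inductive_set VA :: "(cantor \<Rightarrow> cantor) set" where
  V: "thompsonV f \<Longrightarrow> f \<in> VA"
| A: "brinA h \<Longrightarrow> brin_act h \<in> VA"
| comp: "f \<in> VA \<Longrightarrow> g \<in> VA \<Longrightarrow> g \<circ> f \<in> VA"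
| inverse: "f \<in> VA \<Longrightarrow> inv f \<in> VA"

fun eval_word :: "(bool \<times> (cantor \<Rightarrow> cantor)) list \<Rightarrow> cantor \<Rightarrow> cantor" where
  "eval_word [] = id"
| "eval_word ((b, s) # w) = eval_word w \<circ> (if b then s else inv s)"

definition generates_VA :: "(cantor \<Rightarrow> cantor) set \<Rightarrow> bool" where
  "generates_VA S \<longleftrightarrow> S \<subseteq> VA \<and>
     (\<forall>g\<in>VA. \<exists>w. set (map snd w) \<subseteq> S \<and> eval_word w = g)"

definition word_length :: "(cantor \<Rightarrow> cantor) set \<Rightarrow> (cantor \<Rightarrow> cantor) \<Rightarrow> nat" where
  "word_length S g = (LEAST n. \<exists>w. length w = n \<and> set (map snd w) \<subseteq> S \<and> eval_word w = g)"

definition ipow :: "(cantor \<Rightarrow> cantor) \<Rightarrow> int \<Rightarrow> cantor \<Rightarrow> cantor" where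
  "ipow f k = (if 0 \<le> k then f ^^ nat k else inv f ^^ nat (- k))"

end

theory Submission
  imports Defs
begin

text \<open>Two quantities are subadditive up to a constant factor under word length: the number of
  singularities, and the logarithm of the bi-Lipschitz constant for the standard ultrametric on
  the Cantor set. For every f of infinite order one of them grows linearly along the powers of f.
  At a fixed singularity the self-similarity and the monotonicity of the germ show that, unless f
  is trivial there, orbits converge exponentially fast to the singularity or to a nearby fixed
  point with slope different from 1. So after passing to a power all singularities lie on
  infinite orbits. Follow such an orbit from its first to its last singularity: if the composed
  germ is singular, the number of singularities of the n-th power grows linearly; otherwise an
  induced map of f is an element of V of infinite order, and the pigeonhole principle applied to
  the slopes along its orbits yields a periodic point with slope different from 1.\<close>

section \<open>Words and sequences\<close>

text \<open>There are two obstructions to a short word. If distinct x and y are such that f^k x and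
  f^k y agree in k digits for every k, then a word for f^K, read backwards, has to pull points apart
  by about K digits, while each letter contributes boundedly many. Monotonicity of a germ alone
  gives no such rate, since orbits could approach a fixed point arbitrarily slowly; commuting with
  doubling at the point turns one gained digit into one digit per fixed number of steps. Counting
  singularities meets another obstacle: singularities on one orbit can cancel in the powers, so the
  composite over a whole stretch has to be examined. If it is regular, f may still be singular along
  the stretch, and the induced map jumps over it in one step. The argument takes place in the class
  \<open>G\<close>, which is given by bijectivity and local conditions, is closed under composition
  and inversion, and contains \<open>VA\<close>. The fan theorem turns local data into uniform
  constants; sums over all words of one length replace maxima.\<close>

definition pre :: "nat \<Rightarrow> cantor \<Rightarrow> bool list" where
  "pre n x = map x [0..<n]"

definition sdrop :: "nat \<Rightarrow> cantor \<Rightarrow> cantor" where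
  "sdrop n x = (\<lambda>i. x (i + n))"

definition agree :: "nat \<Rightarrow> cantor \<Rightarrow> cantor \<Rightarrow> bool" where
  "agree n x y \<longleftrightarrow> (\<forall>i<n. x i = y i)"

abbreviation cst :: "bool \<Rightarrow> cantor" where
  "cst c \<equiv> (\<lambda>_. c)"

lemma length_pre [simp]: "length (pre n x) = n"
  by (simp add: pre_def)

lemma cat_Nil [simp]: "cat [] w = w"
  by (simp add: cat_def)

lemma cat_append [simp]: "cat (a @ b) w = cat a (cat b w)"
  by (rule ext) (auto simp: cat_def nth_append)

lemma cat_pre_sdrop [simp]: "cat (pre n x) (sdrop n x) = x"
  by (rule ext) (auto simp: cat_def pre_def sdrop_def)

lemma sdrop_cat [simp]: "sdrop (length a) (cat a w) = w"
  by (rule ext) (auto simp: cat_def sdrop_def)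

lemma cat_inject [simp]: "cat a w = cat a w' \<longleftrightarrow> w = w'"
  by (metis sdrop_cat)

lemma pre_cat [simp]: "pre (length a) (cat a w) = a"
  by (rule nth_equalityI) (auto simp: cat_def pre_def)

lemma cat_eq_same_length: "length a = length b \<Longrightarrow> cat a w = cat b w' \<longleftrightarrow> a = b \<and> w = w'"
  by (metis pre_cat sdrop_cat)

lemma cat_eq_le:
  assumes "cat a w = cat b w'" "length a \<le> length b"
  obtains t where "b = a @ t" "w = cat t w'"
proof -
  have "cat (take (length a) b) (cat (drop (length a) b) w') = cat b w'"
    by (metis append_take_drop_id cat_append)
  then have "cat a w = cat (take (length a) b) (cat (drop (length a) b) w')"
    using assms by simp
  then have "a = take (length a) b" "w = cat (drop (length a) b) w'"
    using assms(2) cat_eq_same_length[of a "take (length a) b"] by simp_all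
  then show ?thesis
    using that by (metis append_take_drop_id)
qed

lemma is_prefix_iff: "is_prefix u x \<longleftrightarrow> (\<exists>w. x = cat u w)"
proof
  assume "is_prefix u x"
  then have "x = cat u (sdrop (length u) x)"
    by (intro ext) (auto simp: is_prefix_def cat_def sdrop_def)
  then show "\<exists>w. x = cat u w" by blast
qed (auto simp: is_prefix_def cat_def)

section \<open>Agreement of sequences on initial segments\<close>

lemma agree_refl [simp]: "agree n x x"
  by (simp add: agree_def)

lemma agree_sym: "agree n x y \<Longrightarrow> agree n y x"
  by (simp add: agree_def)

lemma agree_trans: "agree n x y \<Longrightarrow> agree n y z \<Longrightarrow> agree n x z"
  by (simp add: agree_def)

lemma agree_mono: "agree n x y \<Longrightarrow> m \<le> n \<Longrightarrow> agree m x y"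
  by (simp add: agree_def)

lemma agree_0 [simp]: "agree 0 x y"
  by (simp add: agree_def)

lemma agree_all: "(\<And>n. agree n x y) \<Longrightarrow> x = y"
  unfolding agree_def by blast

lemma agree_cat: "agree (length a) (cat a w) (cat a w')"
  by (simp add: agree_def cat_def)

lemma agree_cat_iff [simp]: "agree (length a + n) (cat a w) (cat a w') \<longleftrightarrow> agree n w w'"
proof
  assume "agree (length a + n) (cat a w) (cat a w')"
  then have "w i = w' i" if "i < n" for i
    unfolding agree_def cat_def using that by (auto dest: spec[of _ "length a + i"])
  then show "agree n w w'" by (simp add: agree_def)
qed (auto simp: agree_def cat_def)

lemma agree_catI: "agree n w w' \<Longrightarrow> agree n (cat a w) (cat a w')"
  by (rule agree_mono[of "length a + n"]) auto

lemma agree_cat_ex: "agree (length a) (cat a w) y \<Longrightarrow> \<exists>w'. y = cat a w'"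
  unfolding is_prefix_iff[symmetric] by (simp add: is_prefix_def agree_def cat_def)

lemma agree_pre: "agree n x y \<longleftrightarrow> pre n x = pre n y"
  by (auto simp: agree_def pre_def)

lemma pre_extend:
  assumes "n \<le> m" obtains b where "pre m x = pre n x @ b"
proof -
  have "pre m x = pre n x @ map x [n..<m]"
    unfolding pre_def using upt_add_eq_append[of 0 n "m-n"] assms by auto
  then show ?thesis using that by blast
qed

lemma cat_replicate_cst [simp]: "cat (replicate n c) (cst c) = cst c"
  by (rule ext) (auto simp: cat_def)

lemma cat_singleton: "cat [c] w = (\<lambda>i. case i of 0 \<Rightarrow> c | Suc j \<Rightarrow> w j)"
  by (rule ext) (auto simp: cat_def split: nat.split)

lemma cat_Cons: "cat (c # u) w = cat [c] (cat u w)"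
  using cat_append[of "[c]" u w] by simp

lemma cat_cst [simp]: "cat [c] (cst c) = cst c"
  using cat_replicate_cst[of 1 c] by simp

lemma cat_eq_cst: "cat u w = cst c \<longleftrightarrow> u = replicate (length u) c \<and> w = cst c"
  using cat_eq_same_length[of u "replicate (length u) c" w "cst c"] by simp

lemma cst_cat_eq_cst:
  assumes "cat u (cst c) = cat v (cst d)"
  shows "c = d"
proof -
  have "cat u (cst c) (length u + length v) = cat v (cst d) (length u + length v)"
    using assms by simp
  then show ?thesis by (simp add: cat_def)
qed

lemma cst_tail_cases:
  assumes "cat u (cst c) = cat v (cst c)" "length u \<le> length v"
  obtains i where "v = u @ replicate i c"
proof -
  obtain t where "v = u @ t" "cst c = cat t (cst c)"
    using cat_eq_le[OF assms] by blast
  then show ?thesis using that cat_eq_cst[of t "cst c" c] by metis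
qed

lemma cantor_cases:
  obtains c w where "x = cat [c] w"
  using cat_pre_sdrop[of 1 x] by (metis length_pre length_Suc_conv One_nat_def length_0_conv)

lemma not_cst_split:
  assumes "w \<noteq> cst c"
  obtains i t where "w = cat (replicate i c) (cat [\<not> c] t)"
proof -
  have ex: "\<exists>i. w i \<noteq> c" using assms by auto
  define i where "i = (LEAST i. w i \<noteq> c)"
  have i: "w i \<noteq> c" "\<And>j. j < i \<Longrightarrow> w j = c"
    unfolding i_def using LeastI_ex[OF ex] not_less_Least by blast+
  have "w = cat (replicate i c) (cat [\<not> c] (sdrop (Suc i) w))"
  proof
    fix j
    show "w j = cat (replicate i c) (cat [\<not> c] (sdrop (Suc i) w)) j"
      using i by (cases "j < i"; cases "j = i") (auto simp: cat_def sdrop_def)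
  qed
  then show ?thesis using that by blast
qed

text \<open>Compactness of the Cantor set, in the form of the fan theorem.\<close>

lemma fan:
  assumes mono: "\<And>a b. P a \<Longrightarrow> P (a @ b)"
    and bar: "\<And>x. \<exists>n. P (pre n x)"
  obtains N where "\<And>a. length a \<ge> N \<Longrightarrow> P a"
proof -
  \<comment> \<open>Koenig's argument: badness passes to one of the two extensions by a digit, so a
    bad empty word would yield a sequence all of whose prefixes are bad.\<close>
  define bad where "bad a \<longleftrightarrow> (\<forall>N. \<exists>b. length b \<ge> N \<and> \<not> P (a @ b))" for a
  have step: "\<exists>c. bad (a @ [c])" if "bad a" for a
  proof (rule ccontr)
    assume "\<not> ?thesis"
    then obtain NT NF where N: "\<And>b. length b \<ge> NT \<Longrightarrow> P (a @ [True] @ b)"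
      "\<And>b. length b \<ge> NF \<Longrightarrow> P (a @ [False] @ b)"
      unfolding bad_def by (metis append_assoc)
    obtain b where b: "length b \<ge> Suc (NT + NF)" "\<not> P (a @ b)"
      using \<open>bad a\<close> unfolding bad_def by blast
    then obtain c b' where "b = c # b'" by (cases b) auto
    then show False using N[of b'] b by (cases c) auto
  qed
  have "\<not> bad []"
  proof
    assume "bad []"
    define s where "s = rec_nat [] (\<lambda>_ a. a @ [SOME c. bad (a @ [c])])"
    have s0: "s 0 = []" and sS: "\<And>n. s (Suc n) = s n @ [SOME c. bad (s n @ [c])]"
      by (simp_all add: s_def)
    have bad_s: "bad (s n)" for n
    proof (induction n)
      case 0 then show ?case using \<open>bad []\<close> s0 by simp
    next
      case (Suc n) then show ?case using step someI_ex[of "\<lambda>c. bad (s n @ [c])"] sS by simp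
    qed
    define x where "x i = last (s (Suc i))" for i
    have "pre n x = s n" for n
      by (induction n) (auto simp: pre_def s0 sS x_def)
    then obtain n where "P (s n)" using bar[of x] by auto
    then show False using bad_s[of n] mono unfolding bad_def by blast
  qed
  then show ?thesis using that unfolding bad_def by auto
qed

lemma finite_words: "finite {a :: bool list. length a = n}"
  using finite_lists_length_eq[of "UNIV :: bool set" n] by simp

lemma card_words: "card {a :: bool list. length a = n} = 2 ^ n"
  using card_lists_length_eq[of "UNIV :: bool set" n] by simp

section \<open>Lipschitz maps\<close>

text \<open>For the metric in which two sequences that first differ at position n are at distance
  2 to the power -n, this says that the map is Lipschitz with constant 2 to the power B.\<close>

definition lip :: "nat \<Rightarrow> (cantor \<Rightarrow> cantor) \<Rightarrow> bool" where
  "lip B f \<longleftrightarrow> (\<forall>n x y. agree (n + B) x y \<longrightarrow> agree n (f x) (f y))"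

lemma lipD: "lip B f \<Longrightarrow> agree (n + B) x y \<Longrightarrow> agree n (f x) (f y)"
  by (simp add: lip_def)

lemma lip_id: "lip 0 id"
  by (simp add: lip_def)

lemma lip_mono: "lip B f \<Longrightarrow> B \<le> C \<Longrightarrow> lip C f"
  unfolding lip_def by (meson agree_mono add_left_mono)

lemma lip_comp: "lip B f \<Longrightarrow> lip C g \<Longrightarrow> lip (B + C) (g \<circ> f)"
  unfolding lip_def by (metis comp_apply add.assoc add.commute)

lemma lip_funpow: "lip B f \<Longrightarrow> lip (n * B) (f ^^ n)"
proof (induction n)
  case 0 then show ?case using lip_id by (simp add: id_def)
next
  case (Suc n)
  then have "lip (n * B + B) (f \<circ> f ^^ n)" by (intro lip_comp)
  then show ?case by (simp add: add.commute comp_def)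
qed

text \<open>Compactness: one depth \<open>N\<close> serves all cones, and the sum of the constants
  over the words of length \<open>N\<close> bounds each of them. The summand \<open>N\<close> in the
  final constant forces the two points into a common cone.\<close>

lemma lip_if_locally_lip:
  assumes "\<And>x. \<exists>k B. \<forall>n w w'. agree (n + B) w w' \<longrightarrow> agree n (H (cat (pre k x) w)) (H (cat (pre k x) w'))"
  obtains B where "lip B H"
proof -
  define P where "P a \<longleftrightarrow> (\<exists>B. \<forall>n w w'. agree (n + B) w w' \<longrightarrow> agree n (H (cat a w)) (H (cat a w')))" for a
  have "P (a @ b)" if "P a" for a b
    using that unfolding P_def by (metis agree_catI cat_append)
  moreover have "\<exists>n. P (pre n x)" for x
    using assms[of x] unfolding P_def by blast
  ultimately obtain N where N: "\<And>a. length a \<ge> N \<Longrightarrow> P a"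
    using fan by metis
  define B where "B a = (SOME B. \<forall>n w w'. agree (n + B) w w' \<longrightarrow> agree n (H (cat a w)) (H (cat a w')))" for a
  have B: "agree n (H (cat a w)) (H (cat a w'))" if "agree (n + B a) w w'" "length a = N" for a n w w'
    using someI_ex[OF N[unfolded P_def, of a]] that unfolding B_def by simp
  have "lip (N + (\<Sum>a | length a = N. B a)) H"
    unfolding lip_def
  proof (intro allI impI)
    fix n x y
    assume ag: "agree (n + (N + (\<Sum>a | length a = N. B a))) x y"
    let ?a = "pre N x"
    have x: "x = cat ?a (sdrop N x)" by simp
    have "pre N x = pre N y" using ag agree_pre agree_mono by (metis le_add1 le_add2 le_trans)
    then have y: "y = cat ?a (sdrop N y)" by simp
    have "B ?a \<le> (\<Sum>a | length a = N. B a)"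
      by (rule member_le_sum) (auto simp: finite_words)
    then have "agree (length ?a + (n + B ?a)) x y"
      using ag by (auto intro: agree_mono)
    then have "agree (n + B ?a) (sdrop N x) (sdrop N y)"
      using x y agree_cat_iff by metis
    then show "agree n (H x) (H y)" using B[of n ?a] x y by (metis length_pre)
  qed
  then show ?thesis using that by blast
qed

section \<open>Regular points\<close>

text \<open>This is local membership in V. The two sides of a dyadic breakpoint are different points
  of the Cantor set, so the breakpoints of an element of V are regular from both sides.\<close>

definition regular :: "(cantor \<Rightarrow> cantor) \<Rightarrow> cantor \<Rightarrow> bool" where
  "regular f x \<longleftrightarrow> (\<exists>u v. is_prefix u x \<and> (\<forall>w. f (cat u w) = cat v w))"

definition sing :: "(cantor \<Rightarrow> cantor) \<Rightarrow> cantor set" where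
  "sing f = {x. \<not> regular f x}"

lemma regularI: "(\<And>w. f (cat u w) = cat v w) \<Longrightarrow> regular f (cat u z)"
  unfolding regular_def is_prefix_iff by blast

lemma regularE:
  assumes "regular f x"
  obtains u v z where "x = cat u z" "f x = cat v z" "\<And>w. f (cat u w) = cat v w"
  using assms unfolding regular_def is_prefix_iff by metis

text \<open>Prefix replacement on a cone restricts to prefix replacement on every smaller cone, so
  any sufficiently long prefix of x can be used.\<close>

lemma regular_deep:
  assumes "regular f x"
  obtains N where "\<And>n. n \<ge> N \<Longrightarrow> \<exists>v. f x = cat v (sdrop n x) \<and> (\<forall>w. f (cat (pre n x) w) = cat v w)"
proof -
  obtain u v z where *: "x = cat u z" "f x = cat v z" "\<And>w. f (cat u w) = cat v w"
    using assms by (blast elim: regularE)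
  have "\<exists>v. f x = cat v (sdrop n x) \<and> (\<forall>w. f (cat (pre n x) w) = cat v w)" if n: "n \<ge> length u" for n
  proof -
    obtain b where "pre n x = u @ b" using pre_extend[OF n, of x] *(1) by auto
    then have "\<forall>w. f (cat (pre n x) w) = cat (v @ b) w" using * by simp
    then show ?thesis by (metis cat_pre_sdrop)
  qed
  then show ?thesis using that by blast
qed

lemma regular_open:
  assumes "regular f x"
  obtains n where "\<And>y. agree n x y \<Longrightarrow> regular f y"
proof -
  obtain u v z where *: "x = cat u z" "\<And>w. f (cat u w) = cat v w"
    using assms by (blast elim: regularE)
  then show ?thesis using that[of "length u"] agree_cat_ex regularI by metis
qed

lemma regular_cong:
  assumes "regular f x" "\<And>y. agree n x y \<Longrightarrow> g y = f y"
  shows "regular g x"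
proof -
  obtain N where N: "\<And>n. n \<ge> N \<Longrightarrow> \<exists>v. f x = cat v (sdrop n x) \<and> (\<forall>w. f (cat (pre n x) w) = cat v w)"
    using regular_deep assms(1) by metis
  let ?n = "max N n"
  obtain v where v: "\<And>w. f (cat (pre ?n x) w) = cat v w" using N[of ?n] by auto
  have "agree n x (cat (pre ?n x) w)" for w
    using agree_cat[of "pre ?n x" "sdrop ?n x" w] by (auto intro: agree_mono)
  then have "g (cat (pre ?n x) w) = cat v w" for w using v assms(2) by metis
  then show ?thesis using regularI[of g "pre ?n x" v "sdrop ?n x"] by simp
qed

lemma regular_id: "regular id x"
  using regularI[of id "[]" "[]" x] by simp

lemma regular_comp:
  assumes "regular f x" "regular g (f x)"
  shows "regular (g \<circ> f) x"
proof -
  obtain u v z where f: "x = cat u z" "f x = cat v z" "\<And>w. f (cat u w) = cat v w"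
    using assms(1) by (blast elim: regularE)
  obtain u' v' z' where g: "f x = cat u' z'" "\<And>w. g (cat u' w) = cat v' w"
    using regularE[OF assms(2)] by metis
  show ?thesis
  proof (cases "length u' \<le> length v")
    case True
    then obtain t where "v = u' @ t" using cat_eq_le f(2) g(1) by metis
    then have "(g \<circ> f) (cat u w) = cat (v' @ t) w" for w using f g by simp
    then show ?thesis using regularI f(1) by metis
  next
    case False
    then obtain t where t: "u' = v @ t" "z = cat t z'" using cat_eq_le f(2) g(1) by (metis nle_le)
    then have "(g \<circ> f) (cat (u @ t) w) = cat v' w" for w using f g(2)[of w] by simp
    then show ?thesis using regularI[of "g \<circ> f" "u @ t"] f(1) t by simp
  qed
qed

lemma regular_inv:
  assumes "inj f" "regular f x"
  shows "regular (inv f) (f x)"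
proof -
  obtain u v z where f: "x = cat u z" "f x = cat v z" "\<And>w. f (cat u w) = cat v w"
    using assms(2) by (blast elim: regularE)
  have "inv f (cat v w) = cat u w" for w using f(3) assms(1) by (metis inv_f_f)
  then show ?thesis using regularI f(2) by metis
qed

lemma regular_funpow:
  "(\<And>t. t < n \<Longrightarrow> regular f ((f ^^ t) x)) \<Longrightarrow> regular (f ^^ n) x"
proof (induction n)
  case 0 then show ?case using regular_id by (simp add: id_def)
next
  case (Suc n)
  then have "regular (f \<circ> f ^^ n) x" by (intro regular_comp) auto
  then show ?case by (simp add: comp_def)
qed

lemma sing_comp: "sing (g \<circ> f) \<subseteq> sing f \<union> f -` sing g"
  unfolding sing_def using regular_comp by blast

lemma id_near_regular:
  assumes "\<And>y. agree n x y \<Longrightarrow> f y = y"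
  shows "regular f x"
  using regular_cong[OF regular_id, of n x f] assms by simp

section \<open>Self-similar germs\<close>

text \<open>The lexicographic order if c is False, its reverse if c is True;
  in both cases the constant sequence c is the least element.\<close>

definition lt :: "bool \<Rightarrow> cantor \<Rightarrow> cantor \<Rightarrow> bool" where
  "lt c x y \<longleftrightarrow> (\<exists>i. (\<forall>j<i. x j = y j) \<and> x i = c \<and> y i \<noteq> c)"

lemma lt_irrefl [simp]: "\<not> lt c x x"
  by (auto simp: lt_def)

lemma lt_trans:
  assumes "lt c x y" "lt c y z" shows "lt c x z"
proof -
  obtain i j where i: "\<forall>k<i. x k = y k" "x i = c" "y i \<noteq> c"
    and j: "\<forall>k<j. y k = z k" "y j = c" "z j \<noteq> c"
    using assms unfolding lt_def by blast
  have "(\<forall>k<min i j. x k = z k) \<and> x (min i j) = c \<and> z (min i j) \<noteq> c"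
    using i j by (cases i j rule: linorder_cases) (auto simp: min_def)
  then show ?thesis unfolding lt_def by blast
qed

lemma lt_linear: "lt c x y \<or> x = y \<or> lt c y x"
proof (cases "x = y")
  case False
  then have ex: "\<exists>i. x i \<noteq> y i" by auto
  define i where "i = (LEAST i. x i \<noteq> y i)"
  have "x i \<noteq> y i" "\<forall>j<i. x j = y j"
    unfolding i_def using LeastI_ex[OF ex] not_less_Least by blast+
  then show ?thesis unfolding lt_def by metis
qed auto

lemma lt_cat [simp]: "lt c (cat a w) (cat a w') \<longleftrightarrow> lt c w w'"
proof
  assume "lt c (cat a w) (cat a w')"
  then obtain i where i: "\<forall>j<i. cat a w j = cat a w' j" "cat a w i = c" "cat a w' i \<noteq> c"
    unfolding lt_def by blast
  then have "i \<ge> length a" by (auto simp: cat_def split: if_splits)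
  have at: "cat a z (j + length a) = z j" for j z by (simp add: cat_def)
  have "w j = w' j" if "j < i - length a" for j
    using i(1) that at[of w j] at[of w' j] by (metis less_diff_conv)
  moreover have "w (i - length a) = c" "w' (i - length a) \<noteq> c"
    using i at[of w "i - length a"] at[of w' "i - length a"] \<open>i \<ge> length a\<close> by auto
  ultimately have "(\<forall>j<i - length a. w j = w' j) \<and> w (i - length a) = c \<and> w' (i - length a) \<noteq> c"
    by blast
  then show "lt c w w'" unfolding lt_def by blast
next
  assume "lt c w w'"
  then obtain i where i: "\<forall>j<i. w j = w' j" "w i = c" "w' i \<noteq> c"
    unfolding lt_def by blast
  have "cat a w j = cat a w' j" if "j < i + length a" for j
    using i(1) that by (cases "j < length a") (simp_all add: cat_def less_diff_conv2)
  moreover have "cat a w (i + length a) = c" "cat a w' (i + length a) \<noteq> c"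
    using i by (simp_all add: cat_def)
  ultimately have "(\<forall>j<i + length a. cat a w j = cat a w' j) \<and> cat a w (i + length a) = c \<and> cat a w' (i + length a) \<noteq> c"
    by blast
  then show "lt c (cat a w) (cat a w')" unfolding lt_def by blast
qed

lemma not_lt_cst [simp]: "\<not> lt c w (cst c)"
  by (auto simp: lt_def)

text \<open>Cones are order-convex: if x left the cone, both comparisons would be decided inside
  \<open>a\<close>, where the two bounds coincide, and in opposite directions.\<close>

lemma lt_cat_between:
  assumes "lt c (cat a w) x" "lt c x (cat a w')"
  shows "\<exists>z. x = cat a z"
proof -
  obtain i j where i: "\<forall>k<i. cat a w k = x k" "cat a w i = c" "x i \<noteq> c"
    and j: "\<forall>k<j. x k = cat a w' k" "x j = c" "cat a w' j \<noteq> c"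
    using assms unfolding lt_def by blast
  have "i \<ge> length a \<or> j \<ge> length a"
  proof (rule ccontr)
    assume "\<not> ?thesis"
    then show False using i j by (cases i j rule: linorder_cases) (auto simp: cat_def)
  qed
  then have "agree (length a) (cat a w) x \<or> agree (length a) (cat a w') x"
    using i(1) j(1) by (auto simp: agree_def)
  then show ?thesis using agree_cat_ex by blast
qed

text \<open>The one-sided neighbourhood is the cone of \<open>u\<close>; \<open>c\<close> = False is
  a point p^+, \<open>c\<close> = True a point p^-, and the common \<open>c\<close> keeps the sign.
  Prepending \<open>c\<close> halves the distance to the centre, so the second clause is the
  relation between f and the doublings L_p, L_q. Monotonicity takes the place of continuity on
  [0,1], and the last clause makes the centre the one possible singularity in the cone.\<close>

definition germ :: "(cantor \<Rightarrow> cantor) \<Rightarrow> bool list \<Rightarrow> bool list \<Rightarrow> bool \<Rightarrow> (cantor \<Rightarrow> cantor) \<Rightarrow> bool" where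
  "germ f u v c F \<longleftrightarrow>
     (\<forall>w. f (cat u w) = cat v (F w)) \<and>
     (\<forall>w. F (cat [c] w) = cat [c] (F w)) \<and>
     (\<forall>w w'. lt c w w' \<longrightarrow> lt c (F w) (F w')) \<and>
     (\<forall>w. w \<noteq> cst c \<longrightarrow> regular f (cat u w))"

definition selfsim :: "(cantor \<Rightarrow> cantor) \<Rightarrow> cantor \<Rightarrow> bool" where
  "selfsim f x \<longleftrightarrow> (\<exists>u v c F. x = cat u (cst c) \<and> germ f u v c F)"

text \<open>The conditions at the points are local so that closure under composition and inversion
  can be checked point by point.\<close>

definition G :: "(cantor \<Rightarrow> cantor) set" where
  "G = {f. bij f \<and> (\<forall>x. regular f x \<or> selfsim f x)}"

lemma germD:
  assumes "germ f u v c F"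
  shows "f (cat u w) = cat v (F w)" "F (cat [c] w) = cat [c] (F w)"
    "lt c w w' \<Longrightarrow> lt c (F w) (F w')" "w \<noteq> cst c \<Longrightarrow> regular f (cat u w)"
  using assms unfolding germ_def by auto

section \<open>Calculus of germs and closure of \<open>G\<close> under composition\<close>

lemma cat_singleton_fix:
  assumes "z = cat [c] z" shows "z = cst c"
proof
  fix n
  have z: "z n = (case n of 0 \<Rightarrow> c | Suc j \<Rightarrow> z j)" for n
    using fun_cong[OF assms, of n] unfolding cat_singleton .
  show "z n = c"
  proof (induction n)
    case 0 show ?case using z[of 0] by simp
  next
    case (Suc n) then show ?case using z[of "Suc n"] by simp
  qed
qed

lemma germ_cst: "germ f u v c F \<Longrightarrow> F (cst c) = cst c"
  by (rule cat_singleton_fix) (use germD(2)[of f u v c F "cst c"] in simp)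

lemma germ_apply: "germ f u v c F \<Longrightarrow> f (cat u (cst c)) = cat v (cst c)"
  using germ_cst germD(1) by metis

lemma germ_replicate:
  "germ f u v c F \<Longrightarrow> F (cat (replicate i c) w) = cat (replicate i c) (F w)"
proof (induction i)
  case (Suc i)
  have "cat (replicate (Suc i) c) z = cat [c] (cat (replicate i c) z)" for z
    using cat_Cons[of c "replicate i c" z] by simp
  then show ?case using germD(2)[OF Suc.prems] Suc by metis
qed simp

text \<open>Since \<open>F\<close> commutes with prepending \<open>c\<close>, both cones may shrink
  by the same number of digits without changing \<open>F\<close>. This is how the image cone of one
  germ is aligned with the domain of the next.\<close>

lemma germ_deepen:
  assumes "germ f u v c F"
  shows "germ f (u @ replicate i c) (v @ replicate i c) c F"
  unfolding germ_def
proof (intro conjI allI impI)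
  fix w assume "w \<noteq> cst c"
  then have "cat (replicate i c) w \<noteq> cst c" by (simp add: cat_eq_cst)
  then show "regular f (cat (u @ replicate i c) w)"
    using germD(4)[OF assms] by simp
qed (use germD[OF assms] germ_replicate[OF assms] in auto)

text \<open>A regular point with a constant tail is treated as a germ with \<open>F\<close> the
  identity, so that regular and singular factors can be composed uniformly.\<close>

lemma regular_imp_germ:
  assumes "regular f (cat u (cst c))"
  obtains i v where "germ f (u @ replicate i c) v c id"
proof -
  obtain N where N: "\<And>n. n \<ge> N \<Longrightarrow>
      \<exists>v. f (cat u (cst c)) = cat v (sdrop n (cat u (cst c))) \<and> (\<forall>w. f (cat (pre n (cat u (cst c))) w) = cat v w)"
    using regular_deep assms by metis
  let ?u = "u @ replicate N c"
  have "pre (length ?u) (cat ?u (cst c)) = ?u" by (rule pre_cat)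
  then have "pre (length ?u) (cat u (cst c)) = ?u" by simp
  moreover have "length ?u \<ge> N" by simp
  ultimately obtain v where "\<And>w. f (cat ?u w) = cat v w" using N by metis
  then have "germ f ?u v c id" unfolding germ_def using regularI[of f ?u v] by simp
  then show ?thesis using that by blast
qed

lemma G_bij: "f \<in> G \<Longrightarrow> bij f"
  by (simp add: G_def)

lemma G_cases:
  assumes "f \<in> G"
  obtains "regular f x" | u v c F where "x = cat u (cst c)" "germ f u v c F"
  using assms unfolding G_def selfsim_def by blast

lemma G_germ_cst:
  assumes "f \<in> G" "x = cat u (cst c)"
  obtains u' v' F where "x = cat u' (cst c)" "germ f u' v' c F"
  using G_cases[OF assms(1), of x]
proof cases
  case 1
  then obtain i v where g: "germ f (u @ replicate i c) v c id"
    using assms(2) regular_imp_germ by metis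
  have "x = cat (u @ replicate i c) (cst c)" using assms(2) by simp
  then show ?thesis using g by (rule that)
next
  case (2 u' v' c' F)
  then have "c' = c" using assms(2) cst_cat_eq_cst by metis
  then show ?thesis using 2 that by blast
qed

lemma germ_comp:
  assumes f: "germ f u v c F" and g: "germ g v v' c F'"
  shows "germ (g \<circ> f) u v' c (F' \<circ> F)"
  unfolding germ_def
proof (intro conjI allI impI)
  fix w assume w: "w \<noteq> cst c"
  \<comment> \<open>\<open>cst c\<close> is the least element and is fixed by the strictly monotone
    \<open>F\<close>, so \<open>F\<close> keeps other points away from it.\<close>
  then have "lt c (cst c) w" using lt_linear not_lt_cst by blast
  then have "lt c (cst c) (F w)" using germD(3)[OF f, of "cst c" w] germ_cst[OF f] by simp
  then have "F w \<noteq> cst c" by auto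
  then show "regular (g \<circ> f) (cat u w)"
    using germD[OF f] germD(4)[OF g] w by (intro regular_comp) auto
qed (use germD[OF f] germD[OF g] in auto)

lemma G_comp:
  assumes "f \<in> G" "g \<in> G"
  shows "g \<circ> f \<in> G"
proof -
  have "regular (g \<circ> f) x \<or> selfsim (g \<circ> f) x" for x
  proof (cases "regular f x \<and> regular g (f x)")
    case True then show ?thesis using regular_comp by blast
  next
    case False
    \<comment> \<open>Prefix replacement preserves tails, so if \<open>g\<close> is singular at
      \<open>f x\<close>, whose tail is then constant, the tail of x is constant as well.\<close>
    have "\<exists>u c. x = cat u (cst c)"
    proof (cases "regular f x")
      case True
      then have "\<not> regular g (f x)" using False by blast
      then obtain u c where u: "f x = cat u (cst c)" using G_cases[OF assms(2)] by metis
      obtain u' v' z where f: "x = cat u' z" "f x = cat v' z" using True by (blast elim: regularE)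
      have "sdrop (length u + length v') (f x) = sdrop (length u) z"
        unfolding f(2) by (rule ext) (simp add: sdrop_def cat_def)
      moreover have "sdrop (length u + length v') (f x) = cst c"
        unfolding u by (rule ext) (simp add: sdrop_def cat_def)
      ultimately have "sdrop (length u) z = cst c" by simp
      then have "z = cat (pre (length u) z) (cst c)" by (metis cat_pre_sdrop)
      then have "x = cat (u' @ pre (length u) z) (cst c)" using f(1) by simp
      then show ?thesis by blast
    next
      case False then show ?thesis using G_cases[OF assms(1)] by metis
    qed
    then obtain u0 c where "x = cat u0 (cst c)" by blast
    then obtain u v F where f: "x = cat u (cst c)" "germ f u v c F"
      using G_germ_cst assms(1) by metis
    then have fx: "f x = cat v (cst c)" using germ_apply by simp
    then obtain u' v' F' where g: "f x = cat u' (cst c)" "germ g u' v' c F'"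
      using G_germ_cst assms(2) by metis
    \<comment> \<open>\<open>v\<close> and \<open>u'\<close> address the same point, so one extends
      the other by digits \<open>c\<close>; the germ with the shorter word is deepened until they
      match.\<close>
    have "selfsim (g \<circ> f) x"
    proof (cases "length u' \<le> length v")
      case True
      then obtain i where "v = u' @ replicate i c" using fx g(1) cst_tail_cases by metis
      then show ?thesis using germ_comp[OF f(2)] germ_deepen[OF g(2), of i] f(1)
        unfolding selfsim_def by blast
    next
      case False
      then obtain i where "u' = v @ replicate i c" using fx g(1) cst_tail_cases by (metis nle_le)
      then have "germ (g \<circ> f) (u @ replicate i c) v' c (F' \<circ> F)"
        using germ_comp[OF germ_deepen[OF f(2), of i]] g(2) by simp
      moreover have "x = cat (u @ replicate i c) (cst c)" using f(1) by simp
      ultimately show ?thesis unfolding selfsim_def by blast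
    qed
    then show ?thesis ..
  qed
  then show ?thesis using assms bij_comp[of f g] unfolding G_def by blast
qed

lemma G_id: "id \<in> G"
  by (simp add: G_def regular_id)

lemma G_funpow: "f \<in> G \<Longrightarrow> f ^^ n \<in> G"
proof (induction n)
  case 0 then show ?case using G_id by (simp add: id_def)
next
  case (Suc n) then show ?case using G_comp[of "f ^^ n" f] by (simp add: comp_def)
qed

text \<open>The words starting with the digit opposite to \<open>c\<close> form a fundamental domain
  for prepending \<open>c\<close>. It is a compact set of regular points, so \<open>F\<close> is
  Lipschitz there, and self-similarity carries the constant over to all other words.\<close>

lemma germ_lip:
  assumes "germ f u v c F"
  obtains B where "lip B F"
proof -
  have "\<exists>k B. \<forall>n w w'. agree (n + B) w w' \<longrightarrow>
     agree n (F (cat [\<not> c] (cat (pre k x) w))) (F (cat [\<not> c] (cat (pre k x) w')))" for x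
  proof -
    let ?x = "cat [\<not> c] x" and ?u = "u @ [\<not> c]"
    have "?x \<noteq> cst c" using cat_eq_cst[of "[\<not> c]" x c] by auto
    then have "regular f (cat u ?x)" using germD(4)[OF assms] by blast
    then obtain N where N: "\<And>n. n \<ge> N \<Longrightarrow> \<exists>v. f (cat u ?x) = cat v (sdrop n (cat u ?x)) \<and> (\<forall>w. f (cat (pre n (cat u ?x)) w) = cat v w)"
      using regular_deep by blast
    let ?a = "?u @ pre N x"
    have "cat ?a (sdrop N x) = cat u ?x" by (simp only: cat_append cat_pre_sdrop)
    then have "pre (length ?a) (cat u ?x) = ?a" using pre_cat[of ?a "sdrop N x"] by simp
    moreover have "length ?a \<ge> N" by simp
    ultimately obtain b where b: "\<And>w. f (cat ?a w) = cat b w" using N by metis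
    have eq: "cat v (F (cat [\<not> c] (cat (pre N x) w))) = cat b w" for w
      using b[of w] germD(1)[OF assms] by (simp only: cat_append)
    have "agree n (F (cat [\<not> c] (cat (pre N x) w))) (F (cat [\<not> c] (cat (pre N x) w')))"
      if "agree (n + length v) w w'" for n w w'
    proof -
      have "agree (length v + n) (cat b w) (cat b w')"
        using agree_catI that by (simp add: add.commute)
      then show ?thesis unfolding eq[symmetric] agree_cat_iff .
    qed
    then show ?thesis by blast
  qed
  then obtain B where B: "lip B (\<lambda>w. F (cat [\<not> c] w))"
    by (rule lip_if_locally_lip[of "\<lambda>w. F (cat [\<not> c] w)"])
  \<comment> \<open>The extra 1 pays for the first digit. If it is \<open>c\<close>, it is stripped
    from argument and value alike and the induction hypothesis applies; otherwise the bound on the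
    fundamental domain applies.\<close>
  have "agree (n + Suc B) w w' \<longrightarrow> agree n (F w) (F w')" for n w w'
  proof (induction n arbitrary: w w')
    case (Suc n)
    show ?case
    proof
      assume ag: "agree (Suc n + Suc B) w w'"
      obtain d z where z: "w = cat [d] z" using cantor_cases by blast
      obtain d' z' where z': "w' = cat [d'] z'" using cantor_cases by blast
      have "w 0 = w' 0" using ag by (simp add: agree_def)
      then have d: "d' = d" using z z' by (simp add: cat_singleton)
      have ag': "agree (Suc n + B) z z'"
        using ag agree_cat_iff[of "[d]" "Suc n + B" z z'] z z' d by simp
      show "agree (Suc n) (F w) (F w')"
      proof (cases "d = c")
        case True
        have "agree n (F z) (F z')" using Suc ag' by simp
        then show ?thesis using z z' d True germD(2)[OF assms]
            agree_cat_iff[of "[c]" n "F z" "F z'"] by simp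
      next
        case False
        then have "d = (\<not> c)" by auto
        then show ?thesis using lipD[OF B ag'] z z' d by simp
      qed
    qed
  qed simp
  then have "lip (Suc B) F" unfolding lip_def by blast
  then show ?thesis using that by blast
qed

lemma G_lip:
  assumes "f \<in> G"
  obtains B where "lip B f"
proof -
  have "\<exists>k B. \<forall>n w w'. agree (n + B) w w' \<longrightarrow> agree n (f (cat (pre k x) w)) (f (cat (pre k x) w'))" for x
    using G_cases[OF assms, of x]
  proof cases
    case 1
    then obtain u v z where *: "x = cat u z" "\<And>w. f (cat u w) = cat v w" by (blast elim: regularE)
    then have "pre (length u) x = u" by simp
    then have "\<forall>n w w'. agree (n + 0) w w' \<longrightarrow>
        agree n (f (cat (pre (length u) x) w)) (f (cat (pre (length u) x) w'))"
      using * agree_catI by simp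
    then show ?thesis by blast
  next
    case (2 u v c F)
    obtain B where B: "lip B F" using germ_lip 2(2) by blast
    have "pre (length u) x = u" using 2(1) by simp
    then have "\<forall>n w w'. agree (n + B) w w' \<longrightarrow>
        agree n (f (cat (pre (length u) x) w)) (f (cat (pre (length u) x) w'))"
      using germD(1)[OF 2(2)] agree_catI lipD[OF B] by simp
    then show ?thesis by blast
  qed
  then show ?thesis by (rule lip_if_locally_lip[of f]) (rule that)
qed

text \<open>Every point has a cone with at most one singularity in it, and finitely many such cones
  cover the space.\<close>

lemma G_finite_sing:
  assumes "f \<in> G"
  shows "finite (sing f)"
proof -
  define P where "P a \<longleftrightarrow> finite {x \<in> sing f. is_prefix a x}" for a
  have "P (a @ b)" if "P a" for a b
  proof -
    have "{x \<in> sing f. is_prefix (a @ b) x} \<subseteq> {x \<in> sing f. is_prefix a x}"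
      unfolding is_prefix_iff by auto
    then show ?thesis using that finite_subset unfolding P_def by blast
  qed
  moreover have "\<exists>n. P (pre n x)" for x
    using G_cases[OF assms, of x]
  proof cases
    case 1
    then obtain u v z where *: "x = cat u z" "\<And>w. f (cat u w) = cat v w" by (blast elim: regularE)
    then have e: "{x \<in> sing f. is_prefix u x} = {}"
      unfolding sing_def is_prefix_iff using regularI by blast
    have "P (pre (length u) x)" unfolding P_def using * e by (simp del: Collect_empty_eq)
    then show ?thesis by blast
  next
    case (2 u v c F)
    have "w = cst c" if "\<not> regular f (cat u w)" for w
      by (rule ccontr) (use germD(4)[OF 2(2)] that in simp)
    then have "{x \<in> sing f. is_prefix u x} \<subseteq> {x}"
      unfolding sing_def is_prefix_iff 2(1) by auto
    then have "finite {x \<in> sing f. is_prefix u x}" by (rule finite_subset) simp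
    then have "P (pre (length u) x)" unfolding P_def 2(1) pre_cat .
    then show ?thesis by blast
  qed
  ultimately obtain N where N: "\<And>a. length a \<ge> N \<Longrightarrow> P a" using fan by metis
  have "sing f \<subseteq> (\<Union>a\<in>{a. length a = N}. {x \<in> sing f. is_prefix a x})"
  proof
    fix x assume "x \<in> sing f"
    moreover have "is_prefix (pre N x) x" unfolding is_prefix_iff by (metis cat_pre_sdrop)
    ultimately show "x \<in> (\<Union>a\<in>{a. length a = N}. {x \<in> sing f. is_prefix a x})" by force
  qed
  moreover have "finite (\<Union>a\<in>{a. length a = N}. {x \<in> sing f. is_prefix a x})"
    using N finite_words unfolding P_def by auto
  ultimately show ?thesis using finite_subset by blast
qed

text \<open>Continuity of the inverse on a compact space: a point outside the cone of
  \<open>u\<close> has an image different from that of the centre, hence so has a whole cone around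
  it, and the fan theorem makes the distance uniform.\<close>

lemma G_open_map:
  assumes "f \<in> G"
  obtains n where "\<And>y. agree n (f (cat u z)) (f y) \<Longrightarrow> \<exists>w. y = cat u w"
proof -
  let ?x = "cat u z"
  obtain B where B: "lip B f" using G_lip assms by blast
  define P where "P a \<longleftrightarrow> (\<exists>n. \<forall>w. agree n (f ?x) (f (cat a w)) \<longrightarrow> is_prefix u (cat a w))" for a
  have "P (a @ b)" if "P a" for a b
    using that unfolding P_def by (metis cat_append)
  moreover have "\<exists>n. P (pre n y)" for y
  proof (cases "is_prefix u y")
    case True
    then obtain w where "y = cat u w" unfolding is_prefix_iff by blast
    then have "P (pre (length u) y)" unfolding P_def is_prefix_iff by auto
    then show ?thesis ..
  next
    case False
    then have "y \<noteq> ?x" unfolding is_prefix_iff by blast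
    then have "f y \<noteq> f ?x" using G_bij[OF assms] by (metis bij_is_inj injD)
    then obtain n where n: "\<not> agree n (f ?x) (f y)" using agree_all by metis
    have "\<not> agree n (f ?x) (f (cat (pre (n + B) y) w))" for w
    proof
      assume "agree n (f ?x) (f (cat (pre (n + B) y) w))"
      moreover have "agree (n + B) (cat (pre (n + B) y) w) y"
        using agree_cat[of "pre (n + B) y" w "sdrop (n + B) y"] by simp
      ultimately show False using n lipD[OF B] agree_trans by blast
    qed
    then show ?thesis unfolding P_def by blast
  qed
  ultimately obtain N where N: "\<And>a. length a \<ge> N \<Longrightarrow> P a" using fan by metis
  define e where "e a = (SOME n. \<forall>w. agree n (f ?x) (f (cat a w)) \<longrightarrow> is_prefix u (cat a w))" for a
  have e: "agree (e a) (f ?x) (f (cat a w)) \<Longrightarrow> is_prefix u (cat a w)" if "length a = N" for a w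
    using someI_ex[OF N[unfolded P_def, of a]] that unfolding e_def by simp
  have "\<exists>w. y = cat u w" if "agree (\<Sum>a | length a = N. e a) (f ?x) (f y)" for y
  proof -
    have "e (pre N y) \<le> (\<Sum>a | length a = N. e a)"
      by (rule member_le_sum) (auto simp: finite_words)
    then have "agree (e (pre N y)) (f ?x) (f (cat (pre N y) (sdrop N y)))"
      using that agree_mono by simp
    then show ?thesis using e[of "pre N y" "sdrop N y"] unfolding is_prefix_iff by simp
  qed
  then show ?thesis using that by blast
qed

text \<open>The image of the cone of \<open>u\<close> need not be a cone, but by openness it
  contains the cone of \<open>v\<close> followed by enough digits \<open>c\<close>. There the
  inverse has a germ \<open>F'\<close> with \<open>F (F' w)\<close> equal to \<open>w\<close>
  preceded by these digits, and the properties of \<open>F'\<close> follow by cancelling the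
  injective \<open>F\<close>.\<close>

lemma germ_inv:
  assumes f: "f \<in> G" and g: "germ f u v c F"
  obtains i F' where "germ (inv f) (v @ replicate i c) u c F'"
proof -
  have bij: "bij f" using f by (rule G_bij)
  obtain n where n: "\<And>y. agree n (f (cat u (cst c))) (f y) \<Longrightarrow> \<exists>w. y = cat u w"
    using G_open_map[OF f] by metis
  let ?v = "v @ replicate n c"
  have fu: "f (cat u (cst c)) = cat ?v (cst c)" using germ_apply[OF g] by simp
  have "\<exists>w'. inv f (cat ?v w) = cat u w'" for w
  proof -
    have "agree (length ?v) (cat ?v (cst c)) (cat ?v w)" by (rule agree_cat)
    then have "agree n (f (cat u (cst c))) (f (inv f (cat ?v w)))"
      unfolding fu surj_f_inv_f[OF bij_is_surj[OF bij]] by (rule agree_mono) simp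
    then show ?thesis by (rule n)
  qed
  then obtain F' where F': "\<And>w. inv f (cat ?v w) = cat u (F' w)" by metis
  have FF': "F (F' w) = cat (replicate n c) w" for w
  proof -
    have "cat v (F (F' w)) = cat ?v w"
      using F'[of w] germD(1)[OF g] bij by (metis bij_inv_eq_iff)
    then show ?thesis by simp
  qed
  have inj: "F w = F w' \<Longrightarrow> w = w'" for w w'
    using germD(1)[OF g] bij by (metis bij_is_inj cat_inject injD)
  have "germ (inv f) ?v u c F'"
    unfolding germ_def
  proof (intro conjI allI impI)
    fix w
    have "F (F' (cat [c] w)) = cat (replicate n c) (cat [c] w)" by (rule FF')
    also have "\<dots> = cat (replicate n c @ [c]) w" by (simp only: cat_append)
    also have "\<dots> = cat ([c] @ replicate n c) w" by (simp only: replicate_append_same append_Cons append_Nil)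
    also have "\<dots> = F (cat [c] (F' w))" by (simp only: cat_append germD(2)[OF g] FF')
    finally show "F' (cat [c] w) = cat [c] (F' w)" by (rule inj)
  next
    fix w w' assume "lt c w w'"
    then have "lt c (F (F' w)) (F (F' w'))" by (simp add: FF')
    then have "F' w \<noteq> F' w'" "\<not> lt c (F' w') (F' w)"
      using germD(3)[OF g] lt_trans lt_irrefl by metis+
    then show "lt c (F' w) (F' w')" using lt_linear by blast
  next
    fix w assume w: "w \<noteq> cst c"
    have "F' w \<noteq> cst c"
    proof
      assume "F' w = cst c"
      then have "cat (replicate n c) w = cst c" using FF'[of w] germ_cst[OF g] by simp
      then show False using w by (simp add: cat_eq_cst)
    qed
    then have "regular (inv f) (f (cat u (F' w)))"
      using germD(4)[OF g] regular_inv bij bij_is_inj by blast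
    moreover have "f (cat u (F' w)) = cat ?v w"
      using F'[of w] bij by (metis bij_inv_eq_iff)
    ultimately show "regular (inv f) (cat ?v w)" by simp
  qed (rule F')
  then show ?thesis by (rule that)
qed

lemma G_inv:
  assumes "f \<in> G" shows "inv f \<in> G"
proof -
  have bij: "bij f" using assms by (rule G_bij)
  have "regular (inv f) y \<or> selfsim (inv f) y" for y
  proof -
    obtain x where y: "y = f x" using bij by (metis bij_pointE)
    show ?thesis using G_cases[OF assms, of x]
    proof cases
      case 1 then show ?thesis using regular_inv bij bij_is_inj y by blast
    next
      case (2 u v c F)
      obtain i F' where "germ (inv f) (v @ replicate i c) u c F'"
        using germ_inv[OF assms 2(2)] by blast
      moreover have "y = cat (v @ replicate i c) (cst c)" using y 2 germ_apply by simp
      ultimately show ?thesis unfolding selfsim_def by blast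
    qed
  qed
  then show ?thesis using bij bij_imp_bij_inv unfolding G_def by blast
qed

section \<open>Linear growth of word length\<close>

definition word_over :: "'a set \<Rightarrow> (bool \<times> 'a) list \<Rightarrow> bool" where
  "word_over S w \<longleftrightarrow> set (map snd w) \<subseteq> S"

text \<open>One constant serves as factor and as additive term, through \<open>Suc\<close>. Negative
  powers are recovered by inverting words.\<close>

definition lin :: "(cantor \<Rightarrow> cantor) set \<Rightarrow> (cantor \<Rightarrow> cantor) \<Rightarrow> bool" where
  "lin S f \<longleftrightarrow> (\<exists>C. \<forall>K w. word_over S w \<and> eval_word w = f ^^ K \<longrightarrow> K \<le> C * Suc (length w))"

definition inv_word :: "(bool \<times> 'a) list \<Rightarrow> (bool \<times> 'a) list" where
  "inv_word w = rev (map (\<lambda>(b, s). (\<not> b, s)) w)"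

section \<open>Words, their inverses and powers, and the two subadditive quantities\<close>

lemma word_induct [case_names Nil Cons]:
  "P [] \<Longrightarrow> (\<And>b s w. P w \<Longrightarrow> P ((b, s) # w)) \<Longrightarrow> P w"
  by (induction w) auto

lemma eval_word_append: "eval_word (w @ w') = eval_word w' \<circ> eval_word w"
  by (induction w rule: word_induct) (auto simp: comp_def)

lemma length_inv_word [simp]: "length (inv_word w) = length w"
  by (simp add: inv_word_def)

lemma word_over_inv [simp]: "word_over S (inv_word w) \<longleftrightarrow> word_over S w"
  by (force simp: word_over_def inv_word_def)

lemma word_over_Cons [simp]: "word_over S ((b, s) # w) \<longleftrightarrow> s \<in> S \<and> word_over S w"
  by (auto simp: word_over_def)

lemma word_over_append [simp]: "word_over S (w @ w') \<longleftrightarrow> word_over S w \<and> word_over S w'"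
  by (auto simp: word_over_def)

lemma eval_word_G: "S \<subseteq> G \<Longrightarrow> word_over S w \<Longrightarrow> eval_word w \<in> G"
  by (induction w rule: word_induct) (auto intro!: G_comp G_inv G_id simp del: id_apply)

lemma eval_inv_word:
  assumes "S \<subseteq> G" "word_over S w"
  shows "eval_word (inv_word w) = inv (eval_word w)"
  using assms(2)
proof (induction w rule: word_induct)
  case (Cons b s w)
  then have s: "s \<in> G" "bij s" using assms(1) G_bij by auto
  have bw: "bij (eval_word w)" using Cons eval_word_G G_bij assms(1) by simp
  have "eval_word (inv_word ((b, s) # w)) = (if \<not> b then s else inv s) \<circ> inv (eval_word w)"
    using Cons by (simp add: inv_word_def eval_word_append comp_def)
  also have "\<dots> = inv (eval_word w \<circ> (if b then s else inv s))"
    using s bw by (auto simp: o_inv_distrib bij_imp_bij_inv inv_inv_eq)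
  finally show ?case by (simp only: eval_word.simps)
qed (simp add: inv_word_def)

lemma inv_funpow:
  fixes f :: "'a \<Rightarrow> 'a"
  assumes "bij f" shows "inv (f ^^ n) = inv f ^^ n"
proof (induction n)
  case 0 show ?case by (simp only: funpow.simps(1) inv_id)
next
  case (Suc n)
  have "inv (f \<circ> f ^^ n) = inv (f ^^ n) \<circ> inv f" using assms by (simp add: o_inv_distrib bij_fn)
  then show ?case by (simp only: Suc.IH funpow.simps(2)[of n f] funpow_Suc_right[of n "inv f"])
qed

text \<open>A word for f^K repeated n times is a word for the K-th power of f^n. This permits
  passing to a power whenever convenient.\<close>

lemma lin_pow:
  assumes "n > 0" "lin S (f ^^ n)" shows "lin S f"
proof -
  obtain C where C: "\<And>K w. word_over S w \<Longrightarrow> eval_word w = (f ^^ n) ^^ K \<Longrightarrow> K \<le> C * Suc (length w)"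
    using assms(2) unfolding lin_def by blast
  have "K \<le> (C * n) * Suc (length w)" if "word_over S w" "eval_word w = f ^^ K" for K w
  proof -
    have W: "word_over S (concat (replicate m w)) \<and> eval_word (concat (replicate m w)) = (f ^^ K) ^^ m" for m
      using that by (induction m) (auto simp: eval_word_append funpow_Suc_right word_over_def simp del: funpow.simps(2))
    have "(f ^^ K) ^^ n = (f ^^ n) ^^ K" by (simp add: funpow_mult mult.commute)
    then have "K \<le> C * Suc (length (concat (replicate n w)))" using W[of n] C by metis
    also have "length (concat (replicate n w)) = n * length w" by (induction n) auto
    also have "C * Suc (n * length w) \<le> C * (n * Suc (length w))"
      using assms(1) by (intro mult_le_mono2) simp
    finally show ?thesis by (simp only: mult.assoc)
  qed
  then show ?thesis unfolding lin_def by blast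
qed

lemma lin_inv:
  assumes "S \<subseteq> G" "bij f" "lin S (inv f)" shows "lin S f"
proof -
  obtain C where C: "\<And>K w. word_over S w \<Longrightarrow> eval_word w = inv f ^^ K \<Longrightarrow> K \<le> C * Suc (length w)"
    using assms(3) unfolding lin_def by blast
  have "K \<le> C * Suc (length w)" if "word_over S w" "eval_word w = f ^^ K" for K w
    using C[of "inv_word w" K] that eval_inv_word[OF assms(1), of w] inv_funpow[OF assms(2), of K] by simp
  then show ?thesis unfolding lin_def by blast
qed

lemma lip_word:
  assumes "finite S" "S \<subseteq> G"
  obtains B where "\<And>w. word_over S w \<Longrightarrow> lip (B * length w) (eval_word w)"
proof -
  \<comment> \<open>A word may use inverse letters, so the constant has to bound the inverses of the
    generators too.\<close>
  define T where "T = S \<union> inv ` S"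
  have T: "finite T" "T \<subseteq> G" using assms G_inv by (auto simp: T_def)
  define b where "b s = (SOME B. lip B s)" for s
  have b: "lip (b s) s" if "s \<in> T" for s
    unfolding b_def using G_lip[of s] T(2) that someI_ex[of "\<lambda>B. lip B s"] by blast
  have B: "lip (\<Sum>s\<in>T. b s) s" if "s \<in> T" for s
    using that T(1) b by (intro lip_mono[OF b] member_le_sum) auto
  have "lip ((\<Sum>s\<in>T. b s) * length w) (eval_word w)" if "word_over S w" for w
    using that
  proof (induction w rule: word_induct)
    case (Cons c s w)
    then have "(if c then s else inv s) \<in> T" by (auto simp: T_def)
    from lip_comp[OF B[OF this] Cons.IH] Cons.prems show ?case by (simp add: comp_def)
  qed (use lip_id in \<open>simp add: id_def\<close>)
  then show ?thesis by (rule that)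
qed

lemma card_sing_comp:
  assumes "f \<in> G" "g \<in> G"
  shows "card (sing (g \<circ> f)) \<le> card (sing f) + card (sing g)"
proof -
  have bij: "bij f" using G_bij assms(1) by blast
  have "finite (f -` sing g)"
    using G_finite_sing[OF assms(2)] bij_is_inj[OF bij] by (rule finite_vimageI)
  then have "card (sing (g \<circ> f)) \<le> card (sing f \<union> f -` sing g)"
    using sing_comp G_finite_sing[OF assms(1)] by (intro card_mono) auto
  also have "\<dots> \<le> card (sing f) + card (f -` sing g)" by (rule card_Un_le)
  also have "card (f -` sing g) = card (sing g)"
    using bij by (intro card_vimage_inj) (auto simp: bij_is_inj bij_is_surj)
  finally show ?thesis .
qed

lemma card_sing_word:
  assumes "finite S" "S \<subseteq> G"
  obtains B where "\<And>w. word_over S w \<Longrightarrow> card (sing (eval_word w)) \<le> B * length w"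
proof -
  define T where "T = S \<union> inv ` S"
  have T: "finite T" "T \<subseteq> G" using assms G_inv by (auto simp: T_def)
  have B: "card (sing s) \<le> (\<Sum>s\<in>T. card (sing s))" if "s \<in> T" for s
    using that T(1) by (intro member_le_sum) auto
  have "card (sing (eval_word w)) \<le> (\<Sum>s\<in>T. card (sing s)) * length w" if "word_over S w" for w
    using that
  proof (induction w rule: word_induct)
    case Nil
    have "sing id = {}" using regular_id by (auto simp: sing_def)
    then show ?case by (simp only: eval_word.simps card.empty)
  next
    case (Cons c s w)
    then have s: "(if c then s else inv s) \<in> T" by (auto simp: T_def)
    have "eval_word w \<in> G" using Cons.prems eval_word_G assms(2) by simp
    then have "card (sing (eval_word w \<circ> (if c then s else inv s))) \<le> (\<Sum>s\<in>T. card (sing s)) + card (sing (eval_word w))"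
      using card_sing_comp[of "if c then s else inv s" "eval_word w"] s T(2) B[OF s] by auto
    moreover have "card (sing (eval_word w)) \<le> (\<Sum>s\<in>T. card (sing s)) * length w" using Cons by simp
    ultimately show ?case by (simp only: eval_word.simps length_Cons mult_Suc_right)
  qed
  then show ?thesis by (rule that)
qed

text \<open>The inverse of f^K takes two points that agree in K digits to two that already differ
  among the first d, so its Lipschitz exponent exceeds K - d. The inverse word has the same length
  as the word.\<close>

lemma lin_if_converging_pair:
  assumes S: "finite S" "S \<subseteq> G" and "bij f" and "x \<noteq> y"
    and ag: "\<And>k. agree k ((f ^^ k) x) ((f ^^ k) y)"
  shows "lin S f"
proof -
  obtain B where B: "\<And>w. word_over S w \<Longrightarrow> lip (B * length w) (eval_word w)"
    using lip_word S by metis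
  obtain d where d: "\<not> agree d x y" using \<open>x \<noteq> y\<close> agree_all by blast
  have "K \<le> (d + B) * Suc (length w)" if w: "word_over S w" "eval_word w = f ^^ K" for K w
  proof (rule ccontr)
    assume "\<not> ?thesis"
    then have "d + B * length w \<le> K" by (simp add: algebra_simps)
    then have "agree (d + B * length w) ((f ^^ K) x) ((f ^^ K) y)" using ag agree_mono by blast
    moreover have "lip (B * length w) (inv (f ^^ K))"
      using B[of "inv_word w"] w eval_inv_word[OF S(2) w(1)] by simp
    ultimately have "agree d (inv (f ^^ K) ((f ^^ K) x)) (inv (f ^^ K) ((f ^^ K) y))"
      using lipD by blast
    then show False using d bij_is_inj[OF bij_fn[OF \<open>bij f\<close>]] by simp
  qed
  then show ?thesis unfolding lin_def by blast
qed

lemma lin_if_many_sing: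
  assumes S: "finite S" "S \<subseteq> G" and "\<And>k. k \<le> m + card (sing (f ^^ k))"
  shows "lin S f"
proof -
  obtain B where B: "\<And>w. word_over S w \<Longrightarrow> card (sing (eval_word w)) \<le> B * length w"
    using card_sing_word S by metis
  have "K \<le> (m + B) * Suc (length w)" if "word_over S w" "eval_word w = f ^^ K" for K w
    using assms(3)[of K] B[of w] that by (simp add: algebra_simps)
  then show ?thesis unfolding lin_def by blast
qed

section \<open>Contracted cones and regular fixed points\<close>

lemma funpow_cat_contract:
  assumes "\<And>w. g (cat a w) = cat (a @ t) w"
  shows "(g ^^ k) (cat a w) = cat a (((cat t) ^^ k) w)"
  using assms by (induction k) auto

lemma agree_funpow_cat: "t \<noteq> [] \<Longrightarrow> agree k (((cat t) ^^ k) w) (((cat t) ^^ k) w')"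
proof (induction k)
  case (Suc k)
  have "agree (length t + k) (((cat t) ^^ Suc k) w) (((cat t) ^^ Suc k) w')" using Suc by simp
  moreover have "Suc k \<le> length t + k" using Suc.prems by (cases t) auto
  ultimately show ?case by (rule agree_mono)
qed simp

text \<open>Every iteration inserts the nonempty word \<open>t\<close> after \<open>a\<close>, so
  any two points of the cone gain at least one common digit each time.\<close>

lemma lin_if_contracting:
  assumes S: "finite S" "S \<subseteq> G" and "bij f" "t \<noteq> []"
    and f: "\<And>w. f (cat a w) = cat (a @ t) w"
  shows "lin S f"
proof (rule lin_if_converging_pair[OF S \<open>bij f\<close>])
  show "cat a (cst True) \<noteq> cat a (cst False)" by (auto dest: fun_cong)
  show "agree k ((f ^^ k) (cat a (cst True))) ((f ^^ k) (cat a (cst False)))" for k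
    using f \<open>t \<noteq> []\<close> by (simp add: funpow_cat_contract agree_catI agree_funpow_cat)
qed

text \<open>If replacing \<open>u\<close> by \<open>v\<close> fixes a point, the two words are
  comparable. Equality makes f trivial nearby; a longer \<open>v\<close> makes f contract a cone,
  and a longer \<open>u\<close> makes the inverse contract one.\<close>

lemma regular_fixpoint:
  assumes S: "finite S" "S \<subseteq> G" and "bij f" and "f z = z" "regular f z"
  shows "(\<exists>n. \<forall>y. agree n z y \<longrightarrow> f y = y) \<or> lin S f"
proof -
  obtain u v w0 where u: "z = cat u w0" "f z = cat v w0" "\<And>w. f (cat u w) = cat v w"
    using regularE[OF assms(5)] by metis
  have eq: "cat u w0 = cat v w0" using u assms(4) by simp
  consider "u = v" | t where "t \<noteq> []" "v = u @ t" | t where "t \<noteq> []" "u = v @ t"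
    using cat_eq_le[OF eq] cat_eq_le[OF eq[symmetric]] by (metis append_Nil2 nle_le)
  then show ?thesis
  proof cases
    case 1
    then have "\<forall>y. agree (length u) z y \<longrightarrow> f y = y" using u agree_cat_ex by metis
    then show ?thesis by blast
  next
    case (2 t)
    then show ?thesis using lin_if_contracting[OF S \<open>bij f\<close>] u by metis
  next
    case (3 t)
    have "inv f (cat v w) = cat (v @ t) w" for w
      using u(3)[of w] 3(2) \<open>bij f\<close> by (metis bij_inv_eq_iff)
    then have "lin S (inv f)"
      using lin_if_contracting[OF S bij_imp_bij_inv[OF \<open>bij f\<close>]] 3(1) by metis
    then show ?thesis using lin_inv S(2) \<open>bij f\<close> by blast
  qed
qed

section \<open>Fixed singular points\<close>

lemma lt_shift:
  assumes "z \<noteq> cst c" shows "lt c (cat [c] z) z"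
proof -
  obtain i t where z: "z = cat (replicate i c) (cat [\<not> c] t)"
    using not_cst_split[OF assms] by blast
  have "cat [c] z = cat (replicate i c @ [c]) (cat [\<not> c] t)"
    unfolding z replicate_append_same by (simp only: cat_append[symmetric] append_Cons append_Nil)
  moreover have "lt c (cat [c] (cat [\<not> c] t)) (cat [\<not> c] t)"
    unfolding lt_def by (rule exI[of _ 0]) (simp add: cat_def)
  ultimately show ?thesis unfolding z by (simp only: cat_append lt_cat)
qed

lemma lt_replicate:
  assumes "w = cat (replicate i c) (cat [\<not> c] t)"
  shows "lt c (cat (replicate (Suc i) c) r) w"
proof -
  have "cat (replicate (Suc i) c) r = cat (replicate i c) (cat [c] r)"
    by (simp only: replicate_Suc replicate_append_same[symmetric] cat_append)
  moreover have "lt c (cat [c] r) (cat [\<not> c] t)"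
    unfolding lt_def by (rule exI[of _ 0]) (simp add: cat_def)
  ultimately show ?thesis unfolding assms by (simp only: lt_cat)
qed

text \<open>\<open>cst c\<close> is the least element and also starts with k digits
  \<open>c\<close>, so the whole order interval between it and the bound lies in their cone.\<close>

lemma agree_cst_if_below:
  assumes "\<not> lt c (cat (replicate k c) w) x"
  shows "agree k x (cst c)"
proof (cases "x = cst c")
  case False
  then obtain i t where x: "x = cat (replicate i c) (cat [\<not> c] t)" using not_cst_split by blast
  have "k \<le> i"
  proof (rule ccontr)
    assume "\<not> ?thesis"
    then have "replicate k c = replicate (Suc i) c @ replicate (k - Suc i) c"
      by (simp only: replicate_add[symmetric]) simp
    then have "cat (replicate k c) w = cat (replicate (Suc i) c) (cat (replicate (k - Suc i) c) w)"
      by (simp only: cat_append)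
    then show False using lt_replicate[OF x] assms by metis
  qed
  then show ?thesis unfolding x by (auto simp: agree_def cat_def)
qed simp

lemma funpow_cat_singleton: "((cat [c]) ^^ k) w = cat (replicate k c) w"
proof (induction k)
  case (Suc k)
  then show ?case using cat_Cons[of c "replicate k c" w] by simp
qed simp

text \<open>Once the earlier digits are stable, a digit can change only towards \<open>c\<close>,
  hence at most once; so every digit stabilises.\<close>

lemma decreasing_converges:
  assumes dec: "\<And>k. lt c (s (Suc k)) (s k)"
  obtains z where "\<And>n. \<exists>K. \<forall>k\<ge>K. agree n z (s k)"
proof -
  have less: "lt c (s (k + Suc d)) (s k)" for k d
  proof (induction d)
    case 0 then show ?case using dec[of k] by simp
  next
    case (Suc d) then show ?case using dec[of "k + Suc d"] lt_trans by simp
  qed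
  have "\<exists>K. \<forall>k\<ge>K. agree n (s K) (s k)" for n
  proof (induction n)
    case (Suc n)
    then obtain K where K: "\<And>k. k \<ge> K \<Longrightarrow> agree n (s K) (s k)" by blast
    have K2: "agree n (s j) (s k)" if "j \<ge> K" "k \<ge> K" for j k
      using K that agree_sym agree_trans by blast
    show ?case
    proof (cases "\<exists>k0\<ge>K. s k0 n = c")
      case True
      then obtain k0 where k0: "k0 \<ge> K" "s k0 n = c" by blast
      have "agree (Suc n) (s k0) (s k)" if "k \<ge> k0" for k
      proof -
        have ag: "agree n (s k0) (s k)" using K2 that k0 by simp
        have "s k n = c"
        proof (rule ccontr)
          assume "s k n \<noteq> c"
          then have "lt c (s k0) (s k)" using ag k0(2) unfolding lt_def agree_def by blast
          moreover have "lt c (s k) (s k0)"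
            using less[of k0 "k - Suc k0"] that \<open>s k n \<noteq> c\<close> k0(2) by (cases "k = k0") auto
          ultimately show False using lt_trans lt_irrefl by blast
        qed
        then show ?thesis using ag k0(2) by (auto simp: agree_def less_Suc_eq)
      qed
      then show ?thesis by blast
    next
      case False
      then have "agree (Suc n) (s K) (s k)" if "k \<ge> K" for k
        using K[OF that] that by (auto simp: agree_def less_Suc_eq)
      then show ?thesis by blast
    qed
  qed simp
  then obtain K where K: "\<And>n k. k \<ge> K n \<Longrightarrow> agree n (s (K n)) (s k)" by metis
  define z where "z i = s (K (Suc i)) i" for i
  have "agree n z (s k)" if "k \<ge> Max (K ` {..n})" for n k
    unfolding agree_def
  proof (intro allI impI)
    fix i assume "i < n"
    then have "K (Suc i) \<le> Max (K ` {..n})" by (intro Max_ge) auto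
    then have "agree (Suc i) (s (K (Suc i))) (s k)" by (intro K) (rule le_trans[OF _ that])
    then show "z i = s k i" by (simp add: z_def agree_def)
  qed
  then show ?thesis using that by blast
qed

text \<open>One point moved towards the singular fixed point suffices. Its orbit decreases to a
  limit. If the limit is the singular point, self-similarity makes the convergence exponential for a
  power of f; if not, the limit is a regular fixed point at which f is not trivial.\<close>

lemma lin_if_decreasing:
  assumes S: "finite S" "S \<subseteq> G" and f: "f \<in> G" and g: "germ f u v c F"
    and fixp: "f (cat u (cst c)) = cat u (cst c)"
    and dec: "f (cat u w) = cat u w'" "lt c w' w"
  shows "lin S f"
proof -
  have bij: "bij f" using f by (rule G_bij)
  have mono: "lt c (f (cat u z)) (f (cat u z'))" if "lt c z z'" for z z'
    using germD(1,3)[OF g] that by simp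
  \<comment> \<open>The interval from the fixed point up to \<open>w\<close>. Monotonicity and
    convexity of cones keep f inside the cone of \<open>u\<close> here, so f can be iterated as a
    map \<open>h\<close> in the coordinates of that cone.\<close>
  define I where "I = {z. z = w \<or> lt c z w}"
  define h where "h z = sdrop (length u) (f (cat u z))" for z
  have ex: "\<exists>z'. f (cat u z) = cat u z' \<and> z' \<in> I" if "z \<in> I" for z
  proof -
    consider "z = w" | "z = cst c" | "lt c z w" "lt c (cst c) z"
      using \<open>z \<in> I\<close> lt_linear[of c z "cst c"] not_lt_cst[of c z] unfolding I_def by auto
    then show ?thesis
    proof cases
      case 1 then show ?thesis using dec unfolding I_def by blast
    next
      case 2
      have "w \<noteq> cst c" using dec by auto
      then have "lt c (cst c) w" using lt_linear[of c w "cst c"] by simp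
      then show ?thesis using fixp 2 unfolding I_def by blast
    next
      case 3
      then have l: "lt c (cat u (cst c)) (f (cat u z))" "lt c (f (cat u z)) (cat u w')"
        using mono[of "cst c" z] mono[of z w] fixp dec by simp_all
      obtain z' where z': "f (cat u z) = cat u z'" using lt_cat_between[OF l] by blast
      have "lt c z' w'" using l(2) by (simp only: z' lt_cat)
      then have "lt c z' w" using dec(2) by (rule lt_trans)
      then show ?thesis using z' unfolding I_def by blast
    qed
  qed
  have h: "f (cat u z) = cat u (h z)" "h z \<in> I" if "z \<in> I" for z
    using ex[OF that] by (auto simp: h_def)
  have hmono: "lt c (h z) (h z')" if "z \<in> I" "z' \<in> I" "lt c z z'" for z z'
    using mono[OF that(3)] h that by simp
  have hpow: "(f ^^ k) (cat u z) = cat u ((h ^^ k) z) \<and> (h ^^ k) z \<in> I" if "z \<in> I" for z k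
    by (induction k) (use that h in auto)
  have hpow_mono: "\<not> lt c ((h ^^ k) z') ((h ^^ k) z)" if "z \<in> I" "z' \<in> I" "\<not> lt c z' z" for z z' k
  proof (induction k)
    case 0 then show ?case using that by simp
  next
    case (Suc k)
    then show ?case using hpow[OF that(1), of k] hpow[OF that(2), of k] hmono lt_linear lt_trans lt_irrefl
      by (metis funpow.simps(2) comp_apply)
  qed
  have shiftI: "cat [c] z \<in> I" if "z \<in> I" for z
  proof (cases "z = cst c")
    case False
    then have "lt c (cat [c] z) z" by (rule lt_shift)
    then show ?thesis using that lt_trans unfolding I_def by blast
  qed (use that in simp)
  have uv: "cat u (cst c) = cat v (cst c)" using fixp germ_apply[OF g] by simp
  \<comment> \<open>The germ has target word \<open>v\<close>, not \<open>u\<close>. Both address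
    the same point, so one extends the other by digits \<open>c\<close>, and \<open>h\<close>
    differs from \<open>F\<close> by prepending or removing such digits.\<close>
  have hshift: "h (cat [c] z) = cat [c] (h z)" if "z \<in> I" for z
  proof (cases "length u \<le> length v")
    case True
    then obtain i where v: "v = u @ replicate i c" using uv cst_tail_cases by metis
    then have hF: "h y = cat (replicate i c) (F y)" if "y \<in> I" for y
      using h(1)[OF that] germD(1)[OF g, of y] by simp
    have "cat (replicate i c) (cat [c] y) = cat [c] (cat (replicate i c) y)" for y
      by (simp only: cat_append[symmetric] append_Cons append_Nil replicate_append_same)
    then show ?thesis using hF[OF shiftI[OF that]] hF[OF that] germD(2)[OF g] by simp
  next
    case False
    then obtain i where u: "u = v @ replicate i c" using uv cst_tail_cases by (metis nle_le)
    then have hF: "F y = cat (replicate i c) (h y)" if "y \<in> I" for y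
      using h(1)[OF that] germD(1)[OF g, of y] by simp
    have "cat (replicate i c) (cat [c] y) = cat [c] (cat (replicate i c) y)" for y
      by (simp only: cat_append[symmetric] append_Cons append_Nil replicate_append_same)
    then show ?thesis using hF[OF shiftI[OF that]] hF[OF that] germD(2)[OF g] by (metis cat_inject)
  qed
  have hpow_shift: "(h ^^ k) (((cat [c]) ^^ j) z) = ((cat [c]) ^^ j) ((h ^^ k) z) \<and> ((cat [c]) ^^ j) z \<in> I"
    if "z \<in> I" for z j k
  proof -
    have in_I: "((cat [c]) ^^ j) y \<in> I" if "y \<in> I" for y j
      by (induction j) (use that shiftI in auto)
    have h1: "h (((cat [c]) ^^ j) y) = ((cat [c]) ^^ j) (h y)" if "y \<in> I" for y j
      by (induction j) (use that in_I hshift in auto)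
    have "(h ^^ k) (((cat [c]) ^^ j) z) = ((cat [c]) ^^ j) ((h ^^ k) z)"
      by (induction k) (use that h1 hpow in auto)
    then show ?thesis using in_I that by blast
  qed
  have wI: "w \<in> I" by (simp add: I_def)
  define s where "s k = (h ^^ k) w" for k
  have sI: "s k \<in> I" for k using hpow[OF wI] by (simp add: s_def)
  have sdec: "lt c (s (Suc k)) (s k)" for k
  proof (induction k)
    case 0
    then show ?case using dec h(1)[OF wI] by (simp add: s_def)
  next
    case (Suc k)
    show ?case using hmono[OF sI sI Suc] by (simp add: s_def)
  qed
  have fs: "f (cat u (s k)) = cat u (s (Suc k))" for k
    using h(1)[OF sI] by (simp add: s_def)
  obtain z where z: "\<And>n. \<exists>K. \<forall>k\<ge>K. agree n z (s k)"
    using decreasing_converges sdec by blast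
  show ?thesis
  proof (cases "z = cst c")
    case True
    have "w \<noteq> cst c" using dec by auto
    then obtain e t where w: "w = cat (replicate e c) (cat [\<not> c] t)" using not_cst_split by blast
    \<comment> \<open>\<open>cat [c] w\<close> starts with exactly e + 1 digits \<open>c\<close>, so
      e + 2 of them put a point strictly below it.\<close>
    obtain K where K: "\<And>k. k \<ge> K \<Longrightarrow> agree (e + 2) z (s k)" using z by blast
    define m where "m = Suc K"
    have "agree (length (replicate (e + 2) c)) (cat (replicate (e + 2) c) (cst c)) (s m)"
      using K[of m] unfolding True cat_replicate_cst length_replicate by (simp add: m_def)
    then obtain r where r: "s m = cat (replicate (e + 2) c) r" using agree_cat_ex by blast
    have cw: "cat [c] w = cat (replicate (Suc e) c) (cat [\<not> c] t)"
      unfolding w by (simp only: cat_append[symmetric] replicate_Suc append_Cons append_Nil)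
    have sm: "lt c (s m) (cat [c] w)"
      using lt_replicate[OF cw, of r] r by (simp only: add_2_eq_Suc')
    \<comment> \<open>Since \<open>h\<close> is monotone and commutes with prepending
      \<open>c\<close>, the single inequality \<open>sm\<close> can be iterated: every block of m
      steps gains one more digit \<open>c\<close>.\<close>
    have below: "\<not> lt c (((cat [c]) ^^ k) w) ((h ^^ (m * k)) w)" for k
    proof (induction k)
      case (Suc k)
      have "\<not> lt c ((h ^^ m) (((cat [c]) ^^ k) w)) ((h ^^ m) ((h ^^ (m * k)) w))"
        by (rule hpow_mono[OF hpow[OF wI, THEN conjunct2] hpow_shift[OF wI, THEN conjunct2] Suc])
      then have "\<not> lt c (((cat [c]) ^^ k) (s m)) ((h ^^ (m * Suc k)) w)"
        using hpow_shift[OF wI, of m k] by (simp add: s_def funpow_add)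
      moreover have "lt c (((cat [c]) ^^ k) (s m)) (((cat [c]) ^^ k) (cat [c] w))"
        using sm by (simp only: funpow_cat_singleton lt_cat)
      moreover have "((cat [c]) ^^ k) (cat [c] w) = ((cat [c]) ^^ Suc k) w"
        by (simp only: funpow_Suc_right comp_apply)
      ultimately show ?case using lt_trans by metis
    qed simp
    have "lin S (f ^^ m)"
    proof (rule lin_if_converging_pair[OF S bij_fn[OF bij]])
      show "cat u w \<noteq> cat u (cst c)" unfolding cat_inject by fact
      fix k
      have "((f ^^ m) ^^ k) (cat u w) = cat u ((h ^^ (m * k)) w)"
        using hpow[OF wI] by (simp add: funpow_mult mult.commute)
      moreover have "((f ^^ m) ^^ k) (cat u (cst c)) = cat u (cst c)"
      proof -
        have "(f ^^ j) (cat u (cst c)) = cat u (cst c)" for j by (induction j) (use fixp in auto)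
        then show ?thesis by (simp add: funpow_mult)
      qed
      moreover have "agree k ((h ^^ (m * k)) w) (cst c)"
        by (rule agree_cst_if_below[of c k w]) (use below[of k] in \<open>simp only: funpow_cat_singleton not_False_eq_True\<close>)
      ultimately show "agree k (((f ^^ m) ^^ k) (cat u w)) (((f ^^ m) ^^ k) (cat u (cst c)))"
        using agree_catI by metis
    qed
    then show ?thesis by (rule lin_pow[rotated]) (simp add: m_def)
  next
    case False
    \<comment> \<open>By continuity the limit is fixed, and being different from the centre it is
      regular. The points \<open>s k\<close> come arbitrarily near and are not fixed, which rules
      out triviality of f there.\<close>
    obtain B where B: "lip B f" using G_lip f by blast
    have "f (cat u z) = cat u z"
    proof (rule agree_all)
      fix n
      obtain K K' where K: "\<forall>k\<ge>K. agree n z (s k)" "\<forall>k\<ge>K'. agree (n + B) z (s k)"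
        using z[of n] z[of "n + B"] by blast
      let ?k = "max K K'"
      have "agree n (f (cat u z)) (f (cat u (s ?k)))" using K(2)[rule_format, of ?k] by (intro lipD[OF B] agree_catI) simp
      moreover have "agree n (cat u (s (Suc ?k))) (cat u z)" using K(1)[rule_format, of "Suc ?k"] by (intro agree_catI) (rule agree_sym, simp)
      ultimately show "agree n (f (cat u z)) (cat u z)" unfolding fs by (rule agree_trans)
    qed
    from regular_fixpoint[OF S bij this germD(4)[OF g False]]
    consider n where "\<forall>y. agree n (cat u z) y \<longrightarrow> f y = y" | "lin S f"
      by (elim disjE exE)
    then show ?thesis
    proof cases
      case 1
      obtain K where "agree n z (s K)" using z[of n] by blast
      then have "f (cat u (s K)) = cat u (s K)" using 1 agree_catI by metis
      then have "s (Suc K) = s K" unfolding fs cat_inject .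
      then show ?thesis using sdec[of K] by simp
    qed
  qed
qed

text \<open>If f is not trivial near a singular fixed point, some nearby point is moved. Either f
  moves it towards the fixed point, or the inverse moves its image towards it, and
  \<open>lin_if_decreasing\<close> applies to the map in question.\<close>

lemma fixpoint_trivial_or_lin:
  assumes S: "finite S" "S \<subseteq> G" and f: "f \<in> G" and fixp: "f p = p"
  shows "(\<exists>n. \<forall>y. agree n p y \<longrightarrow> f y = y) \<or> lin S f"
  using G_cases[OF f, of p]
proof cases
  case 1
  then show ?thesis using regular_fixpoint[OF S G_bij[OF f] fixp] by blast
next
  case (2 u v c F)
  have bij: "bij f" using f by (rule G_bij)
  obtain i F' where g': "germ (inv f) (v @ replicate i c) u c F'"
    using germ_inv[OF f 2(2)] by blast
  let ?u = "v @ replicate i c"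
  have p': "p = cat ?u (cst c)" using fixp germ_apply[OF 2(2)] 2(1) by simp
  obtain B where B: "lip B f" using G_lip f by blast
  \<comment> \<open>This depth, with \<open>B\<close> more digits for applying f, puts both y and
    \<open>f y\<close> into the cone of the germ of f and into that of the inverse germ.\<close>
  let ?n = "length u + length ?u"
  show ?thesis
  proof (cases "\<exists>y. agree (?n + B) p y \<and> f y \<noteq> y")
    case True
    then obtain y where y: "agree (?n + B) p y" "f y \<noteq> y" by blast
    have "agree ?n p y" using y(1) by (rule agree_mono) simp
    moreover have "agree ?n p (f y)" using lipD[OF B y(1)] fixp by simp
    ultimately have "agree (length u) p y" "agree (length u) p (f y)"
      "agree (length ?u) p y" "agree (length ?u) p (f y)"
      by (auto elim!: agree_mono)
    then obtain w w' z z' where w: "y = cat u w" "f y = cat u w'" "y = cat ?u z" "f y = cat ?u z'"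
      using 2(1) p' agree_cat_ex by metis
    have "w \<noteq> w'" using w(1,2) y(2) by auto
    then consider "lt c w' w" | "lt c w w'" using lt_linear by blast
    then show ?thesis
    proof cases
      case 1
      have "f (cat u (cst c)) = cat u (cst c)" using fixp 2(1) by simp
      moreover have "f (cat u w) = cat u w'" using w by metis
      ultimately show ?thesis using lin_if_decreasing[OF S f 2(2)] 1 by blast
    next
      case b: 2
      then have "lt c y (f y)" using w(1,2) by (metis lt_cat)
      then have "lt c z z'" using w(3,4) by (metis lt_cat)
      moreover have "inv f (cat ?u (cst c)) = cat ?u (cst c)"
        using fixp p' bij by (metis bij_inv_eq_iff)
      moreover have "inv f (cat ?u z') = cat ?u z" using w bij by (metis bij_inv_eq_iff)
      ultimately have "lin S (inv f)" using lin_if_decreasing[OF S G_inv[OF f] g'] by blast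
      then show ?thesis using lin_inv S(2) bij by blast
    qed
  qed blast
qed

section \<open>Bijections that are regular everywhere\<close>

lemma exists_cat_neq:
  assumes "t \<noteq> []" obtains w where "cat t w \<noteq> w"
proof -
  have "cat t (cst (\<not> hd t)) 0 \<noteq> cst (\<not> hd t) 0"
    using assms by (simp add: cat_def hd_conv_nth)
  then show ?thesis using that by metis
qed

text \<open>A cone determines its word. This makes \<open>slope\<close> independent of the chosen
  description of the map.\<close>

lemma cat_all_eq:
  assumes "\<And>w. cat a w = cat b w" shows "a = b"
proof -
  have *: "c = d" if eq: "\<And>w. cat c w = cat d w" and le: "length c \<le> length d" for c d
  proof -
    obtain t where t: "d = c @ t" using cat_eq_le[OF eq le] by blast
    then have "cat t w = w" for w using eq[of w] by simp
    then have "t = []" using exists_cat_neq by metis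
    then show ?thesis using t by simp
  qed
  show ?thesis using *[of a b] *[of b a] assms by (metis nle_le)
qed

text \<open>The binary logarithm of the slope at x, up to sign.\<close>

definition slope :: "(cantor \<Rightarrow> cantor) \<Rightarrow> cantor \<Rightarrow> int" where
  "slope f x = (THE d. \<exists>u v. is_prefix u x \<and> (\<forall>w. f (cat u w) = cat v w) \<and> d = int (length v) - int (length u))"

lemma slope_eq:
  assumes "\<And>w. f (cat u w) = cat v w"
  shows "slope f (cat u z) = int (length v) - int (length u)"
  unfolding slope_def
proof (rule the_equality)
  show "\<exists>u' v'. is_prefix u' (cat u z) \<and> (\<forall>w. f (cat u' w) = cat v' w) \<and>
     int (length v) - int (length u) = int (length v') - int (length u')"
    using assms unfolding is_prefix_iff by blast
next
  fix d
  assume "\<exists>u' v'. is_prefix u' (cat u z) \<and> (\<forall>w. f (cat u' w) = cat v' w) \<and> d = int (length v') - int (length u')"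
  then obtain u' v' z' where *: "cat u z = cat u' z'" "\<And>w. f (cat u' w) = cat v' w"
    "d = int (length v') - int (length u')"
    unfolding is_prefix_iff by blast
  show "d = int (length v) - int (length u)"
  proof (cases "length u \<le> length u'")
    case True
    then obtain t where t: "u' = u @ t" using cat_eq_le *(1) by metis
    then have "v' = v @ t" using *(2) assms by (intro cat_all_eq) (metis cat_append)
    then show ?thesis using t * by simp
  next
    case False
    then obtain t where t: "u = u' @ t" using cat_eq_le *(1) by (metis nle_le)
    then have "v = v' @ t" using *(2) assms by (intro cat_all_eq) (metis cat_append)
    then show ?thesis using t * by simp
  qed
qed

lemma slope_comp:
  assumes "regular f x" "regular g (f x)"
  shows "slope (g \<circ> f) x = slope f x + slope g (f x)"
proof -
  obtain u v z where f: "x = cat u z" "f x = cat v z" "\<And>w. f (cat u w) = cat v w"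
    using assms(1) by (blast elim: regularE)
  obtain u' v' z' where g: "f x = cat u' z'" "\<And>w. g (cat u' w) = cat v' w"
    using regularE[OF assms(2)] by metis
  show ?thesis
  proof (cases "length u' \<le> length v")
    case True
    then obtain t where t: "v = u' @ t" using cat_eq_le f(2) g(1) by metis
    have gv: "g (cat v w) = cat (v' @ t) w" for w using g t by simp
    then have "(g \<circ> f) (cat u w) = cat (v' @ t) w" for w using f by simp
    from slope_eq[of "g \<circ> f", OF this] slope_eq[of f, OF f(3)] slope_eq[of g, OF gv]
    show ?thesis unfolding f(2) unfolding f(1) by simp
  next
    case False
    then obtain t where t: "u' = v @ t" "z = cat t z'" using cat_eq_le f(2) g(1) by (metis nle_le)
    have fu: "f (cat (u @ t) w) = cat u' w" for w using f t by simp
    then have "(g \<circ> f) (cat (u @ t) w) = cat v' w" for w using g(2)[of w] by simp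
    from slope_eq[of "g \<circ> f", OF this, of z'] slope_eq[of f, OF fu, of z'] slope_eq[of g, OF g(2), of z']
    show ?thesis unfolding g(1) unfolding f(1) t(2) by simp
  qed
qed

lemma slope_inv:
  assumes "bij f" "regular f x"
  shows "slope (inv f) (f x) = - slope f x"
proof -
  obtain u v z where f: "x = cat u z" "f x = cat v z" "\<And>w. f (cat u w) = cat v w"
    using assms(2) by (blast elim: regularE)
  have "inv f (cat v w) = cat u w" for w using f(3) assms(1) by (metis bij_is_inj inv_f_f)
  from slope_eq[of "inv f", OF this, of z] slope_eq[of f, OF f(3), of z]
  show ?thesis unfolding f(2) unfolding f(1) by simp
qed

lemma uniformly_regular:
  assumes "\<And>x. regular g x"
  obtains M where "\<And>a. length a \<ge> M \<Longrightarrow> \<exists>b. \<forall>w. g (cat a w) = cat b w"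
proof -
  define P where "P a \<longleftrightarrow> (\<exists>b. \<forall>w. g (cat a w) = cat b w)" for a
  have "P (a @ b)" if "P a" for a b using that unfolding P_def by (metis cat_append)
  moreover have "\<exists>n. P (pre n x)" for x
  proof -
    obtain u v z where "x = cat u z" "\<And>w. g (cat u w) = cat v w"
      using regularE[OF assms[of x]] by metis
    then have "P (pre (length u) x)" unfolding P_def by auto
    then show ?thesis ..
  qed
  ultimately obtain M where "\<And>a. length a \<ge> M \<Longrightarrow> P a" using fan by metis
  then show ?thesis using that unfolding P_def by blast
qed

text \<open>The depth of the image cone is the starting depth plus the slope. As long as it is at
  least \<open>M\<close>, the next application of g is again a single prefix replacement.\<close>

lemma iterate_cone:
  assumes M: "\<And>a. length a \<ge> M \<Longrightarrow> \<exists>b. \<forall>w. g (cat a w) = cat b w"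
    and "\<And>t. t < k \<Longrightarrow> int M \<le> int (length a) + slope (g ^^ t) (cat a z)"
  shows "\<exists>b. (\<forall>w. (g ^^ k) (cat a w) = cat b w) \<and> int (length b) = int (length a) + slope (g ^^ k) (cat a z)"
  using assms(2)
proof (induction k)
  case 0
  have "slope (g ^^ 0) (cat a z) = int (length a) - int (length a)" by (rule slope_eq) simp
  then have "(\<forall>w. (g ^^ 0) (cat a w) = cat a w) \<and> int (length a) = int (length a) + slope (g ^^ 0) (cat a z)"
    by (simp only: funpow_0 diff_self add_0_right simp_thms)
  then show ?case by (rule exI)
next
  case (Suc k)
  then obtain b where b: "\<forall>w. (g ^^ k) (cat a w) = cat b w" "int (length b) = int (length a) + slope (g ^^ k) (cat a z)"
    by (meson less_SucI)
  then have "length b \<ge> M" using Suc.prems[of k] by simp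
  then obtain b' where "\<forall>w. g (cat b w) = cat b' w" using M by blast
  then have b': "(g ^^ Suc k) (cat a w) = cat b' w" for w using b by simp
  show ?case
    by (intro exI[of _ b'] conjI allI b') (use slope_eq[of "g ^^ Suc k", OF b', of z] in linarith)
qed

lemma regular_funpow_all: "(\<And>x. regular g x) \<Longrightarrow> regular (g ^^ k) x"
  by (rule regular_funpow)

text \<open>A positive slope means contraction here. A very large slope along an orbit would provide
  two moments with the same prefix of length \<open>M\<close>, a net contraction between them and no
  expansion beyond the start in between; the return map would then contract a cone into
  itself.\<close>

lemma slope_bounded:
  assumes reg: "\<And>x. regular g x"
    and no: "\<And>n a t. t \<noteq> [] \<Longrightarrow> \<exists>w. (g ^^ n) (cat a w) \<noteq> cat (a @ t) w"
  obtains B :: nat where "\<And>k x. slope (g ^^ k) x \<le> int B"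
proof -
  obtain M where M: "\<And>a. length a \<ge> M \<Longrightarrow> \<exists>b. \<forall>w. g (cat a w) = cat b w"
    using uniformly_regular[OF reg] by blast
  define b where "b a = (SOME b. \<forall>w. g (cat a w) = cat b w)" for a
  have b: "g (cat a w) = cat (b a) w" if "length a = M" for a w
    unfolding b_def by (rule someI_ex[OF M, THEN spec]) (simp add: that)
  define S where "S = (\<Sum>a | length a = M. int (length (b a)))"
  have S: "slope g x \<le> S" for x
  proof -
    let ?a = "pre M x"
    have "slope g (cat ?a (sdrop M x)) = int (length (b ?a)) - int (length ?a)"
      by (rule slope_eq) (simp add: b)
    moreover have "int (length (b ?a)) \<le> S"
      unfolding S_def by (rule member_le_sum) (auto simp: finite_words)
    ultimately show ?thesis by simp
  qed
  have "S \<ge> 0" unfolding S_def by (rule sum_nonneg) simp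
  have "slope (g ^^ k) x \<le> S * 2 ^ M" for k x
  proof (rule ccontr)
    assume big: "\<not> ?thesis"
    define \<delta> where "\<delta> t = slope (g ^^ t) x" for t
    have \<delta>_add: "slope (g ^^ t) ((g ^^ i) x) = \<delta> (t + i) - \<delta> i" for t i
      using slope_comp[OF regular_funpow_all[OF reg] regular_funpow_all[OF reg], of t i x]
      unfolding \<delta>_def funpow_add by linarith
    have \<delta>0: "\<delta> 0 = 0" using \<delta>_add[of 0 0] slope_eq[of id "[]" "[]" x] by (simp add: \<delta>_def id_def)
    have \<delta>S: "\<delta> (Suc t) \<le> \<delta> t + S" for t using \<delta>_add[of 1 t] S[of "(g ^^ t) x"] by simp
    \<comment> \<open>\<open>i r\<close> is the last time at which the slope is at most r S. As one
      step adds at most S, the slope at that time lies above (r - 1) S.\<close>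
    define I where "I r = {t. t \<le> k \<and> \<delta> t \<le> int r * S}" for r :: nat
    define i where "i r = Max (I r)" for r
    have I: "finite (I r)" "0 \<in> I r" for r using \<delta>0 \<open>S \<ge> 0\<close> by (auto simp: I_def)
    have iI: "i r \<in> I r" for r unfolding i_def by (rule Max_in) (use I[of r] in auto)
    have after: "\<delta> t > int r * S" if "i r < t" "t \<le> k" for r t
    proof (rule ccontr)
      assume "\<not> ?thesis"
      then have "t \<in> I r" using that(2) by (simp add: I_def)
      then have "t \<le> i r" unfolding i_def by (rule Max_ge[OF I(1)])
      then show False using that(1) by simp
    qed
    have i_less: "i r < k \<and> (int r - 1) * S < \<delta> (i r)" if "r \<le> 2 ^ M" for r
    proof -
      have "int r \<le> 2 ^ M" using that by (metis of_nat_le_iff of_nat_numeral of_nat_power)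
      then have "int r * S \<le> S * 2 ^ M" using \<open>S \<ge> 0\<close> by (simp add: mult.commute mult_left_mono)
      then have "\<delta> k > int r * S" using big by (simp add: \<delta>_def)
      then have "i r \<noteq> k" "i r \<le> k" using iI[of r] by (auto simp: I_def)
      then have less: "i r < k" by simp
      then have "\<delta> (Suc (i r)) > int r * S" using after by simp
      then show ?thesis using less \<delta>S[of "i r"] by (simp add: algebra_simps)
    qed
    define \<phi> where "\<phi> r = pre M ((g ^^ i r) x)" for r
    \<comment> \<open>There are 2^M + 1 levels r but 2^M prefixes of length
      \<open>M\<close>.\<close>
    have "\<not> inj_on \<phi> {..2 ^ M}"
    proof
      assume "inj_on \<phi> {..2 ^ M}"
      then have "card {..(2::nat) ^ M} \<le> card {a :: bool list. length a = M}"
        by (intro card_inj_on_le[of \<phi>]) (auto simp: \<phi>_def finite_words)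
      then show False by (simp add: card_words)
    qed
    then obtain r r' where r: "r < r'" "r' \<le> 2 ^ M" "\<phi> r = \<phi> r'"
      unfolding inj_on_def by (metis atMost_iff nat_neq_iff)
    have "\<delta> (i r) \<le> int r * S" using iI[of r] by (simp add: I_def)
    also have "\<dots> \<le> (int r' - 1) * S" using r(1) \<open>S \<ge> 0\<close> by (intro mult_right_mono) auto
    also have "\<dots> < \<delta> (i r')" using i_less r(2) by blast
    finally have \<delta>_less: "\<delta> (i r) < \<delta> (i r')" .
    have "int r * S \<le> int r' * S" using r(1) \<open>S \<ge> 0\<close> by (intro mult_right_mono) auto
    then have "i r \<in> I r'" using iI[of r] by (auto simp: I_def)
    then have "i r \<le> i r'" using I(1) unfolding i_def by (intro Max_ge) auto
    then have ii: "i r < i r'" using \<delta>_less by (cases "i r = i r'") auto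
    define n where "n = i r' - i r"
    let ?x = "(g ^^ i r) x"
    let ?a = "pre M ?x"
    \<comment> \<open>After \<open>i r\<close> the slope stays above its level, so the image cone
      never becomes shallower than \<open>M\<close> and can be followed up to time
      \<open>i r'\<close>.\<close>
    have "0 \<le> slope (g ^^ t) ?x" if "t < n" for t
    proof (cases t)
      case 0 then show ?thesis using \<delta>_add[of 0 "i r"] by simp
    next
      case (Suc t')
      have "\<delta> (t + i r) > int r * S"
      proof (rule after)
        show "t + i r \<le> k" using that i_less[OF r(2)] unfolding n_def by linarith
      qed (simp add: Suc)
      then show ?thesis using \<delta>_add[of t "i r"] iI[of r] by (simp add: I_def)
    qed
    then have "\<And>t. t < n \<Longrightarrow> int M \<le> int (length ?a) + slope (g ^^ t) (cat ?a (sdrop M ?x))" by simp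
    from iterate_cone[OF M this]
    obtain b where b: "\<And>w. (g ^^ n) (cat ?a w) = cat b w" "int (length b) = int M + slope (g ^^ n) ?x"
      by auto
    have nx: "(g ^^ n) ?x = (g ^^ i r') x" using ii by (simp add: n_def funpow_add[symmetric, THEN fun_cong, simplified])
    have len: "length b > M" using b(2) \<delta>_add[of n "i r"] \<delta>_less ii by (simp add: n_def)
    have "cat ?a (sdrop M ((g ^^ i r') x)) = (g ^^ i r') x"
      using r(3) cat_pre_sdrop[of M "(g ^^ i r') x"] by (simp add: \<phi>_def)
    also have "\<dots> = cat b (sdrop M ?x)" using b(1)[of "sdrop M ?x"] nx by simp
    finally obtain t where t: "b = ?a @ t" using cat_eq_le len by (metis length_pre less_imp_le)
    then have "t \<noteq> []" using len by auto
    then show False using no[of t n ?a] b(1) t by metis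
  qed
  then have "slope (g ^^ k) x \<le> int (nat (S * 2 ^ M))" for k x using \<open>S \<ge> 0\<close> by simp
  then show ?thesis by (rule that)
qed

text \<open>The fixed point is \<open>a\<close> followed by the periodic word with period
  \<open>t\<close>. Inserting many copies of \<open>t\<close> in front of a tail not fixed by
  \<open>cat t\<close> gives points nearby that are moved.\<close>

lemma contracting_fixpoint:
  assumes "t \<noteq> []" and h: "\<And>w. h (cat a w) = cat (a @ t) w"
  obtains z where "h z = z" "\<And>n. \<exists>y. agree n z y \<and> h y \<noteq> y"
proof -
  define z0 where "z0 = (\<lambda>i. t ! (i mod length t))"
  have z0: "cat t z0 = z0"
    unfolding z0_def using \<open>t \<noteq> []\<close> by (intro ext) (simp add: cat_def le_mod_geq)
  obtain w where w: "cat t w \<noteq> w" using exists_cat_neq \<open>t \<noteq> []\<close> by metis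
  have "h (cat a z0) = cat a z0" using h[of z0] z0 by simp
  moreover have "\<exists>y. agree n (cat a z0) y \<and> h y \<noteq> y" for n
  proof -
    have "((cat t) ^^ n) z0 = z0" by (induction n) (use z0 in auto)
    then have "agree n (cat a z0) (cat a (((cat t) ^^ n) w))"
      using agree_funpow_cat[OF \<open>t \<noteq> []\<close>, of n z0 w] by (simp add: agree_catI)
    moreover have "cat t (((cat t) ^^ n) w) \<noteq> ((cat t) ^^ n) w"
      by (induction n) (use w in auto)
    ultimately show ?thesis using h[of "((cat t) ^^ n) w"] by auto
  qed
  ultimately show ?thesis by (rule that)
qed

text \<open>A cone contracted by a power of g or of its inverse contains the required fixed point.
  Otherwise the slopes of all powers are bounded on both sides, which leaves room for finitely many
  powers.\<close>

lemma regular_dichotomy: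
  assumes bij: "bij g" and reg: "\<And>x. regular g x"
  obtains n where "n > 0" "g ^^ n = id"
  | n z where "(g ^^ n) z = z" "\<And>m. \<exists>y. agree m z y \<and> (g ^^ n) y \<noteq> y"
proof (cases "\<exists>n a t. t \<noteq> [] \<and> ((\<forall>w. (g ^^ n) (cat a w) = cat (a @ t) w) \<or> (\<forall>w. (inv g ^^ n) (cat a w) = cat (a @ t) w))")
  case True
  then obtain n a t where t: "t \<noteq> []" and
    "(\<forall>w. (g ^^ n) (cat a w) = cat (a @ t) w) \<or> (\<forall>w. (inv g ^^ n) (cat a w) = cat (a @ t) w)" by blast
  then show ?thesis
  proof (elim disjE)
    assume "\<forall>w. (g ^^ n) (cat a w) = cat (a @ t) w"
    then have "(g ^^ n) (cat a w) = cat (a @ t) w" for w by blast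
    then show ?thesis by (rule contracting_fixpoint[OF t, of "g ^^ n" a]) (rule that(2))
  next
    assume "\<forall>w. (inv g ^^ n) (cat a w) = cat (a @ t) w"
    then have contr: "(inv g ^^ n) (cat a w) = cat (a @ t) w" for w by blast
    obtain z where z: "(inv g ^^ n) z = z" "\<And>m. \<exists>y. agree m z y \<and> (inv g ^^ n) y \<noteq> y"
      using contracting_fixpoint[OF t contr] by metis
    have iff: "(inv g ^^ n) y = y \<longleftrightarrow> (g ^^ n) y = y" for y
      unfolding inv_funpow[OF bij, symmetric] using bij_fn[OF bij, of n] by (metis bij_inv_eq_iff)
    show ?thesis by (rule that(2)[of n z]) (use z iff in auto)
  qed
next
  case False
  have no: "\<exists>w. (g ^^ n) (cat a w) \<noteq> cat (a @ t) w" "\<exists>w. (inv g ^^ n) (cat a w) \<noteq> cat (a @ t) w"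
    if "t \<noteq> []" for n a t
    using False that by blast+
  obtain B where B: "\<And>k x. slope (g ^^ k) x \<le> int B"
    using slope_bounded[OF reg no(1)] by blast
  have regi: "regular (inv g) x" for x
    using regular_inv[OF bij_is_inj[OF bij] reg, of "inv g x"] bij by (simp add: bij_is_surj surj_f_inv_f)
  obtain B' where B': "\<And>k x. slope (inv g ^^ k) x \<le> int B'"
    using slope_bounded[OF regi no(2)] by blast
  obtain M where M: "\<And>a. length a \<ge> M \<Longrightarrow> \<exists>b. \<forall>w. g (cat a w) = cat b w"
    using uniformly_regular[OF reg] by blast
  \<comment> \<open>Slopes of powers are at least -B', so images of a cone of depth \<open>D\<close>
    stay at depth at least \<open>M\<close>, and every power acts on it by one prefix
    replacement.\<close>
  define D where "D = M + B'"
  have lower: "slope (g ^^ k) x \<ge> - int B'" for k x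
    using slope_inv[OF bij_fn[OF bij] regular_funpow_all[OF reg], of k x] inv_funpow[OF bij, of k]
      B'[of k "(g ^^ k) x"] by simp
  have ex: "\<exists>b. (\<forall>w. (g ^^ k) (cat a w) = cat b w) \<and> length b \<le> D + B" if a: "length a = D" for k a
  proof -
    have low: "int M \<le> int (length a) + slope (g ^^ t) (cat a (cst True))" for t
      using lower[of t "cat a (cst True)"] a unfolding D_def by (smt (verit) of_nat_add)
    have "\<exists>b. (\<forall>w. (g ^^ k) (cat a w) = cat b w) \<and> int (length b) = int (length a) + slope (g ^^ k) (cat a (cst True))"
      by (rule iterate_cone) (fact M, rule low)
    then obtain b where "\<forall>w. (g ^^ k) (cat a w) = cat b w"
      "int (length b) = int (length a) + slope (g ^^ k) (cat a (cst True))" by blast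
    then show ?thesis using B[of k "cat a (cst True)"] a by (intro exI[of _ b] conjI) (assumption, linarith)
  qed
  define \<beta> where "\<beta> k a = (SOME b. (\<forall>w. (g ^^ k) (cat a w) = cat b w) \<and> length b \<le> D + B)" for k a
  have \<beta>: "(\<forall>w. (g ^^ k) (cat a w) = cat (\<beta> k a) w) \<and> length (\<beta> k a) \<le> D + B" if "length a = D" for k a
    unfolding \<beta>_def by (rule someI_ex[OF ex[OF that]])
  define \<gamma> where "\<gamma> k = restrict (\<beta> k) {a. length a = D}" for k
  \<comment> \<open>A power of g is determined by a table of target words of bounded length for the
    words of length \<open>D\<close>. There are finitely many tables, so two powers
    coincide.\<close>
  have "range \<gamma> \<subseteq> {a. length a = D} \<rightarrow>\<^sub>E {b. set b \<subseteq> UNIV \<and> length b \<le> D + B}"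
    using \<beta> by (auto simp: \<gamma>_def split: if_splits)
  moreover have "finite ({a :: bool list. length a = D} \<rightarrow>\<^sub>E {b :: bool list. set b \<subseteq> UNIV \<and> length b \<le> D + B})"
    by (intro finite_PiE finite_words finite_lists_length_le) simp
  ultimately have "\<not> inj \<gamma>" using finite_subset finite_imageD infinite_UNIV_nat by blast
  then obtain k l where kl: "k < l" "\<gamma> k = \<gamma> l" unfolding inj_on_def by (metis nat_neq_iff)
  have "(g ^^ k) x = (g ^^ l) x" for x
  proof -
    have "\<beta> k (pre D x) = \<beta> l (pre D x)" using fun_cong[OF kl(2), of "pre D x"] by (simp add: \<gamma>_def)
    then show ?thesis using \<beta>[of "pre D x" k] \<beta>[of "pre D x" l] by (metis cat_pre_sdrop length_pre)
  qed
  then have "(g ^^ k) x = (g ^^ k) ((g ^^ (l - k)) x)" for x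
    using kl(1) funpow_add[of k "l - k" g] by simp
  then have "(g ^^ (l - k)) x = x" for x using bij_fn[OF bij, of k] by (metis bij_is_inj injD)
  then show ?thesis using that(1)[of "l - k"] kl(1) by (auto simp: fun_eq_iff)
qed

section \<open>Singular points on infinite orbits\<close>

lemma funpow_inj:
  fixes f :: "'a \<Rightarrow> 'a"
  assumes "bij f" "(f ^^ n) x = (f ^^ n) y" shows "x = y"
  using assms(2) bij_is_inj[OF bij_fn[OF assms(1), of n]] by (simp add: inj_eq)

lemma inv_funpow_cancel:
  fixes f :: "'a \<Rightarrow> 'a"
  assumes "bij f"
  shows "(f ^^ n) ((inv f ^^ n) x) = x" "(inv f ^^ n) ((f ^^ n) x) = x"
proof -
  have b: "bij (f ^^ n)" using bij_fn[OF assms] .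
  show "(f ^^ n) ((inv f ^^ n) x) = x"
    unfolding inv_funpow[OF assms, symmetric] using b by (simp add: bij_is_surj surj_f_inv_f)
  show "(inv f ^^ n) ((f ^^ n) x) = x"
    unfolding inv_funpow[OF assms, symmetric] using b by (simp add: bij_is_inj)
qed

text \<open>Points of P are not periodic, so an orbit visits each of them at most once. The second
  claim is the same statement for the backward orbit.\<close>

lemma finite_hitting_times:
  fixes f :: "'a \<Rightarrow> 'a"
  assumes "bij f" "finite P" and aper: "\<And>p n. p \<in> P \<Longrightarrow> n > 0 \<Longrightarrow> (f ^^ n) p \<noteq> p"
  shows "finite {j. (f ^^ j) x \<in> P}" "finite {j. \<exists>q\<in>P. (f ^^ j) q = x}"
proof -
  have "inj_on (\<lambda>j. (f ^^ j) x) {j. (f ^^ j) x \<in> P}"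
  proof (rule linorder_inj_onI)
    fix i j assume ij: "i < j" "i \<in> {j. (f ^^ j) x \<in> P}"
    have "(f ^^ j) x = (f ^^ (j - i)) ((f ^^ i) x)"
      using ij(1) funpow_add[of "j - i" i f] by simp
    then show "(f ^^ i) x \<noteq> (f ^^ j) x" using aper[of "(f ^^ i) x" "j - i"] ij by auto
  qed auto
  then show "finite {j. (f ^^ j) x \<in> P}"
    by (rule inj_on_finite[OF _ _ assms(2)]) auto
  have "finite {j. (f ^^ j) q = x}" if "q \<in> P" for q
  proof -
    have "j = i" if "(f ^^ j) q = x" "(f ^^ i) q = x" "i \<le> j" for i j
    proof (rule ccontr)
      assume "j \<noteq> i"
      have "(f ^^ i) ((f ^^ (j - i)) q) = (f ^^ i) q"
        using that funpow_add[of i "j - i" f] by simp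
      then have "(f ^^ (j - i)) q = q" by (rule funpow_inj[OF assms(1)])
      then show False using aper[OF \<open>q \<in> P\<close>, of "j - i"] that(3) \<open>j \<noteq> i\<close> by simp
    qed
    then have uniq: "i = j" if "(f ^^ i) q = x" "(f ^^ j) q = x" for i j
      using that by (metis nle_le)
    show ?thesis
    proof (cases "\<exists>i. (f ^^ i) q = x")
      case True
      then obtain i where "(f ^^ i) q = x" by blast
      then have "{j. (f ^^ j) q = x} \<subseteq> {i}" using uniq by auto
      then show ?thesis using finite_subset by blast
    qed simp
  qed
  moreover have "{j. \<exists>q\<in>P. (f ^^ j) q = x} = (\<Union>q\<in>P. {j. (f ^^ j) q = x})" by blast
  ultimately show "finite {j. \<exists>q\<in>P. (f ^^ j) q = x}" using assms(2) by simp
qed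

text \<open>For i + m <= k the point f^{-i} r is a singularity of f^k: write f^k as f^i, then f^m,
  then f^{k-m-i}. The outer factors are regular along this orbit and so are their inverses, so
  regularity of f^k would pass to f^m at r. Aperiodicity makes these points distinct.\<close>

lemma lin_if_total_germ_singular:
  assumes S: "finite S" "S \<subseteq> G" and f: "f \<in> G"
    and aper: "\<And>n. n > 0 \<Longrightarrow> (f ^^ n) r \<noteq> r"
    and before: "\<And>i. i > 0 \<Longrightarrow> regular f ((inv f ^^ i) r)"
    and after: "\<And>i. i \<ge> m \<Longrightarrow> regular f ((f ^^ i) r)"
    and sing: "\<not> regular (f ^^ m) r"
  shows "lin S f"
proof (rule lin_if_many_sing[OF S, of m])
  fix k
  have bij: "bij f" using f by (rule G_bij)
  have "inj (\<lambda>i. (inv f ^^ i) r)"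
  proof (rule linorder_injI)
    fix i j :: nat assume "i < j"
    have "(f ^^ j) ((inv f ^^ i) r) = (f ^^ (j - i)) r"
      using \<open>i < j\<close> funpow_add[of "j - i" i f] inv_funpow_cancel(1)[OF bij, of i r] by simp
    moreover have "(f ^^ j) ((inv f ^^ j) r) = r" using inv_funpow_cancel(1)[OF bij] .
    ultimately show "(inv f ^^ i) r \<noteq> (inv f ^^ j) r" using aper[of "j - i"] \<open>i < j\<close> by auto
  qed
  then have "card ((\<lambda>i. (inv f ^^ i) r) ` {i. i + m \<le> k}) = card {i. i + m \<le> k}"
    by (intro card_image) (rule inj_on_subset, auto)
  moreover have "card {..<k - m} \<le> card {i. i + m \<le> k}"
    by (rule card_mono) (auto intro: finite_subset[of _ "{..k}"])
  ultimately have card: "k - m \<le> card ((\<lambda>i. (inv f ^^ i) r) ` {i. i + m \<le> k})" by simp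
  have "(inv f ^^ i) r \<in> sing (f ^^ k)" if i: "i + m \<le> k" for i
  proof (rule ccontr)
    assume "\<not> ?thesis"
    let ?y = "(inv f ^^ i) r" and ?e = "k - m - i"
    have k: "k = ?e + (m + i)" using i by simp
    have fk: "f ^^ k = f ^^ ?e \<circ> f ^^ m \<circ> f ^^ i" by (subst k) (simp only: funpow_add comp_assoc)
    have y: "(f ^^ i) ?y = r" using inv_funpow_cancel(1)[OF bij] .
    have reg1: "regular (f ^^ i) ?y"
    proof (rule regular_funpow)
      fix t assume "t < i"
      have "?y = (inv f ^^ t) ((inv f ^^ (i - t)) r)"
        using \<open>t < i\<close> funpow_add[of t "i - t" "inv f"] by simp
      then have "(f ^^ t) ?y = (inv f ^^ (i - t)) r" using inv_funpow_cancel(1)[OF bij] by simp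
      then show "regular f ((f ^^ t) ?y)" using before[of "i - t"] \<open>t < i\<close> by simp
    qed
    have reg2: "regular (f ^^ ?e) ((f ^^ m) r)"
    proof (rule regular_funpow)
      fix t
      have "(f ^^ t) ((f ^^ m) r) = (f ^^ (t + m)) r" by (simp add: funpow_add)
      then show "regular f ((f ^^ t) ((f ^^ m) r))" using after[of "t + m"] by simp
    qed
    have "regular (inv (f ^^ i)) r"
      using regular_inv[OF bij_is_inj[OF bij_fn[OF bij]] reg1] y by simp
    moreover have "inv (f ^^ i) r = ?y" by (simp add: inv_funpow[OF bij])
    moreover have "regular (f ^^ k) ?y" using \<open>\<not> ?y \<in> sing (f ^^ k)\<close> by (simp add: sing_def)
    ultimately have "regular (f ^^ k \<circ> inv (f ^^ i)) r" using regular_comp by simp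
    moreover have "regular (inv (f ^^ ?e)) ((f ^^ ?e) ((f ^^ m) r))"
      by (rule regular_inv[OF bij_is_inj[OF bij_fn[OF bij]] reg2])
    moreover have fki: "(f ^^ k \<circ> inv (f ^^ i)) x = (f ^^ ?e) ((f ^^ m) x)" for x
      unfolding fk using bij_fn[OF bij, of i] by (simp add: bij_is_surj surj_f_inv_f)
    ultimately have "regular (inv (f ^^ ?e) \<circ> (f ^^ k \<circ> inv (f ^^ i))) r"
      using regular_comp by metis
    moreover have "inv (f ^^ ?e) \<circ> (f ^^ k \<circ> inv (f ^^ i)) = f ^^ m"
    proof
      fix x
      have "(inv (f ^^ ?e) \<circ> (f ^^ k \<circ> inv (f ^^ i))) x = inv (f ^^ ?e) ((f ^^ ?e) ((f ^^ m) x))"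
        by (simp only: comp_apply[of "inv (f ^^ ?e)"] fki)
      also have "\<dots> = (f ^^ m) x" using bij_fn[OF bij, of ?e] by (simp only: bij_is_inj inv_f_f)
      finally show "(inv (f ^^ ?e) \<circ> (f ^^ k \<circ> inv (f ^^ i))) x = (f ^^ m) x" .
    qed
    ultimately show False using sing by metis
  qed
  then have "(\<lambda>i. (inv f ^^ i) r) ` {i. i + m \<le> k} \<subseteq> sing (f ^^ k)" by blast
  then have "card ((\<lambda>i. (inv f ^^ i) r) ` {i. i + m \<le> k}) \<le> card (sing (f ^^ k))"
    using G_finite_sing[OF G_funpow[OF f]] by (rule card_mono[rotated])
  then show "k \<le> m + card (sing (f ^^ k))" using card by linarith
qed

lemma separate_finite:
  assumes "finite Z"
  obtains e where "\<And>z z'. z \<in> Z \<Longrightarrow> z' \<in> Z \<Longrightarrow> agree e z z' \<Longrightarrow> z = z'"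
proof -
  define d where "d z z' = (SOME n. z \<noteq> z' \<longrightarrow> \<not> agree n z z')" for z z'
  have d: "z \<noteq> z' \<longrightarrow> \<not> agree (d z z') z z'" for z z'
    unfolding d_def by (rule someI_ex) (use agree_all in blast)
  let ?e = "\<Sum>z\<in>Z. \<Sum>z'\<in>Z. d z z'"
  have "d z z' \<le> ?e" if "z \<in> Z" "z' \<in> Z" for z z'
  proof -
    have "d z z' \<le> (\<Sum>z'\<in>Z. d z z')" using that assms by (intro member_le_sum) auto
    also have "\<dots> \<le> ?e" using that assms by (intro member_le_sum[where f = "\<lambda>z. \<Sum>z'\<in>Z. d z z'"]) auto
    finally show ?thesis .
  qed
  then have "z = z'" if "z \<in> Z" "z' \<in> Z" "agree ?e z z'" for z z'
    using d agree_mono that by metis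
  then show ?thesis by (rule that)
qed

lemma disjoint_neighbourhoods:
  assumes f: "f \<in> G" and R: "finite R"
    and dis: "\<And>r r' i j. r \<in> R \<Longrightarrow> r' \<in> R \<Longrightarrow> i < j \<Longrightarrow> (f ^^ i) r \<noteq> (f ^^ j) r'"
    and reg: "\<And>r. r \<in> R \<Longrightarrow> regular (f ^^ m) r"
  obtains d where
    "\<And>r r' i j x y. r \<in> R \<Longrightarrow> r' \<in> R \<Longrightarrow> agree d r x \<Longrightarrow> agree d r' y \<Longrightarrow> i < j \<Longrightarrow> j < m \<Longrightarrow> (f ^^ i) x \<noteq> (f ^^ j) y"
    "\<And>r x. r \<in> R \<Longrightarrow> agree d r x \<Longrightarrow> regular (f ^^ m) x"
proof -
  obtain B where B: "lip B f" using G_lip f by blast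
  define Z where "Z = (\<Union>i\<in>{..<m}. (f ^^ i) ` R)"
  have "finite Z" using R by (simp add: Z_def)
  then obtain e where e: "\<And>z z'. z \<in> Z \<Longrightarrow> z' \<in> Z \<Longrightarrow> agree e z z' \<Longrightarrow> z = z'"
    using separate_finite by blast
  define n where "n r = (SOME n. \<forall>y. agree n r y \<longrightarrow> regular (f ^^ m) y)" for r
  have n: "\<forall>y. agree (n r) r y \<longrightarrow> regular (f ^^ m) y" if "r \<in> R" for r
    unfolding n_def by (rule someI_ex) (use regular_open[OF reg[OF that]] in metis)
  \<comment> \<open>\<open>e\<close> separates the finitely many orbit points in \<open>Z\<close>,
    \<open>m * B\<close> absorbs the expansion of fewer than m iterations, and the sum covers the
    neighbourhoods on which f^m is regular.\<close>
  define d where "d = e + m * B + (\<Sum>r\<in>R. n r)"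
  show ?thesis
  proof
    fix r r' i j x y
    assume *: "r \<in> R" "r' \<in> R" "agree d r x" "agree d r' y" "i < j" "j < m"
    have near: "agree e ((f ^^ t) q) ((f ^^ t) z)" if "t < m" "agree d q z" for t q z
    proof -
      have "t * B \<le> m * B" using that(1) by simp
      then have "e + t * B \<le> d" unfolding d_def by linarith
      then have "agree (e + t * B) q z" using that(2) agree_mono by blast
      then show ?thesis using lipD[OF lip_funpow[OF B]] by blast
    qed
    show "(f ^^ i) x \<noteq> (f ^^ j) y"
    proof
      assume "(f ^^ i) x = (f ^^ j) y"
      then have "agree e ((f ^^ i) r) ((f ^^ j) r')"
        using near[of i r x] near[of j r' y] * agree_sym agree_trans by (metis less_trans)
      moreover have "(f ^^ i) r \<in> Z" "(f ^^ j) r' \<in> Z" using * by (auto simp: Z_def)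
      ultimately show False using e dis * by blast
    qed
  next
    fix r x assume *: "r \<in> R" "agree d r x"
    have "n r \<le> (\<Sum>r\<in>R. n r)" using * R by (intro member_le_sum) auto
    then have "n r \<le> d" unfolding d_def by linarith
    then have "agree (n r) r x" using *(2) agree_mono by blast
    then show "regular (f ^^ m) x" using n * by blast
  qed
qed

text \<open>If the total germs along the infinite singular orbits are regular, the germs are collected
  at the first singular point of each orbit: the induced map of f on the complement of the
  intermediate neighbourhoods is regular everywhere.\<close>

lemma induced_map:
  assumes f: "f \<in> G" and m: "m > 0"
    and dis: "\<And>i j x y. x \<in> U \<Longrightarrow> y \<in> U \<Longrightarrow> i < j \<Longrightarrow> j < m \<Longrightarrow> (f ^^ i) x \<noteq> (f ^^ j) y"
    and clopen: "\<And>x y. agree d x y \<Longrightarrow> x \<in> U \<longleftrightarrow> y \<in> U"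
    and regU: "\<And>x. x \<in> U \<Longrightarrow> regular (f ^^ m) x"
    and cover: "\<And>x. \<not> regular f x \<Longrightarrow> \<exists>j<m. \<exists>y\<in>U. x = (f ^^ j) y"
  obtains g T where "bij g" "\<And>x. regular g x" "\<And>x. x \<in> T \<Longrightarrow> g x = x"
    "\<And>x. x \<notin> T \<Longrightarrow> g x \<notin> T \<and> (\<exists>j e. 0 < j \<and> j \<le> m \<and> (\<forall>y. agree e x y \<longrightarrow> g y = (f ^^ j) y))"
    "\<And>x. x \<in> T \<Longrightarrow> \<exists>j y. y \<notin> T \<and> x = (f ^^ j) y"
    "\<And>x. x \<in> T \<Longrightarrow> \<exists>e. \<forall>y. agree e x y \<longrightarrow> y \<in> T"
proof -
  have bij: "bij f" using f by (rule G_bij)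
  \<comment> \<open>\<open>T\<close> consists of the levels 1 to m - 1 of the tower over
    \<open>U\<close>. The map g jumps over them from the base and fixes them pointwise, which keeps
    it a bijection of the whole Cantor set.\<close>
  define T where "T = {x. \<exists>j y. 0 < j \<and> j < m \<and> y \<in> U \<and> x = (f ^^ j) y}"
  define g where "g x = (if x \<in> U then (f ^^ m) x else if x \<in> T then x else f x)" for x
  have UT: "x \<notin> T" if "x \<in> U" for x
  proof
    assume "x \<in> T"
    then obtain j y where "0 < j" "j < m" "y \<in> U" "x = (f ^^ j) y" unfolding T_def by blast
    then show False using dis[of x y 0 j] that by simp
  qed
  \<comment> \<open>Together with \<open>fpre\<close>: f maps \<open>U\<close> and \<open>T\<close>
    jointly onto \<open>T\<close> and the f^m-image of \<open>U\<close>. Hence f also matches the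
    complements, where g equals f, and g is bijective.\<close>
  have fstep: "f x \<in> T \<or> (\<exists>y\<in>U. f x = (f ^^ m) y)" if xUT: "x \<in> U \<union> T" for x
  proof -
    have "x = (f ^^ 0) x" by simp
    then obtain j y where j: "j < m" "y \<in> U" "x = (f ^^ j) y"
      using xUT m unfolding T_def by blast
    then have "f x = (f ^^ Suc j) y" by simp
    then show ?thesis using j unfolding T_def by (cases "Suc j = m") (auto intro!: exI[of _ "Suc j"])
  qed
  have fpre: "x \<in> U \<union> T" if fx: "f x \<in> T \<or> (\<exists>y\<in>U. f x = (f ^^ m) y)" for x
  proof -
    obtain j y where j: "0 < j" "j \<le> m" "y \<in> U" "f x = (f ^^ j) y"
      using fx m unfolding T_def by auto
    then have "f x = f ((f ^^ (j - 1)) y)" by (cases j) auto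
    then have x: "x = (f ^^ (j - 1)) y" using bij by (metis bij_is_inj injD)
    show ?thesis
    proof (cases "j = 1")
      case False
      then have "0 < j - 1" "j - 1 < m" using j by auto
      then show ?thesis using x j(3) unfolding T_def by blast
    qed (use x j in simp)
  qed
  have UmT: "(f ^^ m) x \<notin> T" if "x \<in> U" for x
  proof
    assume "(f ^^ m) x \<in> T"
    then obtain j y where j: "0 < j" "j < m" "y \<in> U" "(f ^^ m) x = (f ^^ j) y" unfolding T_def by blast
    then have "f ((f ^^ (m - 1)) x) = f ((f ^^ (j - 1)) y)" using m by (cases m; cases j) auto
    then have "(f ^^ (j - 1)) y = (f ^^ (m - 1)) x" using bij by (metis bij_is_inj injD)
    moreover have "j - 1 < m - 1" "m - 1 < m" using j m by linarith+
    ultimately show False using dis[OF \<open>y \<in> U\<close> that] by blast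
  qed
  have gT: "g x = x" if "x \<in> T" for x using that UT by (auto simp: g_def)
  have gnT: "g x \<notin> T" if "x \<notin> T" for x
    using that UmT fpre[of x] by (auto simp: g_def)
  have gU: "g x = (f ^^ m) x" if "x \<in> U" for x using that by (simp add: g_def)
  have gf: "g x = f x" if "x \<notin> U" "x \<notin> T" for x using that by (simp add: g_def)
  have gUf: "g x \<noteq> g y" if "x \<in> U" "y \<notin> U" "y \<notin> T" for x y
  proof
    assume "g x = g y"
    then have "f y = (f ^^ m) x" using gU[OF that(1)] gf[OF that(2,3)] by simp
    then show False using fpre[of y] that by blast
  qed
  have "inj g"
  proof (rule injI)
    fix x y assume eq: "g x = g y"
    have T: "x \<in> T \<longleftrightarrow> y \<in> T" using eq gT gnT by metis
    show "x = y"
    proof (cases "x \<in> T")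
      case True then show ?thesis using eq T gT by simp
    next
      case False
      have U: "x \<in> U \<longleftrightarrow> y \<in> U" using eq gUf[of x y] gUf[of y x] False T by auto
      show ?thesis
      proof (cases "x \<in> U")
        case True
        then show ?thesis using eq U gU funpow_inj[OF bij, of m x y] by simp
      next
        case c: False
        then show ?thesis using eq U False T gf bij by (metis bij_is_inj injD)
      qed
    qed
  qed
  moreover have "surj g"
    unfolding surj_def
  proof
    fix y
    show "\<exists>x. y = g x"
    proof (cases "y \<in> T")
      case True then show ?thesis using gT by metis
    next
      case False
      obtain x where x: "y = f x" using bij by (metis bij_pointE)
      show ?thesis
      proof (cases "x \<in> U \<union> T")
        case True
        then show ?thesis using fstep[OF True] x False gU by metis
      next
        case c: False
        then show ?thesis using gf[of x] x by (intro exI[of _ x]) auto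
      qed
    qed
  qed
  ultimately have bg: "bij g" by (simp add: bij_def)
  \<comment> \<open>Membership in \<open>T\<close> is tested by pulling back to \<open>U\<close>, so
    the Lipschitz constant of the inverse enters, with \<open>m * B\<close> for fewer than m
    backward steps.\<close>
  obtain B where B: "lip B (inv f)" using G_lip[OF G_inv[OF f]] by blast
  let ?e = "d + m * B"
  have near: "x \<in> T \<longleftrightarrow> y \<in> T" "x \<in> U \<longleftrightarrow> y \<in> U" if "agree ?e x y" for x y
  proof -
    have inv_iff: "x \<in> T \<longleftrightarrow> (\<exists>j. 0 < j \<and> j < m \<and> (inv f ^^ j) x \<in> U)" for x
    proof
      assume "x \<in> T"
      then obtain j y where jy: "0 < j" "j < m" "y \<in> U" "x = (f ^^ j) y" unfolding T_def by blast
      have "(inv f ^^ j) x \<in> U" unfolding jy(4) inv_funpow_cancel(2)[OF bij] by (rule jy(3))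
      then show "\<exists>j. 0 < j \<and> j < m \<and> (inv f ^^ j) x \<in> U" using jy(1,2) by blast
    next
      assume "\<exists>j. 0 < j \<and> j < m \<and> (inv f ^^ j) x \<in> U"
      then obtain j where "0 < j" "j < m" "(inv f ^^ j) x \<in> U" by blast
      then show "x \<in> T" unfolding T_def mem_Collect_eq
        by (intro exI[of _ j] exI[of _ "(inv f ^^ j) x"] conjI) (simp_all add: inv_funpow_cancel(1)[OF bij])
    qed
    have j: "(inv f ^^ j) x \<in> U \<longleftrightarrow> (inv f ^^ j) y \<in> U" if "j < m" for j
    proof -
      have "j * B \<le> m * B" using that by simp
      then have "d + j * B \<le> ?e" by linarith
      then have "agree (d + j * B) x y" using \<open>agree ?e x y\<close> agree_mono by blast
      then have "agree d ((inv f ^^ j) x) ((inv f ^^ j) y)" by (rule lipD[OF lip_funpow[OF B]])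
      then show ?thesis by (rule clopen)
    qed
    show "x \<in> U \<longleftrightarrow> y \<in> U" using j[of 0] m by simp
    show "x \<in> T \<longleftrightarrow> y \<in> T" unfolding inv_iff using j by metis
  qed
  have local: "\<exists>j e. 0 < j \<and> j \<le> m \<and> (\<forall>y. agree e x y \<longrightarrow> g y = (f ^^ j) y)" if "x \<notin> T" for x
  proof (cases "x \<in> U")
    case True
    have "g y = (f ^^ m) y" if "agree ?e x y" for y
      using gU near(2)[OF that] True by blast
    then show ?thesis using m by blast
  next
    case False
    have "g y = (f ^^ 1) y" if "agree ?e x y" for y
      using gf near[OF that] False \<open>x \<notin> T\<close> by simp
    moreover have "0 < (1::nat)" "1 \<le> m" using m by simp_all
    ultimately show ?thesis by blast
  qed
  have reg: "regular g x" for x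
  proof -
    consider "x \<in> U" | "x \<in> T" | "x \<notin> U" "x \<notin> T" by blast
    then show ?thesis
    proof cases
      case 1
      then show ?thesis using near(2) gU by (intro regular_cong[OF regU[OF 1], of ?e]) metis
    next
      case 2
      then show ?thesis using near(1) gT by (intro id_near_regular[of ?e]) metis
    next
      case 3
      have "regular f x"
      proof (rule ccontr)
        assume "\<not> ?thesis"
        then obtain j y where "j < m" "y \<in> U" "x = (f ^^ j) y" using cover by blast
        then show False using 3 unfolding T_def by (cases "j = 0") auto
      qed
      then show ?thesis using 3 near gf by (elim regular_cong[of f x ?e]) metis
    qed
  qed
  have T1: "\<exists>j y. y \<notin> T \<and> x = (f ^^ j) y" if "x \<in> T" for x
    using that UT unfolding T_def by blast
  have T2: "\<exists>e. \<forall>y. agree e x y \<longrightarrow> y \<in> T" if "x \<in> T" for x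
    using near(1) that by blast
  show ?thesis
    by (rule that[of g T, OF bg reg gT conjI[OF gnT local] T1 T2])
qed

lemma funpow_funpow_commute:
  fixes f :: "'a \<Rightarrow> 'a"
  shows "(f ^^ m) ((f ^^ n) x) = (f ^^ n) ((f ^^ m) x)"
  by (metis add.commute comp_apply funpow_add)

text \<open>Outside \<open>T\<close> a power of g is locally a power of f. Finite order of g would
  bound all periods of f and make f of finite order; so some power of g has a nontrivial fixed
  point, and there a power of f has one.\<close>

lemma lin_if_induced_map:
  assumes S: "finite S" "S \<subseteq> G" and f: "f \<in> G" and inf: "\<And>n. n > 0 \<Longrightarrow> f ^^ n \<noteq> id"
    and g: "bij g" "\<And>x. regular g x" "\<And>x. x \<in> T \<Longrightarrow> g x = x"
    and gT: "\<And>x. x \<notin> T \<Longrightarrow> g x \<notin> T \<and> (\<exists>j e. 0 < j \<and> j \<le> m \<and> (\<forall>y. agree e x y \<longrightarrow> g y = (f ^^ j) y))"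
    and T: "\<And>x. x \<in> T \<Longrightarrow> \<exists>j y. y \<notin> T \<and> x = (f ^^ j) y"
    "\<And>x. x \<in> T \<Longrightarrow> \<exists>e. \<forall>y. agree e x y \<longrightarrow> y \<in> T"
  shows "lin S f"
proof -
  have bij: "bij f" using f by (rule G_bij)
  \<comment> \<open>The lower bound n keeps the exponent N positive; the upper bound makes the
    periods found below uniformly bounded.\<close>
  have it: "(g ^^ n) x \<notin> T \<and> (\<exists>N e. n \<le> N \<and> N \<le> n * m \<and> (\<forall>y. agree e x y \<longrightarrow> (g ^^ n) y = (f ^^ N) y))"
    if x: "x \<notin> T" for n x
  proof (induction n)
    case 0 then show ?case using x by auto
  next
    case (Suc n)
    then obtain N e where N: "n \<le> N" "N \<le> n * m" "\<And>y. agree e x y \<Longrightarrow> (g ^^ n) y = (f ^^ N) y"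
      by blast
    have nT: "(g ^^ n) x \<notin> T" using Suc by blast
    then obtain j e' where j: "0 < j" "j \<le> m" "\<And>y. agree e' ((g ^^ n) x) y \<Longrightarrow> g y = (f ^^ j) y"
      using gT by blast
    obtain B where B: "lip B (f ^^ N)" using G_lip[OF G_funpow[OF f]] by blast
    have "(g ^^ Suc n) y = (f ^^ (j + N)) y" if ag: "agree (e + (e' + B)) x y" for y
    proof -
      have e: "agree e x y" using ag by (rule agree_mono) simp
      have "agree (e' + B) x y" using ag by (rule agree_mono) simp
      then have "agree e' ((f ^^ N) x) ((f ^^ N) y)" by (rule lipD[OF B])
      then have "g ((g ^^ n) y) = (f ^^ j) ((g ^^ n) y)"
        by (intro j(3)) (simp only: N(3)[OF agree_refl] N(3)[OF e])
      then show ?thesis using N(3)[OF e] by (simp add: funpow_add)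
    qed
    moreover have "Suc n \<le> j + N" "j + N \<le> Suc n * m" using j N by simp_all
    ultimately show ?case using gT[OF nT] by (intro conjI) (simp, blast)
  qed
  show ?thesis
  proof (rule regular_dichotomy[OF g(1,2)])
    fix n assume n: "n > 0" "g ^^ n = id"
    have per: "\<exists>N. 0 < N \<and> N \<le> n * m \<and> (f ^^ N) x = x" if "x \<notin> T" for x
    proof -
      obtain N e where N: "n \<le> N" "N \<le> n * m" "\<And>y. agree e x y \<Longrightarrow> (g ^^ n) y = (f ^^ N) y"
        using it[OF \<open>x \<notin> T\<close>, of n] by blast
      have "(f ^^ N) x = x" using N(3)[of x] n(2) by simp
      then show ?thesis using N n(1) by (metis less_le_trans)
    qed
    have "\<exists>N. 0 < N \<and> N \<le> n * m \<and> (f ^^ N) x = x" for x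
    proof (cases "x \<in> T")
      case True
      then obtain j y where y: "y \<notin> T" "x = (f ^^ j) y" using T(1) by blast
      then obtain N where N: "0 < N" "N \<le> n * m" "(f ^^ N) y = y" using per by blast
      have "(f ^^ N) ((f ^^ j) y) = (f ^^ j) ((f ^^ N) y)"
        by (rule funpow_funpow_commute)
      then show ?thesis using N y by auto
    qed (use per in blast)
    \<comment> \<open>The factorial is a common multiple of all the periods, which are at most n
      m.\<close>
    then have "(f ^^ fact (n * m)) x = x" for x
    proof -
      obtain N where N: "0 < N" "N \<le> n * m" "(f ^^ N) x = x"
        using \<open>\<And>x. \<exists>N. 0 < N \<and> N \<le> n * m \<and> (f ^^ N) x = x\<close> by blast
      then have "N dvd fact (n * m)" by (intro dvd_fact) auto
      then obtain q where q: "fact (n * m) = N * q" by blast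
      have "((f ^^ N) ^^ q) x = x" by (induction q) (use N in auto)
      then show ?thesis unfolding q by (simp add: funpow_mult)
    qed
    then have "f ^^ fact (n * m) = id" by auto
    then show ?thesis using inf[of "fact (n * m)"] by simp
  next
    fix n z assume z: "(g ^^ n) z = z" "\<And>k. \<exists>y. agree k z y \<and> (g ^^ n) y \<noteq> y"
    \<comment> \<open>On the open set \<open>T\<close> the map g is the identity, so no nontrivial
      fixed point lies there.\<close>
    have "z \<notin> T"
    proof
      assume "z \<in> T"
      then obtain e where e: "\<And>y. agree e z y \<Longrightarrow> y \<in> T" using T(2) by blast
      have "(g ^^ n) y = y" if "agree e z y" for y
        by (induction n) (use g(3)[OF e[OF that]] in auto)
      then show False using z(2) by blast
    qed
    then obtain N e where N: "\<And>y. agree e z y \<Longrightarrow> (g ^^ n) y = (f ^^ N) y" "n \<le> N"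
      using it by blast
    have "n \<noteq> 0" using z(2)[of 0] by auto
    have fz: "(f ^^ N) z = z" using N(1)[of z] z(1) by simp
    from fixpoint_trivial_or_lin[OF S G_funpow[OF f] fz]
    show ?thesis
    proof
      assume "\<exists>k. \<forall>y. agree k z y \<longrightarrow> (f ^^ N) y = y"
      then obtain k where k: "\<And>y. agree k z y \<Longrightarrow> (f ^^ N) y = y" by blast
      obtain y where y: "agree (max k e) z y" "(g ^^ n) y \<noteq> y" using z(2) by blast
      have "agree k z y" "agree e z y" using y(1) by (auto elim: agree_mono)
      then show ?thesis using k N(1) y(2) by simp
    next
      assume "lin S (f ^^ N)"
      then show ?thesis by (rule lin_pow[rotated]) (use \<open>n \<noteq> 0\<close> N(2) in simp)
    qed
  qed
qed

lemma lin_if_aperiodic_sing: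
  assumes S: "finite S" "S \<subseteq> G" and f: "f \<in> G" and inf: "\<And>n. n > 0 \<Longrightarrow> f ^^ n \<noteq> id"
    and aper: "\<And>p n. p \<in> sing f \<Longrightarrow> n > 0 \<Longrightarrow> (f ^^ n) p \<noteq> p"
  shows "lin S f"
proof -
  have bij: "bij f" using f by (rule G_bij)
  have fin: "finite (sing f)" using G_finite_sing f by blast
  \<comment> \<open>The first singular point of each singular orbit; that every singular point is
    reached from one of these is \<open>from_R\<close>, by going back as far as possible.\<close>
  define R where "R = {r \<in> sing f. \<forall>q\<in>sing f. \<forall>j>0. (f ^^ j) q \<noteq> r}"
  have R: "finite R" "R \<subseteq> sing f" using fin by (auto simp: R_def)
  have from_R: "\<exists>r\<in>R. \<exists>j. p = (f ^^ j) r" if "p \<in> sing f" for p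
  proof -
    let ?J = "{j. \<exists>q\<in>sing f. (f ^^ j) q = p}"
    have J: "finite ?J" using finite_hitting_times(2)[OF bij fin aper] .
    have "\<exists>q\<in>sing f. (f ^^ 0) q = p" using that by simp
    then have "0 \<in> ?J" by blast
    then have "Max ?J \<in> ?J" by (intro Max_in[OF J]) blast
    then obtain q where q: "q \<in> sing f" "(f ^^ Max ?J) q = p" by blast
    have "(f ^^ i) q' \<noteq> q" if "q' \<in> sing f" "i > 0" for q' i
    proof
      assume "(f ^^ i) q' = q"
      then have "(f ^^ (Max ?J + i)) q' = p" using q(2) by (simp add: funpow_add)
      then have "Max ?J + i \<le> Max ?J" using that(1) by (intro Max_ge J) blast
      then show False using that(2) by simp
    qed
    then have "q \<in> R" using q(1) unfolding R_def by blast
    then show ?thesis using q(2)[symmetric] by (intro bexI[of _ q] exI[of _ "Max ?J"])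
  qed
  have "finite (\<Union>r\<in>R. {j. (f ^^ j) r \<in> sing f})"
    by (intro finite_UN_I R(1) finite_hitting_times(1)[OF bij fin aper])
  then obtain m0 where m0: "\<And>j. j \<in> (\<Union>r\<in>R. {j. (f ^^ j) r \<in> sing f}) \<Longrightarrow> j \<le> m0"
    unfolding finite_nat_set_iff_bounded_le by blast
  define m where "m = Suc m0"
  have m: "j < m" if "r \<in> R" "(f ^^ j) r \<in> sing f" for r j
  proof -
    have "j \<in> (\<Union>r\<in>R. {j. (f ^^ j) r \<in> sing f})" using that by blast
    then show ?thesis using m0[of j] unfolding m_def by simp
  qed
  show ?thesis
  proof (cases "\<exists>r\<in>R. \<not> regular (f ^^ m) r")
    case True
    then obtain r where r: "r \<in> R" "\<not> regular (f ^^ m) r" by blast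
    show ?thesis
    proof (rule lin_if_total_germ_singular[OF S f _ _ _ r(2)])
      fix i :: nat assume "i > 0"
      show "(f ^^ i) r \<noteq> r" by (rule aper) (use r(1) R(2) \<open>i > 0\<close> in auto)
      have "(f ^^ i) ((inv f ^^ i) r) = r" by (rule inv_funpow_cancel(1)[OF bij])
      then have "(inv f ^^ i) r \<notin> sing f" using r(1) \<open>i > 0\<close> unfolding R_def by blast
      then show "regular f ((inv f ^^ i) r)" by (simp add: sing_def)
    next
      fix i assume "i \<ge> m"
      then show "regular f ((f ^^ i) r)" using m[OF r(1), of i] by (auto simp: sing_def)
    qed
  next
    case False
    have distinct: "(f ^^ i) r \<noteq> (f ^^ j) r'" if "r \<in> R" "r' \<in> R" "i < j" for r r' i j
    proof
      assume "(f ^^ i) r = (f ^^ j) r'"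
      then have "(f ^^ i) ((f ^^ (j - i)) r') = (f ^^ i) r"
        using that(3) funpow_add[of i "j - i" f] by simp
      then have "(f ^^ (j - i)) r' = r" by (rule funpow_inj[OF bij])
      moreover have "r' \<in> sing f" "0 < j - i" using that R(2) by auto
      ultimately show False using that(1) unfolding R_def by blast
    qed
    have reg: "regular (f ^^ m) r" if "r \<in> R" for r using False that by blast
    obtain d where d:
      "\<And>r r' i j x y. r \<in> R \<Longrightarrow> r' \<in> R \<Longrightarrow> agree d r x \<Longrightarrow> agree d r' y \<Longrightarrow> i < j \<Longrightarrow> j < m \<Longrightarrow> (f ^^ i) x \<noteq> (f ^^ j) y"
      "\<And>r x. r \<in> R \<Longrightarrow> agree d r x \<Longrightarrow> regular (f ^^ m) x"
      by (rule disjoint_neighbourhoods[OF f R(1), of m])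
        ((rule distinct; assumption), (rule reg; assumption), (rule that; blast))
    define U where "U = {x. \<exists>r\<in>R. agree d r x}"
    have U1: "(f ^^ i) x \<noteq> (f ^^ j) y" if "x \<in> U" "y \<in> U" "i < j" "j < m" for i j x y
      using that d(1) unfolding U_def by blast
    have U2: "x \<in> U \<longleftrightarrow> y \<in> U" if "agree d x y" for x y
      using agree_trans[OF _ that] agree_trans[OF _ agree_sym[OF that]] unfolding U_def by blast
    have U3: "regular (f ^^ m) x" if "x \<in> U" for x using that d(2) unfolding U_def by blast
    have U4: "\<exists>j<m. \<exists>y\<in>U. x = (f ^^ j) y" if "\<not> regular f x" for x
    proof -
      have "x \<in> sing f" using that by (simp add: sing_def)
      from from_R[OF this] obtain r j where rj: "r \<in> R" "x = (f ^^ j) r" by (elim bexE exE)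
      have "r \<in> U" using rj(1) agree_refl unfolding U_def by blast
      moreover have "j < m" using \<open>x \<in> sing f\<close> unfolding rj(2) by (rule m[OF rj(1)])
      ultimately show ?thesis using rj(2) by (intro exI[of _ j] conjI bexI[of _ r])
    qed
    have "m > 0" by (simp add: m_def)
    show ?thesis
    proof (rule induced_map[OF f \<open>m > 0\<close>, of U d])
      fix g T
      assume g: "bij g" "\<And>x. regular g x" "\<And>x. x \<in> T \<Longrightarrow> g x = x"
        "\<And>x. x \<notin> T \<Longrightarrow> g x \<notin> T \<and> (\<exists>j e. 0 < j \<and> j \<le> m \<and> (\<forall>y. agree e x y \<longrightarrow> g y = (f ^^ j) y))"
        "\<And>x. x \<in> T \<Longrightarrow> \<exists>j y. y \<notin> T \<and> x = (f ^^ j) y"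
        "\<And>x. x \<in> T \<Longrightarrow> \<exists>e. \<forall>y. agree e x y \<longrightarrow> y \<in> T"
      show ?thesis by (rule lin_if_induced_map[OF S f]) (fact inf g)+
    qed (fact U1 U2 U3 U4)+
  qed
qed

lemma lin_if_infinite_order:
  assumes S: "finite S" "S \<subseteq> G" and f: "f \<in> G" and inf: "\<And>n. n > 0 \<Longrightarrow> f ^^ n \<noteq> id"
  shows "lin S f"
proof (rule ccontr)
  assume nlin: "\<not> lin S f"
  have bij: "bij f" using f by (rule G_bij)
  define P where "P = {p \<in> sing f. \<exists>n>0. (f ^^ n) p = p}"
  have "finite P" using G_finite_sing[OF f] by (simp add: P_def)
  define \<pi> where "\<pi> p = (SOME n. n > 0 \<and> (f ^^ n) p = p)" for p
  have \<pi>: "\<pi> p > 0 \<and> (f ^^ \<pi> p) p = p" if "p \<in> P" for p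
    unfolding \<pi>_def by (rule someI_ex) (use that in \<open>auto simp: P_def\<close>)
  \<comment> \<open>A common multiple of the periods of the periodic singular points. If f is not
    linear, f^n is trivial near each of them.\<close>
  define n where "n = prod \<pi> P"
  have "n > 0" using \<pi> unfolding n_def by (intro prod_pos) simp
  have near_P: "\<exists>k. \<forall>y. agree k p y \<longrightarrow> (f ^^ n) y = y" if p: "p \<in> P" for p
  proof -
    have "\<not> lin S (f ^^ \<pi> p)" using nlin lin_pow \<pi>[OF p] by blast
    then obtain k where k: "\<And>y. agree k p y \<Longrightarrow> (f ^^ \<pi> p) y = y"
      using fixpoint_trivial_or_lin[OF S G_funpow[OF f]] \<pi>[OF p] by blast
    have "\<pi> p dvd n" unfolding n_def using \<open>finite P\<close> p by (rule dvd_prodI)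
    then obtain q where q: "n = \<pi> p * q" by blast
    have "((f ^^ \<pi> p) ^^ q) y = y" if "agree k p y" for y
      by (induction q) (use k[OF that] in auto)
    then show ?thesis unfolding q by (auto simp: funpow_mult)
  qed
  have "lin S (f ^^ n)"
  proof (rule lin_if_aperiodic_sing[OF S G_funpow[OF f]])
    fix k :: nat assume "k > 0"
    then show "(f ^^ n) ^^ k \<noteq> id" using inf[of "n * k"] \<open>n > 0\<close> by (simp add: funpow_mult mult.commute)
  next
    fix x and k :: nat assume x: "x \<in> sing (f ^^ n)" and "k > 0"
    show "((f ^^ n) ^^ k) x \<noteq> x"
    proof
      assume "((f ^^ n) ^^ k) x = x"
      then have per: "(f ^^ (n * k)) x = x" by (simp add: funpow_mult mult.commute)
      \<comment> \<open>A singularity of f^n needs a singularity of f somewhere on the orbit of x.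
        If x is periodic, that point lies in \<open>P\<close>, so f^n is trivial near it; commuting
        with f^i transports triviality back to x.\<close>
      obtain i where i: "\<not> regular f ((f ^^ i) x)"
        using x regular_funpow[of n f x] by (auto simp: sing_def)
      have "(f ^^ (n * k)) ((f ^^ i) x) = (f ^^ i) ((f ^^ (n * k)) x)"
        by (rule funpow_funpow_commute)
      then have "(f ^^ i) x \<in> P" using i per \<open>n > 0\<close> \<open>k > 0\<close> unfolding P_def sing_def
        by (auto intro!: exI[of _ "n * k"])
      then obtain e where e: "\<And>y. agree e ((f ^^ i) x) y \<Longrightarrow> (f ^^ n) y = y" using near_P by blast
      obtain B where B: "lip B (f ^^ i)" using G_lip[OF G_funpow[OF f]] by blast
      have "(f ^^ n) y = y" if "agree (e + B) x y" for y
      proof -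
        have "(f ^^ n) ((f ^^ i) y) = (f ^^ i) y" using e lipD[OF B that] by blast
        then have "(f ^^ i) ((f ^^ n) y) = (f ^^ i) y"
          by (simp only: funpow_funpow_commute[of i f n])
        then show ?thesis by (rule funpow_inj[OF bij])
      qed
      then have "regular (f ^^ n) x" by (rule id_near_regular)
      then show False using x by (simp add: sing_def)
    qed
  qed
  then show False using nlin lin_pow \<open>n > 0\<close> by blast
qed

section \<open>Thompson's group\<close>

lemma thompsonV_G:
  assumes "thompsonV f" shows "f \<in> G"
proof -
  obtain ps where *: "(\<forall>x. \<exists>!i. i < length ps \<and> is_prefix (fst (ps ! i)) x) \<and>
      (\<forall>y. \<exists>!i. i < length ps \<and> is_prefix (snd (ps ! i)) y) \<and>
      (\<forall>i<length ps. \<forall>w. f (cat (fst (ps ! i)) w) = cat (snd (ps ! i)) w)"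
    using assms unfolding thompsonV_def by (elim exE)
  have ps: "\<exists>!i. i < length ps \<and> is_prefix (fst (ps ! i)) x"
    "\<exists>!i. i < length ps \<and> is_prefix (snd (ps ! i)) y"
    "i < length ps \<Longrightarrow> f (cat (fst (ps ! i)) w) = cat (snd (ps ! i)) w" for x y i w
    using * by simp_all
  have x: "\<exists>i w. i < length ps \<and> x = cat (fst (ps ! i)) w" for x
    using ps(1)[of x] unfolding is_prefix_iff by blast
  have "inj f"
  proof (rule injI)
    fix x y assume eq: "f x = f y"
    obtain i w where i: "i < length ps" "x = cat (fst (ps ! i)) w" using x by blast
    obtain j w' where j: "j < length ps" "y = cat (fst (ps ! j)) w'" using x by blast
    have fx: "f x = cat (snd (ps ! i)) w" "f x = cat (snd (ps ! j)) w'"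
      using i j eq ps(3) by simp_all
    then have "is_prefix (snd (ps ! i)) (f x)" "is_prefix (snd (ps ! j)) (f x)"
      unfolding is_prefix_iff by blast+
    then have "i = j" using ps(2)[of "f x"] i(1) j(1) by blast
    then show "x = y" using fx i j by simp
  qed
  moreover have "surj f"
    unfolding surj_def
  proof
    fix y
    obtain i w where "i < length ps" "y = cat (snd (ps ! i)) w"
      using ps(2)[of y] unfolding is_prefix_iff by blast
    then show "\<exists>x. y = f x" using ps(3) by metis
  qed
  moreover have "regular f x" for x
    using x[of x] regularI ps(3) by metis
  ultimately show ?thesis by (simp add: G_def bij_def)
qed

section \<open>Binary expansions\<close>

lemma summable_binary: "summable (\<lambda>i. (if x i then 1 else 0 :: real) / 2 ^ Suc i)"
proof (rule summable_comparison_test')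
  show "summable (\<lambda>i. (1 / 2 :: real) ^ i)" by (rule summable_geometric) simp
  show "norm ((if x n then 1 else 0 :: real) / 2 ^ Suc n) \<le> (1 / 2) ^ n" for n
    by (auto simp: power_one_over field_simps)
qed

lemma phi_cat_singleton: "phi (cat [c] w) = ((if c then 1 else 0) + phi w) / 2"
proof -
  have "phi (cat [c] w) = (\<Sum>i. (if cat [c] w (Suc i) then 1 else 0) / 2 ^ Suc (Suc i)) + (if cat [c] w 0 then 1 else 0) / 2 ^ Suc 0"
    using suminf_split_head[OF summable_binary[of "cat [c] w"]] unfolding phi_def by linarith
  also have "(\<Sum>i. (if cat [c] w (Suc i) then 1 else 0 :: real) / 2 ^ Suc (Suc i)) = (\<Sum>i. ((if w i then 1 else 0) / 2 ^ Suc i) / 2)"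
    by (rule suminf_cong) (simp add: cat_singleton)
  also have "\<dots> = phi w / 2"
    unfolding phi_def by (rule suminf_divide[OF summable_binary])
  finally show ?thesis by (simp add: cat_singleton)
qed

lemma phi_bounds: "0 \<le> phi x" "phi x \<le> 1"
proof -
  show "0 \<le> phi x" unfolding phi_def by (rule suminf_nonneg[OF summable_binary]) simp
  have "phi x \<le> (\<Sum>i. (1 / 2 :: real) ^ Suc i)"
    unfolding phi_def
  proof (rule suminf_le[OF _ summable_binary])
    show "summable (\<lambda>i. (1 / 2 :: real) ^ Suc i)" by (rule sums_summable[OF power_half_series])
    show "(if x n then 1 else 0) / 2 ^ Suc n \<le> (1 / 2 :: real) ^ Suc n" for n by (auto simp: power_one_over)
  qed
  also have "\<dots> = 1" by (rule sums_unique[OF power_half_series, symmetric])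
  finally show "phi x \<le> 1" .
qed

lemma phi_cst [simp]: "phi (cst False) = 0" "phi (cst True) = 1"
  using phi_cat_singleton[of False "cst False"] phi_cat_singleton[of True "cst True"] by simp_all

text \<open>The left end of the dyadic interval labelled by \<open>u\<close>, whose length is 2 to
  the power of minus the length of \<open>u\<close>.\<close>

definition val :: "bool list \<Rightarrow> real" where
  "val u = phi (cat u (cst False))"

lemma phi_cat: "phi (cat u w) = val u + phi w / 2 ^ length u"
proof (induction u)
  case Nil then show ?case by (simp add: val_def)
next
  case (Cons c u)
  have val: "val (c # u) = ((if c then 1 else 0) + val u) / 2"
    unfolding val_def cat_Cons[of c u] phi_cat_singleton ..
  show ?case
    unfolding cat_Cons[of c u] phi_cat_singleton Cons val by (simp add: field_simps)
qed

lemma val_nat: "\<exists>a. val u = real a / 2 ^ length u"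
proof (induction u)
  case Nil then show ?case by (auto simp: val_def intro: exI[of _ 0])
next
  case (Cons c u)
  then obtain a where a: "val u = real a / 2 ^ length u" by blast
  have "val (c # u) = ((if c then 1 else 0) + val u) / 2"
    unfolding val_def cat_Cons[of c u] phi_cat_singleton ..
  also have "\<dots> = real ((if c then 2 ^ length u else 0) + a) / 2 ^ length (c # u)"
    unfolding a by (simp add: field_simps)
  finally show ?case by blast
qed

lemma val_surj: "a < 2 ^ n \<Longrightarrow> \<exists>u. length u = n \<and> val u = real a / 2 ^ n"
proof (induction n arbitrary: a)
  case 0 then show ?case by (auto simp: val_def)
next
  case (Suc n)
  have val: "val (c # u) = ((if c then 1 else 0) + val u) / 2" for c u
    unfolding val_def cat_Cons[of c u] phi_cat_singleton ..
  show ?case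
  proof (cases "a < 2 ^ n")
    case True
    then obtain u where "length u = n" "val u = real a / 2 ^ n" using Suc by blast
    then have "length (False # u) = Suc n \<and> val (False # u) = real a / 2 ^ Suc n" by (simp add: val)
    then show ?thesis by blast
  next
    case False
    then have "a - 2 ^ n < 2 ^ n" using Suc.prems by simp
    then obtain u where "length u = n" "val u = real (a - 2 ^ n) / 2 ^ n" using Suc by blast
    then have "length (True # u) = Suc n \<and> val (True # u) = real a / 2 ^ Suc n"
      using False by (simp add: val of_nat_diff field_simps)
    then show ?thesis by blast
  qed
qed

lemma phi_replicate: "phi (cat (replicate i False) w) = phi w / 2 ^ i"
  "phi (cat (replicate i True) w) = 1 - (1 - phi w) / 2 ^ i"
proof -
  have "val (replicate i False) = 0" by (simp add: val_def)
  then show "phi (cat (replicate i False) w) = phi w / 2 ^ i" by (simp add: phi_cat)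
  have "1 = val (replicate i True) + 1 / 2 ^ i"
    using phi_cat[of "replicate i True" "cst True"] by simp
  then show "phi (cat (replicate i True) w) = 1 - (1 - phi w) / 2 ^ i"
    by (simp add: phi_cat diff_divide_distrib)
qed

lemma phi_eq_0: assumes "phi y = 0" shows "y = cst False"
proof (rule ccontr)
  assume "\<not> ?thesis"
  then obtain i t where y: "y = cat (replicate i False) (cat [\<not> False] t)" by (rule not_cst_split)
  have "phi y = (1 + phi t) / 2 / 2 ^ i" unfolding y phi_replicate phi_cat_singleton by simp
  then show False using assms phi_bounds(1)[of t] by simp
qed

lemma phi_eq_1: assumes "phi y = 1" shows "y = cst True"
proof (rule ccontr)
  assume "\<not> ?thesis"
  then obtain i t where y: "y = cat (replicate i True) (cat [\<not> True] t)" by (rule not_cst_split)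
  have "phi y = 1 - (1 - phi t / 2) / 2 ^ i" unfolding y phi_replicate phi_cat_singleton by simp
  then show False using assms phi_bounds(2)[of t] by simp
qed

lemma ev0_cat [simp]: "ev0 (cat u w) \<longleftrightarrow> ev0 w"
proof
  assume "ev0 (cat u w)"
  then obtain N where "\<forall>i\<ge>N. \<not> cat u w i" unfolding ev0_def by blast
  then have "\<not> w i" if "i \<ge> N" for i using that by (auto simp: cat_def dest: spec[of _ "length u + i"])
  then show "ev0 w" unfolding ev0_def by blast
next
  assume "ev0 w"
  then obtain N where "\<forall>i\<ge>N. \<not> w i" unfolding ev0_def by blast
  then have "\<forall>i\<ge>N + length u. \<not> cat u w i" by (auto simp: cat_def)
  then show "ev0 (cat u w)" unfolding ev0_def by blast
qed

lemma ev0_cst [simp]: "ev0 (cst c) \<longleftrightarrow> \<not> c"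
  by (auto simp: ev0_def)

lemma ev0E:
  assumes "ev0 x" obtains N where "\<And>n. n \<ge> N \<Longrightarrow> sdrop n x = cst False"
proof -
  obtain N where "\<forall>i\<ge>N. \<not> x i" using assms unfolding ev0_def by blast
  then have "sdrop n x = cst False" if "n \<ge> N" for n using that by (auto simp: sdrop_def)
  then show ?thesis by (rule that)
qed

text \<open>At the first difference the digits are 0 and 1, so x lies in the left half and y in the
  right half of a dyadic interval. Equal labels force their common midpoint, with x = p^- and y =
  p^+.\<close>

lemma lt_phi:
  assumes "lt False x y"
  shows "phi x < phi y \<or> phi x = phi y \<and> (\<exists>a. x = cat a (cst True)) \<and> ev0 y \<and> \<not> ev0 x"
proof -
  obtain i where i: "\<forall>j<i. x j = y j" "\<not> x i" "y i" using assms unfolding lt_def by blast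
  let ?a = "pre i x"
  have pre: "pre i y = ?a" using i(1) by (simp add: pre_def)
  obtain c x' where x': "sdrop i x = cat [c] x'" using cantor_cases by blast
  obtain d y' where y': "sdrop i y = cat [d] y'" using cantor_cases by blast
  have "sdrop i x 0 = c" "sdrop i y 0 = d" unfolding x' y' by (simp_all add: cat_singleton)
  then have cd: "\<not> c" "d" using i by (simp_all add: sdrop_def)
  have x: "x = cat ?a (cat [False] x')" and y: "y = cat ?a (cat [True] y')"
    using cat_pre_sdrop[of i x] cat_pre_sdrop[of i y] x' y' cd pre by simp_all
  have "phi (cat ?a (cat [False] x')) = val ?a + phi x' / 2 / 2 ^ i"
    unfolding phi_cat[of ?a] phi_cat_singleton by simp
  then have "phi x = val ?a + phi x' / 2 / 2 ^ i" unfolding x[symmetric] .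
  moreover have "phi (cat ?a (cat [True] y')) = val ?a + (1 + phi y') / 2 / 2 ^ i"
    unfolding phi_cat[of ?a] phi_cat_singleton by simp
  then have "phi y = val ?a + (1 + phi y') / 2 / 2 ^ i" unfolding y[symmetric] .
  ultimately have diff: "phi y - phi x = ((1 - phi x') + phi y') / 2 / 2 ^ i"
    by (simp add: field_simps)
  show ?thesis
  proof (cases "phi x' = 1 \<and> phi y' = 0")
    case True
    then have xy': "x' = cst True" "y' = cst False" using phi_eq_1 phi_eq_0 by blast+
    have "x = cat (?a @ [False]) (cst True)" "y = cat (?a @ [True]) (cst False)"
      using x y unfolding xy' cat_append by blast+
    moreover from this have "ev0 y" "\<not> ev0 x" by (metis ev0_cat ev0_cst)+
    moreover have "phi x = phi y" using diff True by simp
    ultimately show ?thesis by (intro disjI2 conjI exI[of _ "?a @ [False]"])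
  next
    case False
    then have "0 < (1 - phi x') + phi y'" using phi_bounds[of x'] phi_bounds[of y'] by linarith
    then have "0 < phi y - phi x" unfolding diff by simp
    then show ?thesis by simp
  qed
qed

lemma phi_inject:
  assumes "phi x = phi y" "ev0 x \<longleftrightarrow> ev0 y" shows "x = y"
  using lt_linear[of False x y] lt_phi[of x y] lt_phi[of y x] assms by auto

text \<open>Digits come from repeated doubling, with the tie at 1/2 resolved to the digit 0 so that
  the remainder stays in (0, 1]. If all digits were eventually 0, the positive remainder would
  double forever.\<close>

lemma exists_nonterminating_expansion:
  assumes "0 < r" "r \<le> 1"
  obtains y where "phi y = r" "\<not> ev0 y"
proof -
  define s where "s = rec_nat r (\<lambda>_ t. if t \<le> 1 / 2 then 2 * t else 2 * t - 1)"
  have s0: "s 0 = r" and sS: "s (Suc n) = (if s n \<le> 1 / 2 then 2 * s n else 2 * s n - 1)" for n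
    by (simp_all add: s_def)
  have s: "0 < s n \<and> s n \<le> 1" for n
    by (induction n) (use assms s0 sS in auto)
  define y where "y n \<longleftrightarrow> s n > 1 / 2" for n
  have partial: "(\<Sum>i<n. (if y i then 1 else 0) / 2 ^ Suc i) = r - s n / 2 ^ n" for n
    by (induction n) (auto simp: s0 sS y_def field_simps)
  have "(\<lambda>n. s n / 2 ^ n) \<longlonglongrightarrow> 0"
  proof (rule tendsto_sandwich[of "\<lambda>_. 0" _ _ "\<lambda>n. (1 / 2) ^ n"])
    show "(\<lambda>n. (1 / 2 :: real) ^ n) \<longlonglongrightarrow> 0" by (rule LIMSEQ_realpow_zero) auto
    show "\<forall>\<^sub>F n in sequentially. 0 \<le> s n / 2 ^ n" using s by (intro always_eventually) (simp add: less_imp_le)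
    show "\<forall>\<^sub>F n in sequentially. s n / 2 ^ n \<le> (1 / 2) ^ n"
      using s by (intro always_eventually) (simp add: power_one_over divide_right_mono)
  qed simp
  then have "(\<lambda>n. r - s n / 2 ^ n) \<longlonglongrightarrow> r - 0" by (intro tendsto_intros)
  then have "(\<lambda>i. (if y i then 1 else 0) / 2 ^ Suc i) sums r" unfolding sums_def partial by simp
  then have "phi y = r" unfolding phi_def by (rule sums_unique[symmetric])
  moreover have "\<not> ev0 y"
  proof
    assume "ev0 y"
    then obtain N where N: "\<And>i. i \<ge> N \<Longrightarrow> s i \<le> 1 / 2" unfolding ev0_def y_def by (meson not_less)
    have *: "s (N + k) = 2 ^ k * s N" for k
    proof (induction k)
      case (Suc k)
      then show ?case using sS[of "N + k"] N[of "N + k"] by simp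
    qed simp
    obtain k where "1 / s N < 2 ^ k" using real_arch_pow[of 2 "1 / s N"] by auto
    then have "1 < 2 ^ k * s N" using s[of N] by (simp add: field_simps)
    then show False using * s[of "N + k"] by simp
  qed
  ultimately show ?thesis by (rule that)
qed

section \<open>Dyadic numbers\<close>

lemma dyadic_common:
  assumes "dyadic r" obtains n where "\<And>N. N \<ge> n \<Longrightarrow> \<exists>b::int. r = of_int b / 2 ^ N"
proof -
  obtain a :: int and n where r: "r = of_int a / 2 ^ n" using assms unfolding dyadic_def by blast
  have "r = of_int (a * 2 ^ (N - n)) / 2 ^ N" if "N \<ge> n" for N
  proof -
    have "(2 :: real) ^ N = 2 ^ (N - n) * 2 ^ n" using that by (simp add: power_add[symmetric])
    then show ?thesis unfolding r by (simp add: field_simps)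
  qed
  then show ?thesis using that by blast
qed

lemma dyadicI: "dyadic (of_int b / 2 ^ n)"
  unfolding dyadic_def by blast

lemma dyadic_add: "dyadic a \<Longrightarrow> dyadic b \<Longrightarrow> dyadic (a + b)"
proof -
  assume "dyadic a" "dyadic b"
  then obtain n m where n: "\<And>N. N \<ge> n \<Longrightarrow> \<exists>c::int. a = of_int c / 2 ^ N"
    and m: "\<And>N. N \<ge> m \<Longrightarrow> \<exists>c::int. b = of_int c / 2 ^ N" using dyadic_common by metis
  obtain c d :: int where "a = of_int c / 2 ^ max n m" "b = of_int d / 2 ^ max n m"
    using n[of "max n m"] m[of "max n m"] by auto
  then have "a + b = of_int (c + d) / 2 ^ max n m" by (simp add: add_divide_distrib)
  then show ?thesis using dyadicI by metis
qed

lemma dyadic_powr_mult: "dyadic a \<Longrightarrow> dyadic (2 powr of_int m * a)"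
proof -
  assume "dyadic a"
  then obtain b :: int and n where a: "a = of_int b / 2 ^ n" unfolding dyadic_def by blast
  show ?thesis
  proof (cases "m \<ge> 0")
    case True
    then have "2 powr of_int m = (2 :: real) ^ nat m" by (simp add: powr_real_of_int)
    then have "2 powr of_int m * a = of_int (b * 2 ^ nat m) / 2 ^ n" unfolding a by simp
    then show ?thesis using dyadicI by metis
  next
    case False
    then have "2 powr of_int m = 1 / (2 :: real) ^ nat (- m)" by (simp add: powr_real_of_int divide_inverse)
    then have "2 powr of_int m * a = of_int b / 2 ^ (nat (- m) + n)" unfolding a by (simp add: power_add)
    then show ?thesis using dyadicI by metis
  qed
qed

lemma dyadic_uminus: "dyadic a \<Longrightarrow> dyadic (- a)"
  unfolding dyadic_def by (metis minus_divide_left of_int_minus)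

lemma dyadic_0: "dyadic 0" and dyadic_1: "dyadic 1"
  using dyadicI[of 0 0] dyadicI[of 1 0] by simp_all

lemma dyadic_affine: "dyadic b \<Longrightarrow> dyadic (2 powr of_int m * x + b) \<longleftrightarrow> dyadic x"
proof
  assume b: "dyadic b" and d: "dyadic (2 powr of_int m * x + b)"
  have "dyadic ((2 powr of_int m * x + b) + - b)" by (intro dyadic_add[OF d] dyadic_uminus[OF b])
  then have "dyadic (2 powr of_int m * x)" by simp
  then have "dyadic (2 powr of_int (- m) * (2 powr of_int m * x))" by (rule dyadic_powr_mult)
  then show "dyadic x" by (simp add: powr_minus field_simps)
qed (intro dyadic_add dyadic_powr_mult)

lemma ev0_phi:
  assumes "ev0 x" shows "dyadic (phi x)" "phi x < 1"
proof -
  obtain N where "sdrop N x = cst False" using ev0E[OF assms] by blast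
  then have "x = cat (pre N x) (cst False)" by (metis cat_pre_sdrop)
  then have "phi x = val (pre N x)" using phi_cat[of "pre N x" "cst False"] by simp
  moreover obtain a where "val (pre N x) = real a / 2 ^ N" using val_nat[of "pre N x"] by auto
  ultimately have "phi x = of_int (int a) / 2 ^ N" by simp
  then show "dyadic (phi x)" using dyadicI by metis
  have "phi x \<noteq> 1" using phi_eq_1[of x] assms by auto
  then show "phi x < 1" using phi_bounds[of x] by simp
qed

lemma not_ev0_phi: "\<not> ev0 x \<Longrightarrow> phi x > 0"
  using phi_eq_0[of x] phi_bounds[of x] by fastforce

lemma exists_terminating_expansion:
  assumes "dyadic r" "0 \<le> r" "r < 1"
  obtains y where "phi y = r" "ev0 y"
proof -
  obtain a :: int and n where r: "r = of_int a / 2 ^ n" using assms(1) unfolding dyadic_def by blast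
  have "real_of_int a = r * 2 ^ n" using r by simp
  then have "0 \<le> a" using assms(2) by (metis mult_nonneg_nonneg of_int_0_le_iff zero_le_numeral zero_le_power)
  moreover have "real_of_int a < 2 ^ n" using assms(3) unfolding r by simp
  then have "a < 2 ^ n" by (metis of_int_less_iff of_int_numeral of_int_power)
  ultimately have "nat a < 2 ^ n" by (simp add: nat_less_iff)
  then obtain u where "length u = n" "val u = real (nat a) / 2 ^ n" using val_surj by blast
  then have "phi (cat u (cst False)) = r" using \<open>0 \<le> a\<close> by (simp add: phi_cat r)
  then show ?thesis using that[of "cat u (cst False)"] by simp
qed

text \<open>The terminating expansion of the same label is a second preimage, and by
  \<open>lt_phi\<close> the smaller of two preimages ends in ones.\<close>

lemma dyadic_phi_cases:
  assumes "dyadic (phi x)" "\<not> ev0 x" "phi x < 1"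
  obtains a where "x = cat a (cst True)"
proof -
  obtain y where y: "phi y = phi x" "ev0 y"
    using exists_terminating_expansion assms phi_bounds(1) by metis
  have "\<not> lt False y x" using lt_phi[of y x] y by auto
  moreover have "x \<noteq> y" using assms(2) y(2) by blast
  ultimately have "lt False x y" using lt_linear[of False x y] by blast
  from lt_phi[OF this] have "\<exists>a. x = cat a (cst True)" using y(1) by simp
  then show ?thesis using that by (elim exE)
qed

section \<open>Brin's group\<close>

lemma brinA_cont_inj:
  assumes "brinA h"
  shows "continuous_on {0..1} h" "inj_on h {0..1}" "h ` {0..1} = {0..1}"
proof -
  obtain g where g: "homeomorphism {0..1} {0..1} h g" using assms unfolding brinA_def by blast
  then show "continuous_on {0..1} h" "h ` {0..1} = {0..1}" unfolding homeomorphism_def by blast+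
  show "inj_on h {0..1}" using g by (intro inj_on_inverseI[of _ g]) (auto simp: homeomorphism_def)
qed

text \<open>A continuous injection of an interval is monotone, and the values at 0 and 1 settle the
  direction.\<close>

lemma brinA_strict_mono:
  assumes "brinA h" "0 \<le> x" "x < y" "y \<le> 1"
  shows "h x < h y"
proof -
  have h01: "h 0 = 0" "h 1 = 1" using assms(1) by (auto simp: brinA_def)
  note cont = brinA_cont_inj(1)[OF assms(1)] and inj = brinA_cont_inj(2)[OF assms(1)]
  have range: "0 \<le> h z" "h z \<le> 1" if "0 \<le> z" "z \<le> 1" for z
    using brinA_cont_inj(3)[OF assms(1)] that by (metis atLeastAtMost_iff imageI)+
  have ne: "h a \<noteq> h b" if "0 \<le> a" "a < b" "b \<le> 1" for a b
    using inj_onD[OF inj, of a b] that by auto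
  consider "x = 0" | "0 < x" by (cases "x = 0") (use assms(2) in auto)
  then show ?thesis
  proof cases
    case 1
    then show ?thesis using range[of y] ne[of 0 y] h01 assms by auto
  next
    case 2
    have "continuous_on {0..y} h" by (rule continuous_on_subset[OF cont]) (use assms in auto)
    moreover have "inj_on h {0..y}" by (rule inj_on_subset[OF inj]) (use assms in auto)
    ultimately have "(h 0 < h x \<and> h x < h y) \<or> (h y < h x \<and> h x < h 0)"
      by (rule continuous_inj_imp_mono[OF 2 assms(3)])
    then show ?thesis using range[of x] 2 assms h01 by auto
  qed
qed

lemma brinA_local:
  assumes "brinA h" "0 < x" "x < 1"
  obtains \<epsilon> m n where "\<epsilon> > 0"
    "\<And>y. x \<le> y \<Longrightarrow> y \<le> x + \<epsilon> \<Longrightarrow> h y = h x + 2 powr (real_of_int m) * (y - x)"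
    "\<And>y. x - \<epsilon> \<le> y \<Longrightarrow> y \<le> x \<Longrightarrow> h y = h x + 2 powr (real_of_int n) * (y - x)"
    "m \<noteq> n \<Longrightarrow> dyadic x \<and> dyadic (h x)"
proof -
  have "\<forall>x\<in>{0<..<1}. \<exists>\<epsilon>>0. \<exists>m n :: int.
         (\<forall>y\<in>{x..x+\<epsilon>}. h y = h x + 2 powr (real_of_int m) * (y - x)) \<and>
         (\<forall>y\<in>{x-\<epsilon>..x}. h y = h x + 2 powr (real_of_int n) * (y - x)) \<and>
         (m \<noteq> n \<longrightarrow> dyadic x \<and> dyadic (h x))" using assms(1) unfolding brinA_def by (elim conjE)
  moreover have "x \<in> {0<..<1}" using assms(2,3) by simp
  ultimately have "\<exists>\<epsilon>>0. \<exists>m n :: int.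
         (\<forall>y\<in>{x..x+\<epsilon>}. h y = h x + 2 powr (real_of_int m) * (y - x)) \<and>
         (\<forall>y\<in>{x-\<epsilon>..x}. h y = h x + 2 powr (real_of_int n) * (y - x)) \<and>
         (m \<noteq> n \<longrightarrow> dyadic x \<and> dyadic (h x))" by (rule bspec)
  then obtain \<epsilon> and m n :: int where *: "\<epsilon> > 0"
     "\<forall>y\<in>{x..x+\<epsilon>}. h y = h x + 2 powr (real_of_int m) * (y - x)"
     "\<forall>y\<in>{x-\<epsilon>..x}. h y = h x + 2 powr (real_of_int n) * (y - x)"
     "m \<noteq> n \<longrightarrow> dyadic x \<and> dyadic (h x)"
    by (elim exE conjE)
  show ?thesis
  proof (rule that[of \<epsilon> m n])
    show "\<epsilon> > 0" by fact
    show "h y = h x + 2 powr (real_of_int m) * (y - x)" if "x \<le> y" "y \<le> x + \<epsilon>" for y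
      by (rule *(2)[THEN bspec]) (use that in simp)
    show "h y = h x + 2 powr (real_of_int n) * (y - x)" if "x - \<epsilon> \<le> y" "y \<le> x" for y
      by (rule *(3)[THEN bspec]) (use that in simp)
    show "dyadic x \<and> dyadic (h x)" if "m \<noteq> n" using *(4) that by blast
  qed
qed

text \<open>Follow a linear piece to its right end: this is either a breakpoint, with dyadic
  coordinates, or the point (1, 1).\<close>

lemma brinA_dyadic_intercept:
  assumes h: "brinA h" and x: "0 < x" "x < 1" and \<epsilon>: "\<epsilon> > 0"
    and lin: "\<And>y. x \<le> y \<Longrightarrow> y \<le> x + \<epsilon> \<Longrightarrow> h y = h x + 2 powr (real_of_int m) * (y - x)"
  shows "dyadic (h x - 2 powr (real_of_int m) * x)"
proof -
  define \<beta> where "\<beta> = h x - 2 powr (real_of_int m) * x"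
  define T where "T = {y \<in> {x..1}. \<forall>z\<in>{x..y}. h z = 2 powr (real_of_int m) * z + \<beta>}"
  define s where "s = Sup T"
  have xT: "x \<in> T" using x by (auto simp: T_def \<beta>_def)
  have bdd: "bdd_above T" by (rule bdd_aboveI[of _ 1]) (auto simp: T_def)
  have lin': "h z = 2 powr (real_of_int m) * z + \<beta>" if "x \<le> z" "z \<le> x + \<epsilon>" for z
    using lin[OF that] unfolding \<beta>_def by (simp add: algebra_simps)
  have "min (x + \<epsilon>) 1 \<in> T" using x \<epsilon> lin' by (auto simp: T_def)
  then have xs: "x < s" using cSup_upper[OF _ bdd] x \<epsilon> unfolding s_def by fastforce
  have s1: "s \<le> 1" unfolding s_def using xT by (intro cSup_least) (auto simp: T_def)
  have below: "h z = 2 powr (real_of_int m) * z + \<beta>" if z: "x \<le> z" "z < s" for z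
  proof -
    obtain y where "y \<in> T" "z < y" using less_cSupD[of T z] xT z(2) unfolding s_def by blast
    then show ?thesis using z(1) by (auto simp: T_def)
  qed
  have hs: "h s = 2 powr (real_of_int m) * s + \<beta>"
  proof -
    have "continuous (at s within {0..1}) h"
      using brinA_cont_inj(1)[OF h] xs s1 x by (simp add: continuous_on_eq_continuous_within)
    then have "(h \<longlongrightarrow> h s) (at s within {x..s})"
      unfolding continuous_within by (rule tendsto_within_subset) (use x s1 in auto)
    then have "(h \<longlongrightarrow> h s) (at_left s)" by (simp only: at_within_Icc_at_left[OF xs])
    moreover have "((\<lambda>z. 2 powr (real_of_int m) * z + \<beta>) \<longlongrightarrow> 2 powr (real_of_int m) * s + \<beta>) (at_left s)"
      by (intro tendsto_intros)
    then have "(h \<longlongrightarrow> 2 powr (real_of_int m) * s + \<beta>) (at_left s)"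
    proof (rule Lim_transform_eventually)
      show "eventually (\<lambda>z. 2 powr (real_of_int m) * z + \<beta> = h z) (at_left s)"
        using eventually_at_left_real[OF xs] by eventually_elim (use below in auto)
    qed
    ultimately show ?thesis by (rule tendsto_unique[OF trivial_limit_at_left_real])
  qed
  show ?thesis
  proof (cases "s = 1")
    case True
    then have "\<beta> = - (2 powr (real_of_int m) * 1) + 1" using hs h by (simp add: brinA_def)
    moreover have "dyadic (- (2 powr (real_of_int m) * 1) + 1)"
      by (intro dyadic_add dyadic_uminus dyadic_powr_mult dyadic_1)
    ultimately show ?thesis unfolding \<beta>_def by metis
  next
    case False
    then have s: "0 < s" "s < 1" using s1 xs x by auto
    obtain e k n where e: "e > 0"
      "\<And>y. s \<le> y \<Longrightarrow> y \<le> s + e \<Longrightarrow> h y = h s + 2 powr (real_of_int k) * (y - s)"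
      "\<And>y. s - e \<le> y \<Longrightarrow> y \<le> s \<Longrightarrow> h y = h s + 2 powr (real_of_int n) * (y - s)"
      "k \<noteq> n \<Longrightarrow> dyadic s \<and> dyadic (h s)"
      using brinA_local[OF h s] by metis
    let ?y = "max x (s - e)"
    have y: "x \<le> ?y" "s - e \<le> ?y" "?y < s" using xs e(1) by auto
    have "2 powr (real_of_int m) * ?y + \<beta> = h s + 2 powr (real_of_int n) * (?y - s)"
      using below[OF y(1,3)] e(3)[OF y(2) less_imp_le[OF y(3)]] by (rule trans[OF sym])
    then have "(2 powr (real_of_int m) - 2 powr (real_of_int n)) * (?y - s) = 0"
      unfolding hs by (simp add: algebra_simps)
    then have "2 powr (real_of_int m) = 2 powr (real_of_int n)" using y(3) by simp
    then have mn: "m = n" by (simp add: powr_inj)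
    \<comment> \<open>An equal slope on the right would continue the piece beyond its supremum
      \<open>s\<close>. So \<open>s\<close> is a genuine breakpoint, and both its coordinates are
      dyadic by definition.\<close>
    have "k \<noteq> n"
    proof
      assume "k = n"
      let ?z = "min (s + e) 1"
      have "h z = 2 powr (real_of_int m) * z + \<beta>" if "x \<le> z" "z \<le> ?z" for z
      proof (cases "z < s")
        case False
        then have "h z = h s + 2 powr (real_of_int k) * (z - s)" by (intro e(2)) (use that in auto)
        then show ?thesis unfolding hs using mn \<open>k = n\<close> by (simp add: algebra_simps)
      qed (use below that in auto)
      then have "\<forall>z\<in>{x..?z}. h z = 2 powr (real_of_int m) * z + \<beta>" by simp
      then have "?z \<in> T" unfolding T_def using xs s e(1) by simp
      then have "?z \<le> s" unfolding s_def by (rule cSup_upper[OF _ bdd])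
      then show False using e(1) s by auto
    qed
    then have "dyadic s" "dyadic (h s)" using e(4) by blast+
    then have "dyadic (h s + - (2 powr (real_of_int m) * s))"
      by (intro dyadic_add dyadic_uminus dyadic_powr_mult)
    then show ?thesis using hs unfolding \<beta>_def by simp
  qed
qed

text \<open>Dyadic intercepts are what turns a linear piece into a prefix replacement on small
  cones.\<close>

lemma brinA_affine:
  assumes h: "brinA h" and x: "0 < x" "x < 1"
  obtains \<epsilon> m n a b where "\<epsilon> > 0" "dyadic a" "dyadic b"
    "\<And>y. x \<le> y \<Longrightarrow> y \<le> x + \<epsilon> \<Longrightarrow> h y = 2 powr (real_of_int m) * y + a"
    "\<And>y. x - \<epsilon> \<le> y \<Longrightarrow> y \<le> x \<Longrightarrow> h y = 2 powr (real_of_int n) * y + b"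
    "\<not> dyadic x \<Longrightarrow> m = n \<and> a = b"
proof -
  obtain \<epsilon> m n where e: "\<epsilon> > 0"
    "\<And>y. x \<le> y \<Longrightarrow> y \<le> x + \<epsilon> \<Longrightarrow> h y = h x + 2 powr (real_of_int m) * (y - x)"
    "\<And>y. x - \<epsilon> \<le> y \<Longrightarrow> y \<le> x \<Longrightarrow> h y = h x + 2 powr (real_of_int n) * (y - x)"
    "m \<noteq> n \<Longrightarrow> dyadic x \<and> dyadic (h x)"
    using brinA_local[OF h x] by metis
  \<comment> \<open>The piece to the left of x is the right-hand piece at this nearby point, so the
    statement about right-hand pieces applies. The bound x / 2 keeps it positive.\<close>
  define z where "z = max (x - \<epsilon>) (x / 2)"
  have z: "0 < z" "z < x" "x - \<epsilon> \<le> z" using x e(1) by (auto simp: z_def)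
  have hz: "h z = h x + 2 powr (real_of_int n) * (z - x)" by (rule e(3)) (use z in auto)
  have "dyadic (h z - 2 powr (real_of_int n) * z)"
  proof (rule brinA_dyadic_intercept[OF h, of z "x - z"])
    fix y assume "z \<le> y" "y \<le> z + (x - z)"
    then have "h y = h x + 2 powr (real_of_int n) * (y - x)" by (intro e(3)) (use z in auto)
    then show "h y = h z + 2 powr (real_of_int n) * (y - z)" unfolding hz by (simp add: algebra_simps)
  qed (use z x in auto)
  moreover have "h z - 2 powr (real_of_int n) * z = h x - 2 powr (real_of_int n) * x"
    unfolding hz by (simp add: algebra_simps)
  ultimately have b: "dyadic (h x - 2 powr (real_of_int n) * x)" by metis
  have a: "dyadic (h x - 2 powr (real_of_int m) * x)"
    by (rule brinA_dyadic_intercept[OF h x e(1) e(2)])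
  show ?thesis
  proof (rule that[OF e(1) a b])
    fix y assume "x \<le> y" "y \<le> x + \<epsilon>"
    from e(2)[OF this] show "h y = 2 powr (real_of_int m) * y + (h x - 2 powr (real_of_int m) * x)"
      by (simp add: algebra_simps)
  next
    fix y assume "x - \<epsilon> \<le> y" "y \<le> x"
    from e(3)[OF this] show "h y = 2 powr (real_of_int n) * y + (h x - 2 powr (real_of_int n) * x)"
      by (simp add: algebra_simps)
  next
    assume "\<not> dyadic x"
    then have "m = n" using e(4) by blast
    then show "m = n \<and> h x - 2 powr (real_of_int m) * x = h x - 2 powr (real_of_int n) * x" by simp
  qed
qed

lemma brinA_dyadic_iff:
  assumes h: "brinA h" and x: "0 \<le> x" "x \<le> 1"
  shows "dyadic (h x) \<longleftrightarrow> dyadic x"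
proof -
  consider "x = 0" | "x = 1" | "0 < x" "x < 1" using x by fastforce
  then show ?thesis
  proof cases
    case 3
    obtain \<epsilon> m n a b where "\<epsilon> > 0" "dyadic a" "dyadic b"
      "\<And>y. x \<le> y \<Longrightarrow> y \<le> x + \<epsilon> \<Longrightarrow> h y = 2 powr (real_of_int m) * y + a"
      using brinA_affine[OF h 3] by metis
    then show ?thesis using dyadic_affine[of a m x] by simp
  qed (use h dyadic_0 dyadic_1 in \<open>auto simp: brinA_def\<close>)
qed

lemma brinA_bounds:
  assumes h: "brinA h"
  shows "0 \<le> h (phi x)" "h (phi x) \<le> 1"
  using brinA_cont_inj(3)[OF h] phi_bounds[of x] by (metis atLeastAtMost_iff imageI)+

lemma exists_expansion:
  assumes "0 \<le> r" "r \<le> 1" "e \<Longrightarrow> dyadic r \<and> r < 1" "\<not> e \<Longrightarrow> 0 < r"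
  obtains y where "phi y = r" "ev0 y \<longleftrightarrow> e"
proof (cases e)
  case True
  then show ?thesis using exists_terminating_expansion[of r] assms that by metis
next
  case False
  then show ?thesis using exists_nonterminating_expansion[of r] assms that by metis
qed

text \<open>The definite description is legitimate: h preserves dyadic labels and the endpoints, so
  an expansion of the required kind exists, and \<open>phi_inject\<close> makes it unique.\<close>

lemma brin_act_spec:
  assumes h: "brinA h"
  shows "phi (brin_act h x) = h (phi x)" "ev0 (brin_act h x) \<longleftrightarrow> ev0 x"
proof -
  have h01: "h 0 = 0" "h 1 = 1" using h by (auto simp: brinA_def)
  have 1: "dyadic (h (phi x)) \<and> h (phi x) < 1" if "ev0 x"
    using ev0_phi[OF that] brinA_dyadic_iff[OF h phi_bounds] brinA_strict_mono[OF h phi_bounds(1), of x 1] h01 by auto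
  have 2: "0 < h (phi x)" if "\<not> ev0 x"
    using brinA_strict_mono[OF h, of 0 "phi x"] not_ev0_phi[OF that] phi_bounds[of x] h01 by simp
  obtain y where y: "phi y = h (phi x)" "ev0 y \<longleftrightarrow> ev0 x"
    using exists_expansion[OF brinA_bounds[OF h] 1 2] by blast
  have "phi (brin_act h x) = h (phi x) \<and> (ev0 (brin_act h x) \<longleftrightarrow> ev0 x)"
    unfolding brin_act_def by (rule theI[of _ y]) (use y phi_inject in auto)
  then show "phi (brin_act h x) = h (phi x)" "ev0 (brin_act h x) \<longleftrightarrow> ev0 x" by blast+
qed

lemma brin_act_eqI:
  assumes "brinA h" "phi y = h (phi x)" "ev0 y \<longleftrightarrow> ev0 x"
  shows "brin_act h x = y"
  by (rule phi_inject) (use brin_act_spec[OF assms(1), of x] assms(2,3) in auto)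

lemma brin_act_bij:
  assumes h: "brinA h" shows "bij (brin_act h)"
proof -
  have h01: "h 0 = 0" "h 1 = 1" using h by (auto simp: brinA_def)
  have "inj (brin_act h)"
  proof (rule injI)
    fix x y assume eq: "brin_act h x = brin_act h y"
    have "h (phi x) = h (phi y)" using brin_act_spec(1)[OF h] eq by metis
    then have "phi x = phi y"
      using inj_onD[OF brinA_cont_inj(2)[OF h], of "phi x" "phi y"] phi_bounds by simp
    moreover have "ev0 x \<longleftrightarrow> ev0 y" using brin_act_spec(2)[OF h] eq by metis
    ultimately show "x = y" by (rule phi_inject)
  qed
  moreover have "\<exists>x. y = brin_act h x" for y
  proof -
    have "phi y \<in> h ` {0..1}" using brinA_cont_inj(3)[OF h] phi_bounds[of y] by simp
    then obtain r where r: "0 \<le> r" "r \<le> 1" "h r = phi y" by auto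
    have "dyadic r \<and> r < 1" if "ev0 y"
    proof -
      have "r \<noteq> 1" using ev0_phi(2)[OF that] r h01 by auto
      then show ?thesis using ev0_phi(1)[OF that] brinA_dyadic_iff[OF h r(1,2)] r by simp
    qed
    moreover have "0 < r" if "\<not> ev0 y"
    proof -
      have "r \<noteq> 0" using not_ev0_phi[OF that] r h01 by auto
      then show ?thesis using r(1) by simp
    qed
    ultimately obtain x where "phi x = r" "ev0 x \<longleftrightarrow> ev0 y"
      using exists_expansion[OF r(1,2)] by metis
    then have "brin_act h x = y" using r(3) by (intro brin_act_eqI[OF h]) auto
    then show ?thesis by blast
  qed
  ultimately show ?thesis unfolding bij_def surj_def by blast
qed

lemma brin_act_lt:
  assumes h: "brinA h" and "lt c x y"
  shows "lt c (brin_act h x) (brin_act h y)"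
proof -
  have F: "lt False (brin_act h x) (brin_act h y)" if l: "lt False x y" for x y
  proof -
    have ne: "brin_act h x \<noteq> brin_act h y"
      using l brin_act_bij[OF h] by (metis bij_is_inj injD lt_irrefl)
    have "\<not> lt False (brin_act h y) (brin_act h x)"
    proof
      assume "lt False (brin_act h y) (brin_act h x)"
      from lt_phi[OF this] have *: "h (phi y) < h (phi x) \<or> h (phi y) = h (phi x) \<and> \<not> ev0 y"
        unfolding brin_act_spec[OF h] by blast
      from lt_phi[OF l] show False
      proof
        assume "phi x < phi y"
        then have "h (phi x) < h (phi y)" using brinA_strict_mono[OF h] phi_bounds by blast
        then show False using * by simp
      next
        assume "phi x = phi y \<and> (\<exists>a. x = cat a (cst True)) \<and> ev0 y \<and> \<not> ev0 x"
        then show False using * by simp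
      qed
    qed
    then show ?thesis using ne lt_linear by blast
  qed
  have flip: "lt True x y \<longleftrightarrow> lt False y x" for x y unfolding lt_def by metis
  show ?thesis using F assms(2) flip by (cases c) auto
qed

text \<open>With dyadic intercept and slope a power of 2, a sufficiently small dyadic interval is
  mapped onto a dyadic interval, that is, a cone onto a cone.\<close>

lemma brin_act_regular_if_affine:
  assumes h: "brinA h" and b: "dyadic b"
    and aff: "\<And>N w. N \<ge> N0 \<Longrightarrow> h (phi (cat (pre N x) w)) = 2 powr (real_of_int m) * phi (cat (pre N x) w) + b"
  shows "regular (brin_act h) x"
proof -
  obtain k where k: "\<And>N. N \<ge> k \<Longrightarrow> \<exists>c::int. b = of_int c / 2 ^ N" using dyadic_common[OF b] by blast
  \<comment> \<open>Chosen so that \<open>M\<close> = N - m, the depth of the image cone, is at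
    least \<open>k\<close>; then the intercept is a multiple of 2^{-M} and the left end of the image
    is C / 2^M with an integer C.\<close>
  define N where "N = N0 + k + 2 * nat \<bar>m\<bar>"
  define M where "M = nat (int N - m)"
  have M: "int M = int N - m" "M \<ge> k" unfolding M_def N_def by linarith+
  let ?u = "pre N x"
  have "real_of_int m = real N - real M" using M(1) by linarith
  then have powr: "2 powr (real_of_int m) = (2 :: real) ^ N / 2 ^ M"
    by (simp add: powr_diff powr_realpow)
  obtain a where a: "val ?u = real a / 2 ^ N" using val_nat[of ?u] by auto
  obtain d :: int where d: "b = of_int d / 2 ^ M" using k[OF M(2)] by blast
  define C where "C = int a + d"
  have val: "h (phi (cat ?u w)) = (real_of_int C + phi w) / 2 ^ M" for w
  proof -
    have "N \<ge> N0" by (simp add: N_def)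
    have "phi (cat ?u w) = (real a + phi w) / 2 ^ N" by (simp add: phi_cat a add_divide_distrib)
    then have "2 powr (real_of_int m) * phi (cat ?u w) = (real a + phi w) / 2 ^ M" unfolding powr by simp
    then show ?thesis unfolding aff[OF \<open>N \<ge> N0\<close>] d C_def by (simp add: add_divide_distrib)
  qed
  have "0 \<le> real_of_int C / 2 ^ M" using val[of "cst False"] brinA_bounds(1)[OF h, of "cat ?u (cst False)"] by simp
  then have "0 \<le> real_of_int C / 2 ^ M * 2 ^ M" by (rule mult_nonneg_nonneg) simp
  then have C0: "0 \<le> C" by simp
  have "(real_of_int C + 1) / 2 ^ M \<le> 1" using val[of "cst True"] brinA_bounds(2)[OF h, of "cat ?u (cst True)"] by simp
  then have "real_of_int (C + 1) \<le> real_of_int (2 ^ M)" by (simp add: divide_le_eq)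
  then have "C < 2 ^ M" unfolding of_int_le_iff by simp
  then have "nat C < 2 ^ M" using C0 by (simp add: nat_less_iff)
  then obtain v where v: "length v = M" "val v = real (nat C) / 2 ^ M" using val_surj by blast
  have "brin_act h (cat ?u w) = cat v w" for w
  proof (rule brin_act_eqI[OF h])
    show "phi (cat v w) = h (phi (cat ?u w))"
      unfolding val using v C0 by (simp add: phi_cat add_divide_distrib)
  qed simp
  from regularI[of "brin_act h", OF this] show ?thesis by (metis cat_pre_sdrop)
qed

lemma half_power_less:
  assumes "0 < (\<epsilon> :: real)" obtains N where "\<And>n. n \<ge> N \<Longrightarrow> 1 / 2 ^ n \<le> \<epsilon>"
proof -
  obtain N where N: "1 / \<epsilon> < 2 ^ N" using real_arch_pow[of 2 "1 / \<epsilon>"] by auto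
  have "1 / 2 ^ n \<le> \<epsilon>" if "n \<ge> N" for n
  proof -
    have "(2 :: real) ^ N \<le> 2 ^ n" using that by simp
    then have "1 / \<epsilon> \<le> 2 ^ n" using N by linarith
    then show ?thesis using assms by (simp add: field_simps)
  qed
  then show ?thesis by (rule that)
qed

text \<open>Small cones around p^+ lie to the right of p and those around p^- to the left, so one
  linear piece is seen in either case. At a non-dyadic label there is no breakpoint and both pieces
  coincide.\<close>

lemma brin_act_regular:
  assumes h: "brinA h" and x: "0 < phi x" "phi x < 1"
  shows "regular (brin_act h) x"
proof -
  obtain \<epsilon> m n a b where e: "\<epsilon> > 0" and ab: "dyadic a" "dyadic b" and
    aff: "\<And>y. phi x \<le> y \<Longrightarrow> y \<le> phi x + \<epsilon> \<Longrightarrow> h y = 2 powr (real_of_int m) * y + a"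
    "\<And>y. phi x - \<epsilon> \<le> y \<Longrightarrow> y \<le> phi x \<Longrightarrow> h y = 2 powr (real_of_int n) * y + b"
    and same: "\<not> dyadic (phi x) \<Longrightarrow> m = n \<and> a = b"
    using brinA_affine[OF h x] by metis
  obtain N0 where N0: "\<And>n. n \<ge> N0 \<Longrightarrow> 1 / 2 ^ n \<le> \<epsilon>" using half_power_less[OF e] by blast
  have diff: "phi (cat (pre N x) w) = phi x + (phi w - phi (sdrop N x)) / 2 ^ N" for N w
    using phi_cat[of "pre N x" w] phi_cat[of "pre N x" "sdrop N x"] by (simp add: diff_divide_distrib)
  have close: "phi x - \<epsilon> \<le> phi (cat (pre N x) w)" "phi (cat (pre N x) w) \<le> phi x + \<epsilon>" if "N \<ge> N0" for N w
  proof -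
    have "(phi w - phi (sdrop N x)) / 2 ^ N \<le> 1 / 2 ^ N"
      using phi_bounds[of w] phi_bounds[of "sdrop N x"] by (intro divide_right_mono) simp_all
    moreover have "(- 1) / 2 ^ N \<le> (phi w - phi (sdrop N x)) / 2 ^ N"
      using phi_bounds[of w] phi_bounds[of "sdrop N x"] by (intro divide_right_mono) simp_all
    ultimately have "(phi w - phi (sdrop N x)) / 2 ^ N \<le> 1 / 2 ^ N" "- (1 / 2 ^ N) \<le> (phi w - phi (sdrop N x)) / 2 ^ N"
      by simp_all
    then show "phi x - \<epsilon> \<le> phi (cat (pre N x) w)" "phi (cat (pre N x) w) \<le> phi x + \<epsilon>"
      unfolding diff[of N w] using N0[OF that] by linarith+
  qed
  show ?thesis
  proof (cases "ev0 x")
    case True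
    then obtain N1 where N1: "\<And>n. n \<ge> N1 \<Longrightarrow> sdrop n x = cst False" using ev0E by blast
    show ?thesis
    proof (rule brin_act_regular_if_affine[OF h ab(1), of "N0 + N1"])
      fix N w assume N: "N \<ge> N0 + N1"
      have "phi x \<le> phi (cat (pre N x) w)" unfolding diff[of N w] using N1[of N] N phi_bounds(1)[of w] by simp
      then show "h (phi (cat (pre N x) w)) = 2 powr (real_of_int m) * phi (cat (pre N x) w) + a"
        using close(2)[of N w] N by (intro aff(1)) auto
    qed
  next
    case nev: False
    show ?thesis
    proof (cases "dyadic (phi x)")
      case True
      then obtain u where u: "x = cat u (cst True)" using dyadic_phi_cases nev x(2) by metis
      show ?thesis
      proof (rule brin_act_regular_if_affine[OF h ab(2), of "N0 + length u"])
        fix N w assume N: "N \<ge> N0 + length u"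
        have "sdrop N x = cst True" unfolding u using N by (auto simp: sdrop_def cat_def)
        then have "phi (cat (pre N x) w) \<le> phi x"
          unfolding diff[of N w] using phi_bounds(2)[of w] by (simp add: divide_nonpos_pos)
        then show "h (phi (cat (pre N x) w)) = 2 powr (real_of_int n) * phi (cat (pre N x) w) + b"
          using close(1)[of N w] N by (intro aff(2)) auto
      qed
    next
      case False
      show ?thesis
      proof (rule brin_act_regular_if_affine[OF h ab(1), of N0])
        fix N w assume N: "N \<ge> N0"
        show "h (phi (cat (pre N x) w)) = 2 powr (real_of_int m) * phi (cat (pre N x) w) + a"
          using close[OF N, of w] aff same[OF False] by (cases "phi x \<le> phi (cat (pre N x) w)") auto
      qed
    qed
  qed
qed

text \<open>The germs at 0^+ and at 1^-: the functional equations for h near 0 and near 1 say that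
  the action commutes with prepending 0 and 1 respectively.\<close>

lemma brin_act_germ:
  assumes h: "brinA h"
  obtains j where "germ (brin_act h) (replicate j c) [] c (\<lambda>w. brin_act h (cat (replicate j c) w))"
proof -
  have "\<exists>\<epsilon>>0. \<forall>x\<in>{0..\<epsilon>}. h (2 * x) = 2 * h x" using h unfolding brinA_def by (elim conjE)
  moreover have "\<exists>\<epsilon>>0. \<forall>x\<in>{1-\<epsilon>..1}. h (2 * x - 1) = 2 * h x - 1" using h unfolding brinA_def by (elim conjE)
  ultimately obtain \<epsilon>0 \<epsilon>1 where e0: "\<epsilon>0 > 0" "\<forall>x\<in>{0..\<epsilon>0}. h (2 * x) = 2 * h x"
    and e1: "\<epsilon>1 > 0" "\<forall>x\<in>{1-\<epsilon>1..1}. h (2 * x - 1) = 2 * h x - 1" by blast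
  have "min \<epsilon>0 \<epsilon>1 > 0" using e0 e1 by simp
  then obtain N where N: "\<And>n. n \<ge> N \<Longrightarrow> 1 / 2 ^ n \<le> min \<epsilon>0 \<epsilon>1" using half_power_less by blast
  \<comment> \<open>\<open>Suc\<close> ensures 1/2^j <= 1/2, which keeps the cone away from the
    opposite endpoint of [0,1].\<close>
  define j where "j = Suc N"
  let ?u = "replicate j c"
  have j: "1 / 2 ^ j \<le> \<epsilon>0" "1 / 2 ^ j \<le> \<epsilon>1" using N[of j] by (auto simp: j_def)
  have u: "phi (cat ?u w) \<le> 1 / 2 ^ j" if "\<not> c" for w
    using that phi_replicate(1)[of j w] phi_bounds(2)[of w] by (simp add: divide_right_mono)
  have u': "1 - 1 / 2 ^ j \<le> phi (cat ?u w)" if c for w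
    using that phi_replicate(2)[of j w] phi_bounds(1)[of w] by (simp add: divide_right_mono)
  have half: "1 / 2 ^ j \<le> (1 / 2 :: real)" by (simp add: j_def field_simps)
  have "germ (brin_act h) ?u [] c (\<lambda>w. brin_act h (cat ?u w))"
    unfolding germ_def
  proof (intro conjI allI impI)
    fix w
    have sh: "cat ?u (cat [c] w) = cat [c] (cat ?u w)"
      by (simp only: cat_append[symmetric] append_Cons append_Nil replicate_append_same)
    show "brin_act h (cat ?u (cat [c] w)) = cat [c] (brin_act h (cat ?u w))"
    proof (rule brin_act_eqI[OF h])
      let ?p = "phi (cat ?u w)"
      have "h (((if c then 1 else 0) + ?p) / 2) = ((if c then 1 else 0) + h ?p) / 2"
      proof (cases c)
        case False
        have "?p / 2 \<in> {0..\<epsilon>0}" using u[OF False, of w] j phi_bounds(1)[of "cat ?u w"] by auto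
        then have "h (2 * (?p / 2)) = 2 * h (?p / 2)" using e0(2) by blast
        then show ?thesis using False by simp
      next
        case True
        have "(1 + ?p) / 2 \<in> {1 - \<epsilon>1..1}" using u'[OF True, of w] j phi_bounds[of "cat ?u w"] by auto
        then have "h (2 * ((1 + ?p) / 2) - 1) = 2 * h ((1 + ?p) / 2) - 1" using e1(2) by blast
        moreover have "2 * ((1 + ?p) / 2) - 1 = ?p" by (simp add: field_simps)
        ultimately have "h ?p = 2 * h ((1 + ?p) / 2) - 1" by metis
        then show ?thesis using True by simp
      qed
      then show "phi (cat [c] (brin_act h (cat ?u w))) = h (phi (cat ?u (cat [c] w)))"
        unfolding sh phi_cat_singleton brin_act_spec[OF h] by simp
    qed (simp add: brin_act_spec[OF h])
  next
    fix w w' assume "lt c w w'"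
    then show "lt c (brin_act h (cat ?u w)) (brin_act h (cat ?u w'))" by (intro brin_act_lt[OF h]) simp
  next
    fix w assume "w \<noteq> cst c"
    then have ne: "cat ?u w \<noteq> cst c" by (simp add: cat_eq_cst)
    have "0 < phi (cat ?u w) \<and> phi (cat ?u w) < 1"
    proof (cases c)
      case False
      have "phi (cat ?u w) \<noteq> 0"
      proof
        assume "phi (cat ?u w) = 0"
        from phi_eq_0[OF this] show False using ne False by simp
      qed
      then show ?thesis using u[OF False, of w] half phi_bounds(1)[of "cat ?u w"] by linarith
    next
      case True
      have "phi (cat ?u w) \<noteq> 1"
      proof
        assume "phi (cat ?u w) = 1"
        from phi_eq_1[OF this] show False using ne True by simp
      qed
      then show ?thesis using u'[OF True, of w] half phi_bounds(2)[of "cat ?u w"] by linarith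
    qed
    then show "regular (brin_act h) (cat ?u w)" using brin_act_regular[OF h] by blast
  qed simp
  then show ?thesis by (rule that)
qed

lemma brin_act_G:
  assumes h: "brinA h" shows "brin_act h \<in> G"
proof -
  have "regular (brin_act h) x \<or> selfsim (brin_act h) x" for x
  proof (cases "\<exists>c. x = cst c")
    case True
    then obtain c where c: "x = cst c" by blast
    obtain j where "germ (brin_act h) (replicate j c) [] c (\<lambda>w. brin_act h (cat (replicate j c) w))"
      using brin_act_germ[OF h] by blast
    moreover have "x = cat (replicate j c) (cst c)" using c by simp
    ultimately show ?thesis unfolding selfsim_def by blast
  next
    case False
    then have "phi x \<noteq> 0" "phi x \<noteq> 1" using phi_eq_0 phi_eq_1 by blast+
    then show ?thesis using brin_act_regular[OF h, of x] phi_bounds[of x] by simp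
  qed
  then show ?thesis using brin_act_bij[OF h] by (simp add: G_def)
qed

lemma VA_subset_G: "VA \<subseteq> G"
proof
  fix f assume "f \<in> VA"
  then show "f \<in> G"
  proof induction
    case (V f) then show ?case by (rule thompsonV_G)
  next
    case (A h) then show ?case by (rule brin_act_G)
  next
    case (comp f g) show ?case by (rule G_comp[OF comp.IH])
  next
    case (inverse f) show ?case by (rule G_inv[OF inverse.IH])
  qed
qed

lemma VA_funpow: "f \<in> VA \<Longrightarrow> f ^^ n \<in> VA"
proof (induction n)
  case 0
  have "inv f \<circ> f = id" using 0 VA_subset_G G_bij by (metis bij_is_inj inv_o_cancel subsetD)
  then show ?case using VA.comp[OF 0 VA.inverse[OF 0]] by (metis funpow.simps(1))
next
  case (Suc n)
  then show ?case using VA.comp[of "f ^^ n" f] by (metis funpow.simps(2))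
qed

theorem mainTheorem1:
  fixes f :: "cantor \<Rightarrow> cantor" and S :: "(cantor \<Rightarrow> cantor) set"
  assumes "f \<in> VA"
    and "\<forall>n::nat. n > 0 \<longrightarrow> f ^^ n \<noteq> id"
    and "finite S"
    and "generates_VA S"
  shows "\<exists>C>0. \<forall>k::int. real_of_int \<bar>k\<bar> \<le> C * real (word_length S (ipow f k)) + C"
proof -
  have f: "f \<in> G" and SG: "S \<subseteq> G"
    using assms(1,4) VA_subset_G unfolding generates_VA_def by blast+
  have bij: "bij f" using f by (rule G_bij)
  have "lin S f" using lin_if_infinite_order[OF assms(3) SG f] assms(2) by blast
  then obtain C where C: "\<And>K w. word_over S w \<Longrightarrow> eval_word w = f ^^ K \<Longrightarrow> K \<le> C * Suc (length w)"
    unfolding lin_def by blast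
  \<comment> \<open>\<open>Suc C\<close> in place of \<open>C\<close> makes the constant
    positive.\<close>
  have bound: "real_of_int \<bar>k\<bar> \<le> real (Suc C) * real (word_length S (ipow f k)) + real (Suc C)" for k :: int
  proof -
    have "ipow f k \<in> VA" using assms(1) by (simp add: ipow_def VA_funpow VA.inverse)
    then have "\<exists>w. word_over S w \<and> eval_word w = ipow f k"
      using assms(4) unfolding generates_VA_def word_over_def by blast
    then have "\<exists>n w. length w = n \<and> set (map snd w) \<subseteq> S \<and> eval_word w = ipow f k"
      unfolding word_over_def by blast
    from LeastI_ex[OF this] obtain w where
      w: "length w = word_length S (ipow f k)" "word_over S w" "eval_word w = ipow f k"
      unfolding word_length_def word_over_def by blast
    have "nat \<bar>k\<bar> \<le> C * Suc (length w)"
    proof (cases "0 \<le> k")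
      case True
      then show ?thesis using C[OF w(2), of "nat k"] w(3) by (simp add: ipow_def)
    next
      case False
      \<comment> \<open>A negative power is handled through the inverse word, which has the same
        length.\<close>
      have "eval_word (inv_word w) = f ^^ nat (- k)"
        using eval_inv_word[OF SG w(2)] w(3) False inv_funpow[OF bij, of "nat (- k)"] bij_fn[OF bij, of "nat (- k)"]
        by (simp add: ipow_def) (metis inv_inv_eq)
      then show ?thesis using C[of "inv_word w" "nat (- k)"] w(2) False by simp
    qed
    then have "real (nat \<bar>k\<bar>) \<le> real (C * Suc (length w))" by (rule of_nat_mono)
    also have "\<dots> \<le> real (Suc C) * real (length w) + real (Suc C)" by (simp add: algebra_simps)
    finally show ?thesis using w(1) by simp
  qed
  show ?thesis by (rule exI[of _ "real (Suc C)"]) (use bound in simp)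
qed

end
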